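(* In the linear homoskedastic model described in the context, assume that the design vectors $x_{1,n},\dots,x_{n,n}$ are i.i.d. Gaussian with mean $\mu_n\in\mathbb{R}^{p_n}$ and positive definite covariance matrix $\Sigma_n$, and that the design $X_n=[x_{1,n},\dots,x_{n,n}]'$ is independent of the errors $(\varepsilon_{1,n},\dots,\varepsilon_{n,n})'$, which satisfy $\mathbb{E}[(\varepsilon_{1,n}/\sigma_n)^4]=O(1)$ as $n\to\infty$. Moreover, suppose that $\limsup_np_n/n<1$, $\Delta_\gamma=o(q_n/n)$, and that the null hypothesis does not involve a restriction on the intercept parameter (i.e., the first column of $R_0$ is equal to zero). Then $$\sup_{t\in\mathbb{R}}\left|\mathbb{P}(F_n\le t)-\mathbb{P}\left(F_{q_n,n-p_n-1}(\lambda_n)\le t\right)\right|\;\xrightarrow[n\to\infty]{}\;0,$$ where $F_{q_n,n-p_n-1}(\lambda_n)$ denotes a random variable following the non-central $F$-distribution with $q_n$ and $n-p_n-1$ degrees of freedom and non-centrality parameter $\lambda_n=\Delta_\gamma(n-p_n-1+q_n)$.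
   Context: Model. For each $n$, $p_n$ is a positive integer with $p_n<n-1$ and $(y_{i,n},x_{i,n})_{i=1}^n$ are i.i.d. pairs, $y_{i,n}$ real-valued and $x_{i,n}$ a random vector in $\mathbb{R}^{p_n}$, with $\mathbb{E}[y_{1,n}|x_{1,n}]=\alpha_n+\beta_n'x_{1,n}$ and $\mathrm{Var}[y_{1,n}|x_{1,n}]=\sigma_n^2\in(0,\infty)$ (non-random); $\varepsilon_{i,n}=y_{i,n}-\mathbb{E}[y_{i,n}|x_{i,n}]$. Let $\mu_n=\mathbb{E}[x_{1,n}]$ and $\Sigma_n=\mathrm{Var}[x_{1,n}]$. Write $Y=(y_{1,n},\dots,y_{n,n})'$, $\iota_n=(1,\dots,1)'\in\mathbb{R}^n$, $U=[\iota_n,X_n]$, $\gamma=(\alpha_n,\beta_n')'$. The prime denotes transpose. Hypothesis and test statistic. $R_0$ (depending on $n$) is a $q_n\times(p_n+1)$ non-random matrix of rank $q_n$, $1\le q_n\le p_n+1$, normalized to have orthonormal rows, and $r_0\in\mathbb{R}^{q_n}$; the null hypothesis is $H_0:R_0\gamma=r_0$. With $\hat\gamma_n=(U'U)^{-1}U'Y$, $$F_n=\frac{(R_0\hat\gamma_n-r_0)'(R_0(U'U)^{-1}R_0')^{-1}(R_0\hat\gamma_n-r_0)/q_n}{\|Y-U\hat\gamma_n\|^2/(n-p_n-1)}$$ whenever all appearing quantities are well defined, and $F_n=0$ otherwise. Further, $S_n=\begin{bmatrix}1&\mu_n'\\ \mu_n&\Sigma_n+\mu_n\mu_n'\end{bmatrix}$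 and $\Delta_\gamma=(R_0\gamma-r_0)'(R_0S_n^{-1}R_0')^{-1}(R_0\gamma-r_0)/\sigma_n^2$. Convention. The non-central $F$-distribution with $q$ and $m$ degrees of freedom and non-centrality parameter $\lambda$ is the law of $\frac{\sum_{i=1}^q(Y_i+a_i)^2/q}{\sum_{j=1}^mX_j^2/m}$ with $Y_i,X_j$ i.i.d. standard normal and $\sum_ia_i^2=\lambda$. *)

theory Defs
  imports
    "HOL-Probability.Probability"
    "HOL-Library.Landau_Symbols"
    "Jordan_Normal_Form.Gauss_Jordan_Elimination"
    "Jordan_Normal_Form.DL_Rank"
begin

unbundle no inner_syntax
unbundle no vec_syntax
hide_const (open) Finite_Cartesian_Product.vec Finite_Cartesian_Product.mat

text \<open>
  All dimensions vary with the sample size \<open>n\<close>, so matrices and non-random vectors are those of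
  \<open>Jordan_Normal_Form\<close>. Indices start at \<open>0\<close>: observations are \<open>i < n\<close>, coordinates \<open>j < p\<close>.
  A random vector in \<open>R^p\<close> is a measurable map into the product space \<open>borel_vec p\<close>.
\<close>

abbreviation borel_vec :: "nat \<Rightarrow> (nat \<Rightarrow> real) measure" where
  "borel_vec p \<equiv> PiM {..<p} (\<lambda>_. borel)"

abbreviation std_normal_vec :: "nat \<Rightarrow> (nat \<Rightarrow> real) measure" where
  "std_normal_vec p \<equiv> PiM {..<p} (\<lambda>_. std_normal_distribution)"


text \<open>
  The library constant \<open>indep_var\<close> needs both random variables to have the same value type.
\<close>

definition independent_rv ::
    "'w measure \<Rightarrow> 'a measure \<Rightarrow> ('w \<Rightarrow> 'a) \<Rightarrow> 'b measure \<Rightarrow> ('w \<Rightarrow> 'b) \<Rightarrow> bool" where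
  "independent_rv M N X N' Y \<longleftrightarrow> X \<in> measurable M N \<and> Y \<in> measurable M N' \<and>
     prob_space.indep_set M (sets (vimage_algebra (space M) X N))
                            (sets (vimage_algebra (space M) Y N'))"


subsection \<open>Moments and Gaussian random vectors\<close>

definition mean_vector :: "'w measure \<Rightarrow> nat \<Rightarrow> ('w \<Rightarrow> nat \<Rightarrow> real) \<Rightarrow> real vec" where
  "mean_vector M p X = vec p (\<lambda>j. \<integral>\<omega>. X \<omega> j \<partial>M)"

definition covariance_matrix :: "'w measure \<Rightarrow> nat \<Rightarrow> ('w \<Rightarrow> nat \<Rightarrow> real) \<Rightarrow> real mat" where
  "covariance_matrix M p X = mat p p (\<lambda>(j, k).
     \<integral>\<omega>. (X \<omega> j - mean_vector M p X $ j) * (X \<omega> k - mean_vector M p X $ k) \<partial>M)"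

definition positive_definite :: "nat \<Rightarrow> real mat \<Rightarrow> bool" where
  "positive_definite p S \<longleftrightarrow> S \<in> carrier_mat p p \<and> S\<^sup>T = S \<and>
     (\<forall>v \<in> carrier_vec p. v \<noteq> 0\<^sub>v p \<longrightarrow> v \<bullet> (S *\<^sub>v v) > 0)"

text \<open>
  \<open>N(\<mu>, \<Sigma>)\<close> is the law of \<open>\<mu> + A Z\<close>, where \<open>A A' = \<Sigma>\<close> and \<open>Z\<close> has i.i.d. standard normal
  coordinates; the law does not depend on the choice of the square matrix \<open>A\<close>.
\<close>

definition gaussian_vector ::
    "'w measure \<Rightarrow> nat \<Rightarrow> ('w \<Rightarrow> nat \<Rightarrow> real) \<Rightarrow> real vec \<Rightarrow> real mat \<Rightarrow> bool" where
  "gaussian_vector M p X \<mu> \<Sigma> \<longleftrightarrow>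
     X \<in> measurable M (borel_vec p) \<and> \<mu> \<in> carrier_vec p \<and>
     (\<exists>A \<in> carrier_mat p p. A * A\<^sup>T = \<Sigma> \<and>
        distr M (borel_vec p) X =
        distr (std_normal_vec p) (borel_vec p) (\<lambda>z. \<lambda>j\<in>{..<p}. (\<mu> + A *\<^sub>v vec p z) $ j))"


subsection \<open>The linear homoskedastic model\<close>

definition cond_expectation ::
    "'w measure \<Rightarrow> nat \<Rightarrow> ('w \<Rightarrow> nat \<Rightarrow> real) \<Rightarrow> ('w \<Rightarrow> real) \<Rightarrow> 'w \<Rightarrow> real" where
  "cond_expectation M p X Y = real_cond_exp M (vimage_algebra (space M) X (borel_vec p)) Y"

definition model_error ::
    "'w measure \<Rightarrow> nat \<Rightarrow> ('w \<Rightarrow> nat \<Rightarrow> real) \<Rightarrow> ('w \<Rightarrow> real) \<Rightarrow> 'w \<Rightarrow> real" where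
  "model_error M p X Y \<omega> = Y \<omega> - cond_expectation M p X Y \<omega>"

definition cond_variance ::
    "'w measure \<Rightarrow> nat \<Rightarrow> ('w \<Rightarrow> nat \<Rightarrow> real) \<Rightarrow> ('w \<Rightarrow> real) \<Rightarrow> 'w \<Rightarrow> real" where
  "cond_variance M p X Y = cond_expectation M p X (\<lambda>\<omega>. (model_error M p X Y \<omega>)\<^sup>2)"

text \<open>
  The sample consists of \<open>n\<close> i.i.d. pairs \<open>(y i, x i)\<close>. The conditional moments are prescribed for
  the first pair only; the others inherit them.
\<close>

definition linear_homoskedastic_model ::
    "'w measure \<Rightarrow> nat \<Rightarrow> nat \<Rightarrow> (nat \<Rightarrow> 'w \<Rightarrow> real) \<Rightarrow> (nat \<Rightarrow> 'w \<Rightarrow> nat \<Rightarrow> real) \<Rightarrow>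
     real \<Rightarrow> real vec \<Rightarrow> real \<Rightarrow> bool" where
  "linear_homoskedastic_model M n p y x \<alpha> \<beta> \<sigma> \<longleftrightarrow>
     prob_space M \<and> 0 < p \<and> p < n - 1 \<and> \<beta> \<in> carrier_vec p \<and> 0 < \<sigma> \<and>
     prob_space.indep_vars M (\<lambda>_. borel \<Otimes>\<^sub>M borel_vec p) (\<lambda>i \<omega>. (y i \<omega>, x i \<omega>)) {..<n} \<and>
     (\<forall>i<n. distr M (borel \<Otimes>\<^sub>M borel_vec p) (\<lambda>\<omega>. (y i \<omega>, x i \<omega>)) =
            distr M (borel \<Otimes>\<^sub>M borel_vec p) (\<lambda>\<omega>. (y 0 \<omega>, x 0 \<omega>))) \<and>
     integrable M (y 0) \<and>
     (AE \<omega> in M. cond_expectation M p (x 0) (y 0) \<omega> = \<alpha> + \<beta> \<bullet> vec p (x 0 \<omega>)) \<and>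
     (AE \<omega> in M. cond_variance M p (x 0) (y 0) \<omega> = \<sigma>\<^sup>2)"


subsection \<open>The \<open>F\<close>-statistic and the non-centrality\<close>

text \<open>The matrix \<open>U = [\<iota>, X]\<close>, whose columns are indexed by \<open>0, ..., p\<close>.\<close>

definition regressor_matrix ::
    "nat \<Rightarrow> nat \<Rightarrow> (nat \<Rightarrow> 'w \<Rightarrow> nat \<Rightarrow> real) \<Rightarrow> 'w \<Rightarrow> real mat" where
  "regressor_matrix n p x \<omega> = mat n (p + 1) (\<lambda>(i, j). if j = 0 then 1 else x i \<omega> (j - 1))"

text \<open>
  Here \<open>dim_row R = q\<close> and \<open>dim_row U - dim_col U = n - p - 1\<close>. The value is \<open>0\<close> if one of the two
  inverses does not exist or the residual vector vanishes.
\<close>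

definition F_statistic :: "real mat \<Rightarrow> real vec \<Rightarrow> real mat \<Rightarrow> real vec \<Rightarrow> real" where
  "F_statistic U Y R r =
     (case mat_inverse (U\<^sup>T * U) of None \<Rightarrow> 0 | Some G \<Rightarrow>
     (case mat_inverse (R * G * R\<^sup>T) of None \<Rightarrow> 0 | Some H \<Rightarrow>
       (let g = G *\<^sub>v (U\<^sup>T *\<^sub>v Y);
            d = R *\<^sub>v g - r;
            e = Y - U *\<^sub>v g
        in if e \<bullet> e = 0 then 0
           else (d \<bullet> (H *\<^sub>v d) / real (dim_row R)) /
                (e \<bullet> e / real (dim_row U - dim_col U)))))"

definition second_moment_matrix :: "nat \<Rightarrow> real vec \<Rightarrow> real mat \<Rightarrow> real mat" where
  "second_moment_matrix p \<mu> \<Sigma> =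
     four_block_mat (1\<^sub>m 1) (mat_of_rows p [\<mu>])
                    (mat_of_cols p [\<mu>]) (\<Sigma> + mat_of_cols p [\<mu>] * mat_of_rows p [\<mu>])"

text \<open>
  The inverses below exist when \<open>\<Sigma>\<close> is positive definite and \<open>R\<close> has linearly independent rows.
\<close>

definition Delta_gamma ::
    "real mat \<Rightarrow> real mat \<Rightarrow> real vec \<Rightarrow> real vec \<Rightarrow> real \<Rightarrow> real" where
  "Delta_gamma S R r \<gamma> \<sigma> =
     (let d = R *\<^sub>v \<gamma> - r
      in d \<bullet> (the (mat_inverse (R * the (mat_inverse S) * R\<^sup>T)) *\<^sub>v d) / \<sigma>\<^sup>2)"


subsection \<open>The non-central \<open>F\<close>-distribution\<close>

text \<open>
  The first \<open>q\<close> coordinates of \<open>z\<close> are the numerator variables, the remaining \<open>m\<close> the denominator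
  variables. The law depends on the shifts \<open>a\<close> only through \<open>\<lambda>\<close>.
\<close>

definition noncentral_F :: "nat \<Rightarrow> nat \<Rightarrow> real \<Rightarrow> real measure \<Rightarrow> bool" where
  "noncentral_F q m lam L \<longleftrightarrow>
     (\<exists>a. (\<Sum>i<q. (a i)\<^sup>2) = lam \<and>
        L = distr (std_normal_vec (q + m)) borel
              (\<lambda>z. ((\<Sum>i<q. (z i + a i)\<^sup>2) / real q) / ((\<Sum>j<m. (z (q + j))\<^sup>2) / real m)))"

end

theory Submission
  imports Defs
begin

text \<open>
  Let \<open>A A' = \<Sigma>\<close> and let \<open>Z\<close> be the matrix of standard normal regressors. Choosing \<open>A\<close> suitably, the
  hypothesis becomes a hypothesis on the last \<open>q\<close> coefficients of \<open>[\<iota>, Z]\<close>, and the violation of the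
  hypothesis affects only the first of them, by the amount \<open>\<sigma> \<surd>\<Delta>\<close>. The law of \<open>Z\<close> is invariant under
  orthogonal maps that fix \<open>\<iota>\<close>, so the centered error vector may be replaced by one that has the same
  norm \<open>s\<close> and the direction of a centered standard Gaussian vector independent of \<open>Z\<close>. Conditionally
  on \<open>Z\<close>, in an orthonormal basis obtained by triangularizing \<open>[\<iota>, Z]\<close>, the statistic is the ratio
  that defines the non-central \<open>F\<close>-distribution, except that the shift \<open>\<surd>(\<Delta> N)\<close>, where \<open>N = n - p - 1 + q\<close>,
  is replaced by \<open>\<surd>\<Delta> \<sigma> \<rho> d / s\<close>. Here \<open>\<rho>\<^sup>2\<close> has a chi-square law with \<open>N\<close> degrees of freedom, \<open>d\<^sup>2\<close> has
  one with \<open>n - 1\<close>, and \<open>s\<^sup>2 / \<sigma>\<^sup>2\<close> is \<open>n - 1\<close> up to a relative error of order \<open>n\<^sup>-\<^sup>1\<^sup>/\<^sup>2\<close> because of the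
  fourth moments. So the two shifts differ by \<open>O(\<surd>\<Delta>)\<close> in probability, and perturbing the shift of one
  Gaussian coordinate by \<open>\<delta>\<close> changes the distribution function by at most \<open>2 \<delta>\<close>. As \<open>\<Delta> \<rightarrow> 0\<close>, this is enough.
\<close>

text \<open>The errors need not be Gaussian, so all normality has to come from the design. The
  isometries therefore act on the columns of the design, although independence is given for its
  rows. They have to fix the column of ones; hence the mean of the errors survives the resampling,
  with a law that is not controlled. The zero first column of the restriction matrix is what keeps
  this mean, coordinate 0 of the rotated basis, out of numerator and denominator.

  The shift that arises depends on the very Gaussian coordinates whose ratio it perturbs, so it
  cannot be conditioned away. It is compared with the constant shift: the exceptional band around
  the critical value is defined by the constant alone.

  If all relative errors are at most \<open>\<tau>\<close>, the shifts differ by at most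
  \<open>7 * \<tau> * sqrt (\<Delta> * n)\<close>, while the exceptional probabilities are of order
  \<open>1 / (n * \<tau>^2)\<close>. For fixed \<open>\<delta>\<close> the choice
  \<open>1 / \<tau>^2 = 4 + 49 * \<Delta> * n / \<delta>^2\<close> makes the first at most
  \<open>\<delta>\<close> and the second of order \<open>1 / n + \<Delta>\<close>.\<close>

lemma mat_eqI_mult_vec:
  fixes A B :: "'a :: semiring_1 mat"
  assumes A: "A \<in> carrier_mat n m" and B: "B \<in> carrier_mat n m"
    and eq: "\<And>v. v \<in> carrier_vec m \<Longrightarrow> A *\<^sub>v v = B *\<^sub>v v"
  shows "A = B"
proof (rule eq_matI)
  fix i j assume "i < dim_row B" "j < dim_col B"
  then have ij: "i < n" "j < m" using B by auto
  have "(A *\<^sub>v unit_vec m j) $ i = (B *\<^sub>v unit_vec m j) $ i" using eq[of "unit_vec m j"] by simp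
  then show "A $$ (i, j) = B $$ (i, j)" using A B ij by simp
qed (use A B in auto)

section \<open>Rotation invariance of Lebesgue measure in the plane and of standard Gaussian
  laws\<close>

lemma nn_integral_lborel_shear1:
  fixes k :: "real \<Rightarrow> real \<Rightarrow> ennreal"
  assumes [measurable]: "case_prod k \<in> borel_measurable (borel \<Otimes>\<^sub>M borel)"
  shows "(\<integral>\<^sup>+a. \<integral>\<^sup>+b. k (a + u * b) b \<partial>lborel \<partial>lborel) = (\<integral>\<^sup>+a. \<integral>\<^sup>+b. k a b \<partial>lborel \<partial>lborel)"
proof -
  have "(\<integral>\<^sup>+a. \<integral>\<^sup>+b. k (a + u * b) b \<partial>lborel \<partial>lborel) = (\<integral>\<^sup>+b. \<integral>\<^sup>+a. k (a + u * b) b \<partial>lborel \<partial>lborel)"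
    by (rule lborel_pair.Fubini') measurable
  also have "\<dots> = (\<integral>\<^sup>+b. \<integral>\<^sup>+a. k a b \<partial>lborel \<partial>lborel)"
  proof (rule nn_integral_cong)
    fix b :: real
    have "(\<integral>\<^sup>+a. k a b \<partial>lborel) = \<bar>1::real\<bar> * (\<integral>\<^sup>+a. k (u * b + 1 * a) b \<partial>lborel)"
      by (rule nn_integral_real_affine) auto
    then show "(\<integral>\<^sup>+a. k (a + u * b) b \<partial>lborel) = (\<integral>\<^sup>+a. k a b \<partial>lborel)"
      by (simp add: add.commute)
  qed
  also have "\<dots> = (\<integral>\<^sup>+a. \<integral>\<^sup>+b. k a b \<partial>lborel \<partial>lborel)"
    by (rule lborel_pair.Fubini'[symmetric]) measurable
  finally show ?thesis .
qed

lemma nn_integral_lborel_shear2: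
  fixes k :: "real \<Rightarrow> real \<Rightarrow> ennreal"
  assumes [measurable]: "case_prod k \<in> borel_measurable (borel \<Otimes>\<^sub>M borel)"
  shows "(\<integral>\<^sup>+a. \<integral>\<^sup>+b. k a (b + v * a) \<partial>lborel \<partial>lborel) = (\<integral>\<^sup>+a. \<integral>\<^sup>+b. k a b \<partial>lborel \<partial>lborel)"
proof (rule nn_integral_cong)
  fix a :: real
  have "(\<integral>\<^sup>+b. k a b \<partial>lborel) = \<bar>1::real\<bar> * (\<integral>\<^sup>+b. k a (v * a + 1 * b) \<partial>lborel)"
    by (rule nn_integral_real_affine) auto
  then show "(\<integral>\<^sup>+b. k a (b + v * a) \<partial>lborel) = (\<integral>\<^sup>+b. k a b \<partial>lborel)"
    by (simp add: add.commute)
qed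

text \<open>A rotation other than \<open>1\<close> and \<open>-1\<close> is a product of three shears.\<close>

lemma nn_integral_lborel_rotation:
  fixes k :: "real \<Rightarrow> real \<Rightarrow> ennreal"
  assumes [measurable]: "case_prod k \<in> borel_measurable (borel \<Otimes>\<^sub>M borel)"
    and cs: "c\<^sup>2 + s\<^sup>2 = 1" and s: "s \<noteq> 0"
  shows "(\<integral>\<^sup>+a. \<integral>\<^sup>+b. k (c * a + s * b) (- s * a + c * b) \<partial>lborel \<partial>lborel)
       = (\<integral>\<^sup>+a. \<integral>\<^sup>+b. k a b \<partial>lborel \<partial>lborel)"
proof -
  \<comment> \<open>For \<open>c = cos t\<close> and \<open>s = sin t\<close> this is
    \<open>tan (t / 2)\<close>. The rotation is the shear by \<open>u\<close> in the first variable,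
    then by \<open>- s\<close> in the second, then by \<open>u\<close> in the first again.\<close>
  define u where "u = (1 - c) / s"
  define k1 where "k1 = (\<lambda>a b. k (a + u * b) b)"
  define k2 where "k2 = (\<lambda>a b. k1 a (b + (- s) * a))"
  have us: "u * s = 1 - c" using s by (simp add: u_def)
  have "u * (1 + c) * s = (u * s) * (1 + c)" by (simp add: ac_simps)
  also have "\<dots> = s * s" unfolding us using cs by (simp add: algebra_simps power2_eq_square)
  finally have "u * (1 + c) * s = s * s" .
  then have uc: "u * (1 + c) = s" using s by simp
  have m1[measurable]: "case_prod k1 \<in> borel_measurable (borel \<Otimes>\<^sub>M borel)"
    unfolding k1_def by measurable
  have m2[measurable]: "case_prod k2 \<in> borel_measurable (borel \<Otimes>\<^sub>M borel)"
    unfolding k2_def by measurable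
  have "k (c * a + s * b) (- s * a + c * b) = k2 (a + u * b) b" for a b
  proof -
    have e1: "b + (- s) * (a + u * b) = - s * a + c * b"
    proof -
      have "b + (- s) * (a + u * b) = b - s * a - (u * s) * b" by (simp add: algebra_simps)
      then show ?thesis unfolding us by (simp add: algebra_simps)
    qed
    have e2: "(a + u * b) + u * (- s * a + c * b) = c * a + s * b"
    proof -
      have "(a + u * b) + u * (- s * a + c * b) = a - (u * s) * a + (u * (1 + c)) * b"
        by (simp add: algebra_simps)
      then show ?thesis unfolding us uc by (simp add: algebra_simps)
    qed
    show ?thesis by (simp only: k2_def k1_def e1 e2)
  qed
  then have "(\<integral>\<^sup>+a. \<integral>\<^sup>+b. k (c * a + s * b) (- s * a + c * b) \<partial>lborel \<partial>lborel)
     = (\<integral>\<^sup>+a. \<integral>\<^sup>+b. k2 (a + u * b) b \<partial>lborel \<partial>lborel)" by simp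
  also have "\<dots> = (\<integral>\<^sup>+a. \<integral>\<^sup>+b. k2 a b \<partial>lborel \<partial>lborel)"
    by (rule nn_integral_lborel_shear1) measurable
  also have "\<dots> = (\<integral>\<^sup>+a. \<integral>\<^sup>+b. k1 a b \<partial>lborel \<partial>lborel)"
    unfolding k2_def by (rule nn_integral_lborel_shear2) measurable
  also have "\<dots> = (\<integral>\<^sup>+a. \<integral>\<^sup>+b. k a b \<partial>lborel \<partial>lborel)"
    unfolding k1_def by (rule nn_integral_lborel_shear1) measurable
  finally show ?thesis .
qed

text \<open>The product density depends on \<open>a\<close> and \<open>b\<close> only through
  \<open>a\<^sup>2 + b\<^sup>2\<close>, which the rotation preserves, so the Lebesgue case applies
  to the density times \<open>h\<close>.\<close>

lemma nn_integral_std_normal_rotation: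
  fixes h :: "real \<Rightarrow> real \<Rightarrow> ennreal"
  assumes [measurable]: "case_prod h \<in> borel_measurable (borel \<Otimes>\<^sub>M borel)"
    and cs: "c\<^sup>2 + s\<^sup>2 = 1" and s: "s \<noteq> 0"
  shows "(\<integral>\<^sup>+a. \<integral>\<^sup>+b. h (c * a + s * b) (- s * a + c * b) \<partial>std_normal_distribution \<partial>std_normal_distribution)
       = (\<integral>\<^sup>+a. \<integral>\<^sup>+b. h a b \<partial>std_normal_distribution \<partial>std_normal_distribution)"
proof -
  let ?d = "\<lambda>x. ennreal (std_normal_density x)"
  define k where "k = (\<lambda>a b. ?d a * (?d b * h a b))"
  have [measurable]: "case_prod k \<in> borel_measurable (borel \<Otimes>\<^sub>M borel)"
    unfolding k_def by measurable
  have dd: "?d a * (?d b * x) = ?d (c * a + s * b) * (?d (- s * a + c * b) * x)" for a b and x :: ennreal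
  proof -
    have sq: "(c * a + s * b)\<^sup>2 + (- s * a + c * b)\<^sup>2 = a\<^sup>2 + b\<^sup>2"
    proof -
      have "(c * a + s * b)\<^sup>2 + (- s * a + c * b)\<^sup>2 = (c\<^sup>2 + s\<^sup>2) * a\<^sup>2 + (c\<^sup>2 + s\<^sup>2) * b\<^sup>2"
        by (simp add: power2_eq_square algebra_simps)
      then show ?thesis unfolding cs by simp
    qed
    have p: "std_normal_density x * std_normal_density y = exp (- (x\<^sup>2 + y\<^sup>2) / 2) / (2 * pi)" for x y :: real
      by (simp add: std_normal_density_def field_simps exp_add[symmetric] flip: real_sqrt_mult)
    have "std_normal_density a * std_normal_density b =
      std_normal_density (c * a + s * b) * std_normal_density (- s * a + c * b)"
      unfolding p sq ..
    then show ?thesis by (simp add: mult.assoc[symmetric] ennreal_mult[symmetric])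
  qed
  have E: "(\<integral>\<^sup>+a. \<integral>\<^sup>+b. g a b \<partial>std_normal_distribution \<partial>std_normal_distribution) =
     (\<integral>\<^sup>+a. \<integral>\<^sup>+b. ?d a * (?d b * g a b) \<partial>lborel \<partial>lborel)"
    if [measurable]: "case_prod g \<in> borel_measurable (borel \<Otimes>\<^sub>M borel)" for g :: "real \<Rightarrow> real \<Rightarrow> ennreal"
  proof -
    have "(\<integral>\<^sup>+a. \<integral>\<^sup>+b. g a b \<partial>std_normal_distribution \<partial>std_normal_distribution)
      = (\<integral>\<^sup>+a. \<integral>\<^sup>+b. ?d b * g a b \<partial>lborel \<partial>std_normal_distribution)"
      by (intro nn_integral_cong nn_integral_density) auto
    also have "\<dots> = (\<integral>\<^sup>+a. ?d a * \<integral>\<^sup>+b. ?d b * g a b \<partial>lborel \<partial>lborel)"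
      by (intro nn_integral_density) auto
    also have "\<dots> = (\<integral>\<^sup>+a. \<integral>\<^sup>+b. ?d a * (?d b * g a b) \<partial>lborel \<partial>lborel)"
      by (intro nn_integral_cong nn_integral_cmult[symmetric]) auto
    finally show ?thesis .
  qed
  have "(\<integral>\<^sup>+a. \<integral>\<^sup>+b. h (c * a + s * b) (- s * a + c * b) \<partial>std_normal_distribution \<partial>std_normal_distribution)
     = (\<integral>\<^sup>+a. \<integral>\<^sup>+b. k (c * a + s * b) (- s * a + c * b) \<partial>lborel \<partial>lborel)"
    by (subst E, measurable, simp only: k_def dd[symmetric])
  also have "\<dots> = (\<integral>\<^sup>+a. \<integral>\<^sup>+b. k a b \<partial>lborel \<partial>lborel)"
    by (rule nn_integral_lborel_rotation[OF _ cs s]) measurable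
  also have "\<dots> = (\<integral>\<^sup>+a. \<integral>\<^sup>+b. h a b \<partial>std_normal_distribution \<partial>std_normal_distribution)"
    by (subst E) (simp_all add: k_def)
  finally show ?thesis .
qed

lemma nn_integral_std_normal_uminus:
  assumes [measurable]: "h \<in> borel_measurable borel"
  shows "(\<integral>\<^sup>+a. h (- a) \<partial>std_normal_distribution) = (\<integral>\<^sup>+a. h a \<partial>std_normal_distribution)"
proof -
  have "(\<integral>\<^sup>+a. h a \<partial>std_normal_distribution) = (\<integral>\<^sup>+a. ennreal (std_normal_density a) * h a \<partial>lborel)"
    by (intro nn_integral_density) auto
  also have "\<dots> = \<bar>-1::real\<bar> * (\<integral>\<^sup>+a. ennreal (std_normal_density (0 + (-1) * a)) * h (0 + (-1) * a) \<partial>lborel)"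
    by (rule nn_integral_real_affine) auto
  also have "\<dots> = (\<integral>\<^sup>+a. ennreal (std_normal_density a) * h (- a) \<partial>lborel)"
    by (simp add: std_normal_density_def)
  also have "\<dots> = (\<integral>\<^sup>+a. h (- a) \<partial>std_normal_distribution)"
    by (intro nn_integral_density[symmetric]) auto
  finally show ?thesis ..
qed

lemma prob_space_std_normal_distribution: "prob_space std_normal_distribution"
  by (rule prob_space_normal_density) simp

interpretation std_normal: prob_space std_normal_distribution
  by (rule prob_space_std_normal_distribution)

interpretation std_normal_prod: product_prob_space "\<lambda>_. std_normal_distribution" UNIV
  by standard

lemma prob_space_std_normal_vec: "prob_space (std_normal_vec n)"
  by (intro prob_space_PiM prob_space_std_normal_distribution)

lemma sets_std_normal_PiM [measurable_cong]:
  "sets (PiM I (\<lambda>_. std_normal_distribution)) = sets (PiM I (\<lambda>_. borel))"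
  by (intro sets_PiM_cong) auto

lemma measurable_coordinate: "i < n \<Longrightarrow> (\<lambda>w. w i) \<in> borel_measurable (borel_vec n)"
  by (rule measurable_component_singleton) simp

lemma space_std_normal_vec: "space (std_normal_vec n) = space (borel_vec n)"
  by (simp add: space_PiM)

lemma space_borel_vec: "space (borel_vec n) = extensional {..<n}"
  by (simp add: space_PiM PiE_def)

lemma measurable_PiM_fun_upd:
  assumes "i \<in> I" "f \<in> measurable M (PiM I N)" "g \<in> measurable M (N i)"
  shows "(\<lambda>x. (f x)(i := g x)) \<in> measurable M (PiM I N)"
  using assms by (intro measurable_fun_upd[where J=I]) auto

lemma nn_integral_PiM_std_normal_rotation:
  assumes I: "finite I" "i \<in> I" "l \<in> I" "i \<noteq> l"
    and [measurable]: "f \<in> borel_measurable (PiM I (\<lambda>_. borel))"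
    and cs: "c\<^sup>2 + s\<^sup>2 = 1" "s \<noteq> 0"
  shows "(\<integral>\<^sup>+z. f (z(i := c * z i + s * z l, l := - s * z i + c * z l)) \<partial>PiM I (\<lambda>_. std_normal_distribution))
       = (\<integral>\<^sup>+z. f z \<partial>PiM I (\<lambda>_. std_normal_distribution))"
proof -
  define J where "J = I - {i, l}"
  have J: "finite J" "l \<notin> J" "finite (insert l J)" "i \<notin> insert l J" using I by (auto simp: J_def)
  have IJ: "I = insert i (insert l J)" using I by (auto simp: J_def)
  have mf: "f \<in> borel_measurable (PiM (insert i (insert l J)) (\<lambda>_. borel))"
    using assms(5) unfolding IJ .
  note [measurable] = mf
  let ?P = "\<lambda>I. PiM I (\<lambda>_. std_normal_distribution)"
  have E: "(\<integral>\<^sup>+z. g z \<partial>?P I) = (\<integral>\<^sup>+x. \<integral>\<^sup>+b. \<integral>\<^sup>+a. g (x(l := b, i := a)) \<partial>std_normal_distribution \<partial>std_normal_distribution \<partial>?P J)"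
    if g[measurable]: "g \<in> borel_measurable (PiM (insert i (insert l J)) (\<lambda>_. borel))" for g
    unfolding IJ
    apply (subst std_normal_prod.product_nn_integral_insert[OF J(3,4)])
     apply measurable
    apply (subst std_normal_prod.product_nn_integral_insert[OF J(1,2)])
     apply measurable
    done
  have "(\<integral>\<^sup>+z. f (z(i := c * z i + s * z l, l := - s * z i + c * z l)) \<partial>?P I) =
    (\<integral>\<^sup>+x. \<integral>\<^sup>+b. \<integral>\<^sup>+a. f (x(l := - s * a + c * b, i := c * a + s * b)) \<partial>std_normal_distribution \<partial>std_normal_distribution \<partial>?P J)"
    using I(4) by (subst E) (auto simp: fun_upd_twist intro!: measurable_PiM_fun_upd measurable_compose[OF _ mf])
  also have "\<dots> = (\<integral>\<^sup>+x. \<integral>\<^sup>+b. \<integral>\<^sup>+a. f (x(l := b, i := a)) \<partial>std_normal_distribution \<partial>std_normal_distribution \<partial>?P J)"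
  proof (rule nn_integral_cong)
    fix x assume x[measurable]: "x \<in> space (?P J)"
    have x': "x \<in> space (PiM J (\<lambda>_. borel))" using x by (simp add: space_PiM)
    have [measurable]: "(\<lambda>(b, a). f (x(l := b, i := a))) \<in> borel_measurable (borel \<Otimes>\<^sub>M borel)"
      using x' by measurable
    \<comment> \<open>Coordinate \<open>l\<close> is the outer variable here. The planar rotation
      sees the pair in reverse order, so its sine changes sign.\<close>
    have "(\<integral>\<^sup>+b. \<integral>\<^sup>+a. f (x(l := c * b + (- s) * a, i := - (- s) * b + c * a)) \<partial>std_normal_distribution \<partial>std_normal_distribution)
       = (\<integral>\<^sup>+b. \<integral>\<^sup>+a. f (x(l := b, i := a)) \<partial>std_normal_distribution \<partial>std_normal_distribution)"
      by (rule nn_integral_std_normal_rotation[where h="\<lambda>b a. f (x(l := b, i := a))" and s="- s"]) (use cs in auto)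
    then show "(\<integral>\<^sup>+b. \<integral>\<^sup>+a. f (x(l := - s * a + c * b, i := c * a + s * b)) \<partial>std_normal_distribution \<partial>std_normal_distribution)
       = (\<integral>\<^sup>+b. \<integral>\<^sup>+a. f (x(l := b, i := a)) \<partial>std_normal_distribution \<partial>std_normal_distribution)"
      by (simp add: add.commute)
  qed
  also have "\<dots> = (\<integral>\<^sup>+z. f z \<partial>?P I)"
    by (subst E) auto
  finally show ?thesis .
qed

lemma nn_integral_PiM_std_normal_uminus:
  assumes I: "finite I" "i \<in> I"
    and [measurable]: "f \<in> borel_measurable (PiM I (\<lambda>_. borel))"
  shows "(\<integral>\<^sup>+z. f (z(i := - z i)) \<partial>PiM I (\<lambda>_. std_normal_distribution))
       = (\<integral>\<^sup>+z. f z \<partial>PiM I (\<lambda>_. std_normal_distribution))"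
proof -
  define J where "J = I - {i}"
  have J: "finite J" "i \<notin> J" using I by (auto simp: J_def)
  have IJ: "I = insert i J" using I by (auto simp: J_def)
  have mf: "f \<in> borel_measurable (PiM (insert i J) (\<lambda>_. borel))"
    using assms(3) unfolding IJ .
  note [measurable] = mf
  let ?P = "\<lambda>I. PiM I (\<lambda>_. std_normal_distribution)"
  have E: "(\<integral>\<^sup>+z. g z \<partial>?P I) = (\<integral>\<^sup>+x. \<integral>\<^sup>+a. g (x(i := a)) \<partial>std_normal_distribution \<partial>?P J)"
    if g[measurable]: "g \<in> borel_measurable (PiM (insert i J) (\<lambda>_. borel))" for g
    unfolding IJ
    apply (subst std_normal_prod.product_nn_integral_insert[OF J])
     apply measurable
    done
  have "(\<integral>\<^sup>+z. f (z(i := - z i)) \<partial>?P I) = (\<integral>\<^sup>+x. \<integral>\<^sup>+a. f (x(i := - a)) \<partial>std_normal_distribution \<partial>?P J)"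
    by (subst E) (auto intro!: measurable_PiM_fun_upd measurable_compose[OF _ mf])
  also have "\<dots> = (\<integral>\<^sup>+x. \<integral>\<^sup>+a. f (x(i := a)) \<partial>std_normal_distribution \<partial>?P J)"
  proof (rule nn_integral_cong)
    fix x assume x: "x \<in> space (?P J)"
    have x': "x \<in> space (PiM J (\<lambda>_. borel))" using x by (simp add: space_PiM)
    have [measurable]: "(\<lambda>a. f (x(i := a))) \<in> borel_measurable borel"
      using x' by measurable
    show "(\<integral>\<^sup>+a. f (x(i := - a)) \<partial>std_normal_distribution) = (\<integral>\<^sup>+a. f (x(i := a)) \<partial>std_normal_distribution)"
      by (rule nn_integral_std_normal_uminus) measurable
  qed
  also have "\<dots> = (\<integral>\<^sup>+z. f z \<partial>?P I)"
    by (subst E) auto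
  finally show ?thesis .
qed

subsection \<open>Orthogonal matrices that preserve the standard Gaussian law\<close>

declare index_mult_mat_vec [simp del]

text \<open>Points of \<open>borel_vec n\<close> are extensional functions, hence the restriction to
  indices below \<open>n\<close>.\<close>

definition act :: "nat \<Rightarrow> real mat \<Rightarrow> (nat \<Rightarrow> real) \<Rightarrow> nat \<Rightarrow> real" where
  "act n Q z = (\<lambda>i\<in>{..<n}. (Q *\<^sub>v vec n z) $ i)"

lemma vec_act: "Q \<in> carrier_mat n n \<Longrightarrow> vec n (act n Q z) = Q *\<^sub>v vec n z"
  by (auto simp: act_def)

lemma act_mult:
  assumes "P \<in> carrier_mat n n" "Q \<in> carrier_mat n n"
  shows "act n (P * Q) z = act n P (act n Q z)"
  unfolding act_def[of n "P * Q"] act_def[of n P] vec_act[OF assms(2)]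
  by (subst assoc_mult_mat_vec[OF assms]) auto

lemma act_one: "z \<in> extensional {..<n} \<Longrightarrow> act n (1\<^sub>m n) z = z"
  by (rule ext) (auto simp: act_def extensional_def)

lemma measurable_act [measurable]:
  assumes "Q \<in> carrier_mat n n"
  shows "act n Q \<in> measurable (borel_vec n) (borel_vec n)"
proof -
  have "act n Q z = (\<lambda>i\<in>{..<n}. \<Sum>l\<in>{0..<n}. Q $$ (i, l) * z l)" for z
    unfolding act_def using assms by (intro restrict_ext) (auto simp: scalar_prod_def index_mult_mat_vec)
  then show ?thesis by (subst measurable_cong[where g="\<lambda>z. \<lambda>i\<in>{..<n}. \<Sum>l\<in>{0..<n}. Q $$ (i, l) * z l"])
      (auto intro!: measurable_restrict borel_measurable_sum borel_measurable_times measurable_component_singleton)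
qed

text \<open>Invariance of the Gaussian law is demanded next to orthogonality instead of being
  derived from it. Givens rotations and sign changes have both properties, and products and
  transposes inherit them; every isometry used below is built in this way.\<close>

definition gaussian_isometry :: "nat \<Rightarrow> real mat \<Rightarrow> bool" where
  "gaussian_isometry n Q \<longleftrightarrow> Q \<in> carrier_mat n n \<and> Q\<^sup>T * Q = 1\<^sub>m n \<and>
     distr (std_normal_vec n) (borel_vec n) (act n Q) = std_normal_vec n"

lemma gaussian_isometry_carrier [simp, dest]: "gaussian_isometry n Q \<Longrightarrow> Q \<in> carrier_mat n n"
  by (simp add: gaussian_isometry_def)

lemma gaussian_isometry_inverse:
  assumes "gaussian_isometry n Q"
  shows "Q\<^sup>T * Q = 1\<^sub>m n" "Q * Q\<^sup>T = 1\<^sub>m n"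
proof -
  show 1: "Q\<^sup>T * Q = 1\<^sub>m n" using assms by (simp add: gaussian_isometry_def)
  show "Q * Q\<^sup>T = 1\<^sub>m n"
    by (rule mat_mult_left_right_inverse[OF _ _ 1]) (use assms in \<open>auto simp: gaussian_isometry_def\<close>)
qed

lemma measurable_gaussian_isometry:
  assumes "gaussian_isometry n Q"
  shows "act n Q \<in> measurable (std_normal_vec n) (borel_vec n)"
    and "act n Q \<in> measurable (std_normal_vec n) (std_normal_vec n)"
  using measurable_act[of Q n] assms
  by (auto simp: measurable_cong_sets[OF sets_std_normal_PiM refl] measurable_cong_sets[OF sets_std_normal_PiM sets_std_normal_PiM])

lemma gaussian_isometryI:
  assumes Q: "Q \<in> carrier_mat n n"
    and inv: "\<And>v. v \<in> carrier_vec n \<Longrightarrow> Q\<^sup>T *\<^sub>v (Q *\<^sub>v v) = v"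
    and law: "\<And>f :: _ \<Rightarrow> ennreal. f \<in> borel_measurable (borel_vec n) \<Longrightarrow>
      (\<integral>\<^sup>+z. f (act n Q z) \<partial>std_normal_vec n) = (\<integral>\<^sup>+z. f z \<partial>std_normal_vec n)"
  shows "gaussian_isometry n Q"
proof -
  have "Q\<^sup>T * Q = 1\<^sub>m n"
  proof (rule mat_eqI_mult_vec)
    fix v :: "real vec" assume v: "v \<in> carrier_vec n"
    have "Q\<^sup>T * Q *\<^sub>v v = Q\<^sup>T *\<^sub>v (Q *\<^sub>v v)" by (rule assoc_mult_mat_vec) (use Q v in auto)
    then show "Q\<^sup>T * Q *\<^sub>v v = 1\<^sub>m n *\<^sub>v v" using inv[OF v] v by simp
  qed (use Q in \<open>auto intro!: mult_carrier_mat[of _ n n]\<close>)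
  moreover have "distr (std_normal_vec n) (borel_vec n) (act n Q) = std_normal_vec n"
  proof (rule measure_eqI)
    fix A assume "A \<in> sets (distr (std_normal_vec n) (borel_vec n) (act n Q))"
    then have A[measurable]: "A \<in> sets (borel_vec n)" by simp
    have m: "act n Q \<in> measurable (std_normal_vec n) (borel_vec n)"
      using Q by (auto intro!: measurable_act simp: measurable_cong_sets[OF sets_std_normal_PiM refl])
    have "emeasure (distr (std_normal_vec n) (borel_vec n) (act n Q)) A = (\<integral>\<^sup>+z. indicator A (act n Q z) \<partial>std_normal_vec n)"
      using m by (simp add: nn_integral_distr flip: nn_integral_indicator)
    then show "emeasure (distr (std_normal_vec n) (borel_vec n) (act n Q)) A = emeasure (std_normal_vec n) A"
      using law[of "indicator A"] by (simp add: sets_std_normal_PiM)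
  qed (simp add: sets_std_normal_PiM)
  ultimately show ?thesis using Q by (simp add: gaussian_isometry_def)
qed

lemma gaussian_isometry_mult:
  assumes P: "gaussian_isometry n P" and Q: "gaussian_isometry n Q"
  shows "gaussian_isometry n (P * Q)"
proof -
  have c: "P \<in> carrier_mat n n" "Q \<in> carrier_mat n n" using P Q by auto
  have "(P * Q)\<^sup>T * (P * Q) = Q\<^sup>T * (P\<^sup>T * P) * Q"
    using c by (simp add: transpose_mult[OF c] assoc_mult_mat[where ?n\<^sub>2=n and ?n\<^sub>3=n and ?n\<^sub>4=n and ?n\<^sub>1=n])
  also have "\<dots> = 1\<^sub>m n"
    using c gaussian_isometry_inverse[OF P] gaussian_isometry_inverse[OF Q] by simp
  finally have 1: "(P * Q)\<^sup>T * (P * Q) = 1\<^sub>m n" .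
  have mP: "act n P \<in> measurable (borel_vec n) (borel_vec n)"
   and mQ: "act n Q \<in> measurable (std_normal_vec n) (borel_vec n)"
    using c measurable_gaussian_isometry(1)[OF Q] by auto
  have "distr (std_normal_vec n) (borel_vec n) (act n (P * Q))
    = distr (std_normal_vec n) (borel_vec n) (act n P \<circ> act n Q)"
    by (rule arg_cong[where f="distr _ _"]) (auto simp: act_mult[OF c])
  also have "\<dots> = distr (distr (std_normal_vec n) (borel_vec n) (act n Q)) (borel_vec n) (act n P)"
    by (rule distr_distr[symmetric]) (use mP mQ in auto)
  also have "\<dots> = std_normal_vec n" using P Q by (simp add: gaussian_isometry_def)
  finally show ?thesis using c 1 by (simp add: gaussian_isometry_def)
qed

text \<open>The law is its own image under \<open>Q\<close>, so its image under the transpose is its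
  image under \<open>Q\<^sup>T * Q = 1\<close>.\<close>

lemma gaussian_isometry_transpose:
  assumes Q: "gaussian_isometry n Q"
  shows "gaussian_isometry n Q\<^sup>T"
proof -
  have c: "Q\<^sup>T \<in> carrier_mat n n" "Q \<in> carrier_mat n n" using Q by auto
  have mP: "act n Q\<^sup>T \<in> measurable (borel_vec n) (borel_vec n)"
   and mQ: "act n Q \<in> measurable (std_normal_vec n) (borel_vec n)"
    using c measurable_gaussian_isometry(1)[OF Q] by auto
  have "distr (std_normal_vec n) (borel_vec n) (act n Q\<^sup>T)
    = distr (distr (std_normal_vec n) (borel_vec n) (act n Q)) (borel_vec n) (act n Q\<^sup>T)"
    using Q by (simp add: gaussian_isometry_def)
  also have "\<dots> = distr (std_normal_vec n) (borel_vec n) (act n Q\<^sup>T \<circ> act n Q)"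
    by (rule distr_distr) (use mP mQ in auto)
  also have "\<dots> = distr (std_normal_vec n) (std_normal_vec n) (\<lambda>x. x)"
    by (rule distr_cong) (auto simp: sets_std_normal_PiM act_mult[OF c, symmetric]
      gaussian_isometry_inverse[OF Q] act_one space_std_normal_vec space_borel_vec)
  also have "\<dots> = std_normal_vec n" by (rule distr_id2) simp
  finally show ?thesis using c gaussian_isometry_inverse[OF Q] by (simp add: gaussian_isometry_def)
qed

lemma gaussian_isometry_inner:
  assumes Q: "gaussian_isometry n Q" and v: "v \<in> carrier_vec n" "w \<in> carrier_vec n"
  shows "(Q *\<^sub>v v) \<bullet> (Q *\<^sub>v w) = v \<bullet> w"
proof -
  have c: "Q\<^sup>T \<in> carrier_mat n n" "Q \<in> carrier_mat n n" using Q by auto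
  have "(Q *\<^sub>v v) \<bullet> (Q *\<^sub>v w) = (Q\<^sup>T *\<^sub>v (Q *\<^sub>v v)) \<bullet> w"
    using transpose_vec_mult_scalar[OF c(2) v(2), of "Q *\<^sub>v v"] c v
    by (simp add: comm_scalar_prod[of _ n])
  also have "Q\<^sup>T *\<^sub>v (Q *\<^sub>v v) = v"
    using c v gaussian_isometry_inverse[OF Q] by (simp add: assoc_mult_mat_vec[symmetric])
  finally show ?thesis .
qed

definition givens :: "nat \<Rightarrow> nat \<Rightarrow> nat \<Rightarrow> real \<Rightarrow> real \<Rightarrow> real mat" where
  "givens n i l c s = mat n n (\<lambda>(a, b).
     if a = i then (if b = i then c else if b = l then s else 0)
     else if a = l then (if b = i then - s else if b = l then c else 0)
     else if a = b then 1 else 0)"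

lemma givens_carrier [simp]: "givens n i l c s \<in> carrier_mat n n"
  by (simp add: givens_def)

lemma givens_mult_vec:
  assumes "i < n" "l < n" "i \<noteq> l"
  shows "givens n i l c s *\<^sub>v vec n z = vec n (z(i := c * z i + s * z l, l := - s * z i + c * z l))"
proof (rule eq_vecI)
  fix a assume "a < dim_vec (vec n (z(i := c * z i + s * z l, l := - s * z i + c * z l)))"
  then have a: "a < n" by simp
  have two: "(\<Sum>b = 0..<n. (if b = i then x else if b = l then y else 0) * z b) = x * z i + y * z l" for x y
  proof -
    have "(\<Sum>b = 0..<n. (if b = i then x else if b = l then y else 0) * z b)
      = (\<Sum>b\<in>{i, l}. (if b = i then x else if b = l then y else 0) * z b)"
      by (rule sum.mono_neutral_right) (use assms in auto)
    then show ?thesis using assms by simp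
  qed
  have one: "(\<Sum>b = 0..<n. (if a = b then 1 else 0) * z b) = z a"
  proof -
    have "(\<Sum>b = 0..<n. (if a = b then 1 else 0) * z b) = (\<Sum>b\<in>{a}. (if a = b then 1 else 0) * z b)"
      by (rule sum.mono_neutral_right) (use a in auto)
    then show ?thesis by simp
  qed
  have "(givens n i l c s *\<^sub>v vec n z) $ a = (\<Sum>b = 0..<n. (if a = i then (if b = i then c else if b = l then s else 0)
     else if a = l then (if b = i then - s else if b = l then c else 0)
     else if a = b then 1 else 0) * z b)"
    using a by (simp add: givens_def scalar_prod_def index_mult_mat_vec)
  also have "\<dots> = (z(i := c * z i + s * z l, l := - s * z i + c * z l)) a"
    using assms by (cases "a = i"; cases "a = l") (simp_all only: two one if_True if_False refl, auto)
  finally show "(givens n i l c s *\<^sub>v vec n z) $ a = vec n (z(i := c * z i + s * z l, l := - s * z i + c * z l)) $ a"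
    using a by simp
qed (simp add: givens_def)

lemma vec_index_id: "v \<in> carrier_vec n \<Longrightarrow> vec n (($) v) = v"
  by auto

lemma gaussian_isometry_givens:
  assumes "i < n" "l < n" "i \<noteq> l" and cs: "c\<^sup>2 + s\<^sup>2 = 1" "s \<noteq> 0"
  shows "gaussian_isometry n (givens n i l c s)"
proof -
  have tr: "(givens n i l c s)\<^sup>T = givens n i l c (- s)"
    using assms by (intro eq_matI) (auto simp: givens_def)
  show ?thesis
  proof (rule gaussian_isometryI)
    fix v :: "real vec" assume v: "v \<in> carrier_vec n"
    have "c * (c * x + s * y) - s * (c * y - s * x) = (c\<^sup>2 + s\<^sup>2) * x"
      "s * (c * x + s * y) + c * (c * y - s * x) = (c\<^sup>2 + s\<^sup>2) * y" for x y :: real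
      by (simp_all add: power2_eq_square algebra_simps)
    then have e: "c * (c * x + s * y) - s * (c * y - s * x) = x"
      "s * (c * x + s * y) + c * (c * y - s * x) = y" for x y :: real
      unfolding cs by simp_all
    have "(givens n i l c s)\<^sup>T *\<^sub>v (givens n i l c s *\<^sub>v v) = givens n i l c (-s) *\<^sub>v (givens n i l c s *\<^sub>v vec n (($) v))"
      unfolding tr using v by (simp add: vec_index_id)
    also have "\<dots> = v"
      unfolding givens_mult_vec[OF assms(1-3)] using assms v by (intro eq_vecI) (auto simp: e)
    finally show "(givens n i l c s)\<^sup>T *\<^sub>v (givens n i l c s *\<^sub>v v) = v" .
  next
    fix f :: "_ \<Rightarrow> ennreal" assume f: "f \<in> borel_measurable (borel_vec n)"
    have "act n (givens n i l c s) z = z(i := c * z i + s * z l, l := - s * z i + c * z l)"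
      if "z \<in> extensional {..<n}" for z
      unfolding act_def givens_mult_vec[OF assms(1-3)] using that assms
      by (auto simp: fun_eq_iff extensional_def)
    then have "(\<integral>\<^sup>+z. f (act n (givens n i l c s) z) \<partial>std_normal_vec n)
      = (\<integral>\<^sup>+z. f (z(i := c * z i + s * z l, l := - s * z i + c * z l)) \<partial>std_normal_vec n)"
      by (intro nn_integral_cong) (simp add: space_std_normal_vec space_borel_vec)
    also have "\<dots> = (\<integral>\<^sup>+z. f z \<partial>std_normal_vec n)"
      by (rule nn_integral_PiM_std_normal_rotation) (use assms f in auto)
    finally show "(\<integral>\<^sup>+z. f (act n (givens n i l c s) z) \<partial>std_normal_vec n) = (\<integral>\<^sup>+z. f z \<partial>std_normal_vec n)" .
  qed simp
qed

lemma gaussian_isometry_one: "gaussian_isometry n (1\<^sub>m n)"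
proof -
  have "distr (std_normal_vec n) (borel_vec n) (act n (1\<^sub>m n)) = distr (std_normal_vec n) (std_normal_vec n) (\<lambda>x. x)"
    by (rule distr_cong) (auto simp: sets_std_normal_PiM act_one space_std_normal_vec space_borel_vec)
  also have "\<dots> = std_normal_vec n" by (rule distr_id2) simp
  finally show ?thesis by (simp add: gaussian_isometry_def)
qed

definition flip_sign :: "nat \<Rightarrow> nat \<Rightarrow> real mat" where
  "flip_sign n i = mat n n (\<lambda>(a, b). if a = b then (if a = i then - 1 else 1) else 0)"

lemma flip_sign_mult_vec:
  shows "flip_sign n i *\<^sub>v vec n z = vec n (z(i := - z i))"
proof (rule eq_vecI)
  fix a assume "a < dim_vec (vec n (z(i := - z i)))"
  then have a: "a < n" by simp
  have "(flip_sign n i *\<^sub>v vec n z) $ a = (\<Sum>b = 0..<n. (if a = b then (if a = i then - 1 else 1) else 0) * z b)"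
    using a by (simp add: flip_sign_def scalar_prod_def index_mult_mat_vec)
  also have "\<dots> = (\<Sum>b\<in>{a}. (if a = b then (if a = i then - 1 else 1) else 0) * z b)"
    by (rule sum.mono_neutral_right) (use a in auto)
  finally show "(flip_sign n i *\<^sub>v vec n z) $ a = vec n (z(i := - z i)) $ a" using a by simp
qed (simp add: flip_sign_def)

lemma gaussian_isometry_flip_sign:
  assumes "i < n"
  shows "gaussian_isometry n (flip_sign n i)"
proof -
  let ?Q = "flip_sign n i"
  have c: "?Q \<in> carrier_mat n n" by (simp add: flip_sign_def)
  have tr: "?Q\<^sup>T = ?Q" by (intro eq_matI) (auto simp: flip_sign_def)
  show ?thesis
  proof (rule gaussian_isometryI[OF c])
    fix v :: "real vec" assume v: "v \<in> carrier_vec n"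
    have "?Q\<^sup>T *\<^sub>v (?Q *\<^sub>v v) = ?Q *\<^sub>v (?Q *\<^sub>v vec n (($) v))"
      unfolding tr using v by (simp add: vec_index_id)
    also have "\<dots> = v"
      unfolding flip_sign_mult_vec using v by (intro eq_vecI) auto
    finally show "?Q\<^sup>T *\<^sub>v (?Q *\<^sub>v v) = v" .
  next
    fix f :: "_ \<Rightarrow> ennreal" assume f: "f \<in> borel_measurable (borel_vec n)"
    have "act n ?Q z = z(i := - z i)" if "z \<in> extensional {..<n}" for z
      unfolding act_def flip_sign_mult_vec using that assms by (auto simp: fun_eq_iff extensional_def)
    then have "(\<integral>\<^sup>+z. f (act n ?Q z) \<partial>std_normal_vec n) = (\<integral>\<^sup>+z. f (z(i := - z i)) \<partial>std_normal_vec n)"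
      by (intro nn_integral_cong) (simp add: space_std_normal_vec space_borel_vec)
    also have "\<dots> = (\<integral>\<^sup>+z. f z \<partial>std_normal_vec n)"
      by (rule nn_integral_PiM_std_normal_uminus) (use assms f in auto)
    finally show "(\<integral>\<^sup>+z. f (act n ?Q z) \<partial>std_normal_vec n) = (\<integral>\<^sup>+z. f z \<partial>std_normal_vec n)" .
  qed
qed

lemma givens_mult_vec_index:
  assumes "i < n" "l < n" "i \<noteq> l" "v \<in> carrier_vec n" "a < n"
  shows "(givens n i l c s *\<^sub>v v) $ a =
    (if a = i then c * v $ i + s * v $ l else if a = l then - s * v $ i + c * v $ l else v $ a)"
proof -
  have "givens n i l c s *\<^sub>v v = givens n i l c s *\<^sub>v vec n (($) v)" using assms by (simp add: vec_index_id)
  then show ?thesis unfolding givens_mult_vec[OF assms(1-3)] using assms by auto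
qed

lemma flip_sign_mult_vec_index:
  assumes "v \<in> carrier_vec n" "a < n"
  shows "(flip_sign n i *\<^sub>v v) $ a = (if a = i then - v $ i else v $ a)"
proof -
  have "flip_sign n i *\<^sub>v v = flip_sign n i *\<^sub>v vec n (($) v)" using assms by (simp add: vec_index_id)
  then show ?thesis unfolding flip_sign_mult_vec using assms by auto
qed

text \<open>Givens rotations in the planes of \<open>k\<close> and \<open>i\<close>, one for each
  \<open>i\<close> in \<open>D\<close>, collect the mass of \<open>v\<close> on \<open>D\<close> in
  coordinate \<open>k\<close>. The two clauses on fixed coordinates and fixed vectors protect what
  earlier eliminations have achieved.\<close>

lemma gaussian_isometry_eliminate:
  assumes "finite D" "D \<subseteq> {..<n}" "k < n" "k \<notin> D" and v: "v \<in> carrier_vec n"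
  shows "\<exists>H. gaussian_isometry n H \<and>
    (\<forall>x\<in>carrier_vec n. \<forall>i<n. i \<notin> insert k D \<longrightarrow> (H *\<^sub>v x) $ i = x $ i) \<and>
    (\<forall>x\<in>carrier_vec n. (\<forall>i\<in>insert k D. x $ i = 0) \<longrightarrow> H *\<^sub>v x = x) \<and>
    (\<forall>i\<in>D. (H *\<^sub>v v) $ i = 0) \<and> (H *\<^sub>v v) $ k \<ge> 0"
  using assms(1,2,4)
proof (induction D)
  case empty
  show ?case
  \<comment> \<open>A rotation in the induction step leaves the length \<open>r\<close> at
    \<open>k\<close>, so a sign change is needed only in the base case.\<close>
  proof (cases "v $ k \<ge> 0")
    case True
    then show ?thesis using v gaussian_isometry_one by (intro exI[of _ "1\<^sub>m n"]) auto
  next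
    case False
    have fl: "flip_sign n k *\<^sub>v x = x" if "x \<in> carrier_vec n" "x $ k = 0" for x
      using that by (intro eq_vecI) (auto simp: flip_sign_mult_vec_index, simp add: flip_sign_def)
    show ?thesis using False v assms(3) gaussian_isometry_flip_sign[of k n]
      by (intro exI[of _ "flip_sign n k"]) (simp add: flip_sign_mult_vec_index fl)
  qed
next
  case (insert l D)
  then obtain H where H: "gaussian_isometry n H"
    "\<And>x i. x \<in> carrier_vec n \<Longrightarrow> i < n \<Longrightarrow> i \<notin> insert k D \<Longrightarrow> (H *\<^sub>v x) $ i = x $ i"
    "\<And>x. x \<in> carrier_vec n \<Longrightarrow> (\<forall>i\<in>insert k D. x $ i = 0) \<Longrightarrow> H *\<^sub>v x = x"
    "\<And>i. i \<in> D \<Longrightarrow> (H *\<^sub>v v) $ i = 0" "(H *\<^sub>v v) $ k \<ge> 0" by fastforce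
  have l: "l < n" "l \<noteq> k" using insert by auto
  have cH: "H \<in> carrier_mat n n" using H by auto
  define w where "w = H *\<^sub>v v"
  have w: "w \<in> carrier_vec n" using cH v by (simp add: w_def)
  show ?case
  \<comment> \<open>If \<open>w $ l = 0\<close>, the rotation would have sine 0, which
    \<open>gaussian_isometry_givens\<close> excludes; but then there is nothing to
    eliminate.\<close>
  proof (cases "w $ l = 0")
    case True
    then show ?thesis using H by (intro exI[of _ H]) (auto simp: w_def)
  next
    case False
    define r where "r = sqrt ((w $ k)\<^sup>2 + (w $ l)\<^sup>2)"
    have rpos: "r > 0" using False by (simp add: r_def sum_power2_gt_zero_iff)
    have r2: "r * r = (w $ k)\<^sup>2 + (w $ l)\<^sup>2"
      by (simp add: r_def)
    \<comment> \<open>This rotation takes the pair \<open>(w $ k, w $ l)\<close> to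
      \<open>(r, 0)\<close>.\<close>
    define G where "G = givens n k l (w $ k / r) (w $ l / r)"
    have one: "(w $ k / r)\<^sup>2 + (w $ l / r)\<^sup>2 = 1"
      using rpos r2 False by (simp add: power_divide power2_eq_square flip: add_divide_distrib)
    have G: "gaussian_isometry n G"
      unfolding G_def by (rule gaussian_isometry_givens[OF \<open>k < n\<close> _ _ one]) (use l False rpos in auto)
    have cG: "G \<in> carrier_mat n n" using G by auto
    have Gi: "x \<in> carrier_vec n \<Longrightarrow> a < n \<Longrightarrow> (G *\<^sub>v x) $ a = (if a = k then w $ k / r * x $ k + w $ l / r * x $ l
       else if a = l then - (w $ l / r) * x $ k + w $ k / r * x $ l else x $ a)" for x a
      unfolding G_def using l assms(3) by (intro givens_mult_vec_index) auto
    have GH: "x \<in> carrier_vec n \<Longrightarrow> G * H *\<^sub>v x = G *\<^sub>v (H *\<^sub>v x)" for x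
      using cG cH by simp
    show ?thesis
    proof (rule exI[of _ "G * H"], intro conjI ballI allI impI)
      show "gaussian_isometry n (G * H)" using G H by (intro gaussian_isometry_mult)
    next
      fix x :: "real vec" and i assume x: "x \<in> carrier_vec n" and i: "i < n" "i \<notin> insert k (insert l D)"
      have Hx: "H *\<^sub>v x \<in> carrier_vec n" using cH x by simp
      show "(G * H *\<^sub>v x) $ i = x $ i"
        unfolding GH[OF x] Gi[OF Hx i(1)] using H(2)[OF x i(1)] i by simp
    next
      fix x :: "real vec" assume x: "x \<in> carrier_vec n" and x0: "\<forall>i\<in>insert k (insert l D). x $ i = 0"
      show "G * H *\<^sub>v x = x"
        unfolding GH[OF x] using H(3)[OF x] x0 x cG by (auto intro!: eq_vecI simp: Gi)
    next
      fix i assume i: "i \<in> insert l D"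
      have il: "i < n" "i \<noteq> k" using i insert.prems by auto
      have "w $ l / r * w $ k = w $ k / r * w $ l" by simp
      then show "(G * H *\<^sub>v v) $ i = 0"
        unfolding GH[OF v] w_def[symmetric] Gi[OF w il(1)] using il i H(4)[of i] by (auto simp: w_def[symmetric])
    next
      have "w $ k / r * w $ k + w $ l / r * w $ l = (r * r) / r"
        unfolding r2 by (simp add: power2_eq_square add_divide_distrib)
      then show "0 \<le> (G * H *\<^sub>v v) $ k"
        unfolding GH[OF v] w_def[symmetric] Gi[OF w assms(3)] using rpos by simp
    qed
  qed
qed

text \<open>A QR factorization with prescribed pivot positions. With \<open>\<pi> = id\<close> it
  gives an upper triangular form; a decreasing \<open>\<pi>\<close> later pushes rows into the last
  coordinates. Nonnegative pivots are distances from the span of the previous columns, not just up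
  to sign.\<close>

lemma gaussian_isometry_triangularize:
  fixes k :: nat and \<pi> :: "nat \<Rightarrow> nat"
  assumes u: "\<forall>a<k. u a \<in> carrier_vec n"
    and o: "inj_on \<pi> {..<k}" "\<pi> ` {..<k} \<subseteq> {..<n}"
  shows "\<exists>Q. gaussian_isometry n Q \<and>
    (\<forall>a<k. (\<forall>i<n. i \<notin> \<pi> ` {..a} \<longrightarrow> (Q *\<^sub>v u a) $ i = 0) \<and> (Q *\<^sub>v u a) $ \<pi> a \<ge> 0)"
  using assms
proof (induction k)
  case 0
  then show ?case using gaussian_isometry_one by auto
next
  case (Suc k)
  have "\<exists>Q. gaussian_isometry n Q \<and>
    (\<forall>a<k. (\<forall>i<n. i \<notin> \<pi> ` {..a} \<longrightarrow> (Q *\<^sub>v u a) $ i = 0) \<and> (Q *\<^sub>v u a) $ \<pi> a \<ge> 0)"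
    by (rule Suc.IH) (use Suc.prems in \<open>auto simp: inj_on_def image_subset_iff\<close>)
  then obtain Q where Q: "gaussian_isometry n Q"
    "\<And>a i. a < k \<Longrightarrow> i < n \<Longrightarrow> i \<notin> \<pi> ` {..a} \<Longrightarrow> (Q *\<^sub>v u a) $ i = 0"
    "\<And>a. a < k \<Longrightarrow> (Q *\<^sub>v u a) $ \<pi> a \<ge> 0" by auto
  have cQ: "Q \<in> carrier_mat n n" using Q by auto
  \<comment> \<open>\<open>H\<close> mixes only coordinates that are not pivots of earlier columns.
    The earlier columns vanish there and are left as they are.\<close>
  define D where "D = {..<n} - \<pi> ` {..k}"
  have kn: "\<pi> k < n" using Suc.prems by auto
  have uk: "Q *\<^sub>v u k \<in> carrier_vec n" using cQ Suc.prems(1) by simp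
  obtain H where H: "gaussian_isometry n H"
    "\<And>x i. x \<in> carrier_vec n \<Longrightarrow> i < n \<Longrightarrow> i \<notin> insert (\<pi> k) D \<Longrightarrow> (H *\<^sub>v x) $ i = x $ i"
    "\<And>x. x \<in> carrier_vec n \<Longrightarrow> (\<forall>i\<in>insert (\<pi> k) D. x $ i = 0) \<Longrightarrow> H *\<^sub>v x = x"
    "\<And>i. i \<in> D \<Longrightarrow> (H *\<^sub>v (Q *\<^sub>v u k)) $ i = 0" "(H *\<^sub>v (Q *\<^sub>v u k)) $ \<pi> k \<ge> 0"
    using gaussian_isometry_eliminate[of D n "\<pi> k" "Q *\<^sub>v u k"] kn uk by (auto simp: D_def)
  have HQ: "x \<in> carrier_vec n \<Longrightarrow> H * Q *\<^sub>v x = H *\<^sub>v (Q *\<^sub>v x)" for x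
    using H(1) cQ by (intro assoc_mult_mat_vec) auto
  show ?case
  proof (rule exI[of _ "H * Q"], intro conjI allI impI)
    show "gaussian_isometry n (H * Q)" using H Q by (intro gaussian_isometry_mult)
  next
    fix a i assume a: "a < Suc k" and i: "i < n" "i \<notin> \<pi> ` {..a}"
    show "(H * Q *\<^sub>v u a) $ i = 0"
    proof (cases "a = k")
      case True
      then show ?thesis using H(4)[of i] i Suc.prems(1) by (simp add: HQ D_def)
    next
      case False
      then have ak: "a < k" using a by simp
      have ua: "u a \<in> carrier_vec n" using Suc.prems(1) a by simp
      have "H *\<^sub>v (Q *\<^sub>v u a) = Q *\<^sub>v u a"
      proof (rule H(3), use cQ ua in simp, intro ballI)
        fix i assume "i \<in> insert (\<pi> k) D"
        then have "i < n \<and> i \<notin> \<pi> ` {..a}"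
        proof
          assume "i = \<pi> k"
          moreover have "\<pi> k \<noteq> \<pi> x" if "x \<le> a" for x
            using inj_onD[OF Suc.prems(2), of k x] that ak by auto
          ultimately show ?thesis using kn by auto
        next
          assume "i \<in> D"
          then show ?thesis using ak by (auto simp: D_def)
        qed
        then show "(Q *\<^sub>v u a) $ i = 0" using Q(2)[OF ak] by auto
      qed
      then show ?thesis using Q(2)[OF ak] i ua by (simp add: HQ)
    qed
  next
    fix a assume a: "a < Suc k"
    have ua: "u a \<in> carrier_vec n" using Suc.prems(1) a by simp
    show "0 \<le> (H * Q *\<^sub>v u a) $ \<pi> a"
    proof (cases "a = k")
      case True
      then show ?thesis using H(5) Suc.prems(1) by (simp add: HQ)
    next
      case False
      then have ak: "a < k" using a by simp
      have "(H *\<^sub>v (Q *\<^sub>v u a)) $ \<pi> a = (Q *\<^sub>v u a) $ \<pi> a"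
      proof (rule H(2))
        show "\<pi> a < n" using a Suc.prems(3) by auto
        show "\<pi> a \<notin> insert (\<pi> k) D" using ak inj_onD[OF Suc.prems(2), of k a] by (auto simp: D_def)
      qed (use cQ ua in auto)
      then show ?thesis using Q(3)[OF ak] ua by (simp add: HQ)
    qed
  qed
qed

subsection \<open>Algebra and measurability of the F-statistic\<close>

lemma assoc_mult_mat_dim:
  "dim_col A = dim_row B \<Longrightarrow> dim_col B = dim_row C \<Longrightarrow> (A :: 'a :: semiring_0 mat) * B * C = A * (B * C)"
  by (rule assoc_mult_mat) auto

lemma assoc_mult_mat_vec_dim:
  "dim_col A = dim_row B \<Longrightarrow> dim_col B = dim_vec v \<Longrightarrow> (A :: 'a :: semiring_0 mat) * B *\<^sub>v v = A *\<^sub>v (B *\<^sub>v v)"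
  by (rule assoc_mult_mat_vec) auto

lemma transpose_mult_dim:
  "dim_col A = dim_row B \<Longrightarrow> ((A :: 'a :: comm_semiring_0 mat) * B)\<^sup>T = B\<^sup>T * A\<^sup>T"
  by (rule transpose_mult) auto

lemma mult_mat_vec_add_dim:
  "dim_vec v = dim_col A \<Longrightarrow> dim_vec w = dim_col A \<Longrightarrow> (A :: 'a :: semiring_0 mat) *\<^sub>v (v + w) = A *\<^sub>v v + A *\<^sub>v w"
  by (rule mult_add_distrib_mat_vec) (auto intro: carrier_vecI)

lemma mult_mat_vec_minus_dim:
  "dim_vec v = dim_col A \<Longrightarrow> dim_vec w = dim_col A \<Longrightarrow> (A :: 'a :: ring mat) *\<^sub>v (v - w) = A *\<^sub>v v - A *\<^sub>v w"
  by (rule mult_minus_distrib_mat_vec) (auto intro: carrier_vecI)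

lemmas mat_dim_simps = assoc_mult_mat_dim assoc_mult_mat_vec_dim transpose_mult_dim
  mult_mat_vec_add_dim mult_mat_vec_minus_dim

lemma scalar_prod_mult_mat_vec:
  "dim_vec v = dim_row A \<Longrightarrow> dim_vec w = dim_col A \<Longrightarrow> v \<bullet> ((A :: real mat) *\<^sub>v w) = (A\<^sup>T *\<^sub>v v) \<bullet> w"
  by (rule transpose_vec_mult_scalar[of A "dim_row A" "dim_col A" w v, symmetric])
    (auto intro: carrier_vecI)

lemma mult_mat_cancel:
  assumes "A * B = 1\<^sub>m m" "dim_col A = dim_row B" "dim_row C = dim_col B"
  shows "(A :: 'a :: semiring_1 mat) * (B * C) = C"
proof -
  have "dim_row C = m" using arg_cong[OF assms(1), of dim_col] assms(3) by simp
  then show ?thesis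
    unfolding assoc_mult_mat_dim[OF assms(2) assms(3)[symmetric], symmetric] assms(1)
    by (simp add: left_mult_one_mat')
qed

lemma mult_mat_vec_cancel:
  assumes "A * B = 1\<^sub>m m" "dim_col A = dim_row B" "dim_vec v = dim_col B"
  shows "(A :: 'a :: semiring_1 mat) *\<^sub>v (B *\<^sub>v v) = v"
proof -
  have "v \<in> carrier_vec m"
    using arg_cong[OF assms(1), of dim_col] assms(3) by (intro carrier_vecI) simp
  then show ?thesis
    unfolding assoc_mult_mat_vec_dim[OF assms(2) assms(3)[symmetric], symmetric] assms(1)
    by simp
qed

lemma mat_inverse_eqI:
  assumes A: "(A :: 'a :: field mat) \<in> carrier_mat n n" and B: "B \<in> carrier_mat n n" and BA: "B * A = 1\<^sub>m n"
  shows "mat_inverse A = Some B"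
proof (cases "mat_inverse A")
  case None
  have "det B * det A = 1" using det_mult[OF B A] BA by simp
  then have "det A \<noteq> 0" by auto
  then show ?thesis using mat_inverse(1)[OF A None, of "()"] det_non_zero_imp_unit[OF A, of "()"] by simp
next
  case (Some C)
  then have C: "A * C = 1\<^sub>m n" "C \<in> carrier_mat n n" using mat_inverse(2)[OF A] by auto
  have "B = B * (A * C)" using B C by simp
  also have "\<dots> = C" using A B C by (intro mult_mat_cancel[OF BA]) auto
  finally show ?thesis using Some by simp
qed

text \<open>Cramer's rule in place of Gauss-Jordan elimination: the entries of the inverse become
  polynomials divided by the determinant, from which measurability can be read off.\<close>

lemma mat_inverse_adj_mat:
  assumes A: "(A :: 'a :: field mat) \<in> carrier_mat n n"
  shows "mat_inverse A = (if det A = 0 then None else Some (inverse (det A) \<cdot>\<^sub>m adj_mat A))"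
proof (cases "det A = 0")
  case True
  then have "mat_inverse A \<noteq> Some B" for B
    using mat_inverse(2)[OF A, of B] det_mult[OF A, of B] by auto
  then show ?thesis using True by (cases "mat_inverse A") auto
next
  case False
  have "mat_inverse A = Some (inverse (det A) \<cdot>\<^sub>m adj_mat A)"
  proof (rule mat_inverse_eqI[OF A])
    show "inverse (det A) \<cdot>\<^sub>m adj_mat A \<in> carrier_mat n n" using adj_mat(1)[OF A] by simp
    have "inverse (det A) \<cdot>\<^sub>m adj_mat A * A = inverse (det A) \<cdot>\<^sub>m (adj_mat A * A)"
      using adj_mat(1)[OF A] A by (intro mult_smult_assoc_mat) auto
    also have "\<dots> = 1\<^sub>m n" using False by (intro eq_matI) (auto simp: adj_mat(3)[OF A])
    finally show "inverse (det A) \<cdot>\<^sub>m adj_mat A * A = 1\<^sub>m n" .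
  qed
  then show ?thesis using False by simp
qed

lemma obtain_inverse_mat:
  assumes A: "(A :: real mat) \<in> carrier_mat n n" and "det A \<noteq> 0"
  obtains B where "B \<in> carrier_mat n n" "B * A = 1\<^sub>m n" "A * B = 1\<^sub>m n"
proof -
  have "mat_inverse A = Some (inverse (det A) \<cdot>\<^sub>m adj_mat A)"
    using mat_inverse_adj_mat[OF A] assms by simp
  from mat_inverse(2)[OF A this] show ?thesis by (intro that) auto
qed

text \<open>In \<open>R * inverse (T' T) * R'\<close> with \<open>R = K * R2 * T\<close> the factors
  \<open>T\<close> cancel and \<open>R2\<close> has orthonormal rows, so only \<open>K * K'\<close>
  is left. The resulting quadratic form at \<open>K a\<close> is the squared length of
  \<open>a\<close>. This serves both the statistic and \<open>Delta_gamma\<close>.\<close>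

lemma mat_inverse_quadratic_form:
  fixes T Ti R2 K Ki :: "real mat"
  assumes T: "T \<in> carrier_mat k k" "Ti \<in> carrier_mat k k" "Ti * T = 1\<^sub>m k"
    and R2: "R2 \<in> carrier_mat q k" "R2 * R2\<^sup>T = 1\<^sub>m q"
    and K: "K \<in> carrier_mat q q" "Ki \<in> carrier_mat q q" "Ki * K = 1\<^sub>m q"
  shows "mat_inverse (T\<^sup>T * T) = Some (Ti * Ti\<^sup>T)"
    and "mat_inverse ((K * R2 * T) * (Ti * Ti\<^sup>T) * (K * R2 * T)\<^sup>T) = Some (Ki\<^sup>T * Ki)"
    and "a \<in> carrier_vec q \<Longrightarrow> (K *\<^sub>v a) \<bullet> (Ki\<^sup>T * Ki *\<^sub>v (K *\<^sub>v a)) = a \<bullet> a"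
proof -
  have T1: "T * Ti = 1\<^sub>m k" and K1: "K * Ki = 1\<^sub>m q"
    using mat_mult_left_right_inverse[OF T(2,1,3)] mat_mult_left_right_inverse[OF K(2,1,3)] by auto
  have T2: "Ti\<^sup>T * T\<^sup>T = 1\<^sub>m k" "T\<^sup>T * Ti\<^sup>T = 1\<^sub>m k" and K2: "Ki\<^sup>T * K\<^sup>T = 1\<^sub>m q"
    using T K T1 K1 by (simp_all flip: transpose_mult_dim)
  note dims = carrier_matD[OF T(1)] carrier_matD[OF T(2)] carrier_matD[OF R2(1)] carrier_matD[OF K(1)] carrier_matD[OF K(2)]
  note l = mult_mat_cancel
  show "mat_inverse (T\<^sup>T * T) = Some (Ti * Ti\<^sup>T)"
    by (rule mat_inverse_eqI[of _ k])
      (use T in \<open>auto simp: mat_dim_simps dims l[OF T2(1)] intro!: mult_carrier_mat[of _ k k]\<close>)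
  have e: "(K * R2 * T) * (Ti * Ti\<^sup>T) * (K * R2 * T)\<^sup>T = K * K\<^sup>T"
    by (simp add: mat_dim_simps dims l[OF T1] l[OF T2(1)] l[OF R2(2)])
  show "mat_inverse ((K * R2 * T) * (Ti * Ti\<^sup>T) * (K * R2 * T)\<^sup>T) = Some (Ki\<^sup>T * Ki)"
    unfolding e by (rule mat_inverse_eqI[of _ q])
      (use K in \<open>auto simp: mat_dim_simps dims l[OF K(3)] K2 intro!: mult_carrier_mat[of _ q q]\<close>)
  assume a: "a \<in> carrier_vec q"
  have Ka: "Ki *\<^sub>v (K *\<^sub>v a) = a" using K a by (intro mult_mat_vec_cancel) auto
  have "(K *\<^sub>v a) \<bullet> (Ki\<^sup>T *\<^sub>v a) = (Ki *\<^sub>v (K *\<^sub>v a)) \<bullet> a"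
    using a dims by (subst scalar_prod_mult_mat_vec) auto
  then show "(K *\<^sub>v a) \<bullet> (Ki\<^sup>T * Ki *\<^sub>v (K *\<^sub>v a)) = a \<bullet> a"
    using a by (simp add: mat_dim_simps dims Ka)
qed

text \<open>For \<open>U = V T\<close> in QR form, least squares projects the error onto the columns
  of \<open>V\<close>. The factor \<open>T\<close> drops out of the fitted values, and
  \<open>K\<close> drops out of the quadratic form in the numerator.\<close>

lemma F_statistic_factored:
  assumes V: "V \<in> carrier_mat n k" "V\<^sup>T * V = 1\<^sub>m k"
    and T: "T \<in> carrier_mat k k" "Ti \<in> carrier_mat k k" "Ti * T = 1\<^sub>m k"
    and R2: "R2 \<in> carrier_mat q k" "R2 * R2\<^sup>T = 1\<^sub>m q"
    and K: "K \<in> carrier_mat q q" "Ki \<in> carrier_mat q q" "Ki * K = 1\<^sub>m q"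
    and g: "\<gamma> \<in> carrier_vec k" and e: "e \<in> carrier_vec n" and c: "c \<in> carrier_vec q" and r: "r \<in> carrier_vec q"
    and c_eq: "(K * R2 * T) *\<^sub>v \<gamma> - r = K *\<^sub>v c"
  shows "F_statistic (V * T) (V * T *\<^sub>v \<gamma> + e) (K * R2 * T) r =
    (let a = c + R2 *\<^sub>v (V\<^sup>T *\<^sub>v e); res = e - V *\<^sub>v (V\<^sup>T *\<^sub>v e)
     in if res \<bullet> res = 0 then 0 else (a \<bullet> a / real q) / (res \<bullet> res / real (n - k)))"
proof -
  note q = mat_inverse_quadratic_form[OF T R2 K]
  note dims = carrier_matD[OF V(1)] carrier_matD[OF T(1)] carrier_matD[OF T(2)] carrier_matD[OF R2(1)] carrier_matD[OF K(1)] carrier_matD[OF K(2)]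
    carrier_vecD[OF g] carrier_vecD[OF e] carrier_vecD[OF c] carrier_vecD[OF r]
  have T1: "T * Ti = 1\<^sub>m k"
    using mat_mult_left_right_inverse[OF T(2,1,3)] by auto
  have T2: "Ti\<^sup>T * T\<^sup>T = 1\<^sub>m k"
    using T T1 by (simp_all flip: transpose_mult_dim)
  note l = mult_mat_cancel and lv = mult_mat_vec_cancel
  have UU: "(V * T)\<^sup>T * (V * T) = T\<^sup>T * T"
    by (simp add: mat_dim_simps dims l[OF V(2)])
  define w where "w = V\<^sup>T *\<^sub>v e"
  have w: "w \<in> carrier_vec k" by (intro carrier_vecI) (simp add: w_def dims)
  define a where "a = c + R2 *\<^sub>v w"
  have a: "a \<in> carrier_vec q" by (intro carrier_vecI) (simp add: a_def dims)
  \<comment> \<open>The estimator is the true coefficient vector plus a linear image of the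
    projected error \<open>w\<close>.\<close>
  have gh: "Ti * Ti\<^sup>T *\<^sub>v ((V * T)\<^sup>T *\<^sub>v (V * T *\<^sub>v \<gamma> + e)) = \<gamma> + Ti *\<^sub>v w"
    by (simp add: mat_dim_simps dims lv[OF V(2)] lv[OF T2] lv[OF T(3)] w_def)
  have "(K * R2 * T) *\<^sub>v (\<gamma> + Ti *\<^sub>v w) - r = ((K * R2 * T) *\<^sub>v \<gamma> - r) + K * R2 * T *\<^sub>v (Ti *\<^sub>v w)"
    using w g r by (subst mult_mat_vec_add_dim) (auto simp: dims intro!: eq_vecI)
  also have "\<dots> = K *\<^sub>v a"
    unfolding c_eq using w by (simp add: a_def mat_dim_simps dims lv[OF T1])
  finally have d: "(K * R2 * T) *\<^sub>v (\<gamma> + Ti *\<^sub>v w) - r = K *\<^sub>v a" .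
  have "V * T *\<^sub>v \<gamma> + e - V * T *\<^sub>v (\<gamma> + Ti *\<^sub>v w) = V * T *\<^sub>v \<gamma> + e - (V * T *\<^sub>v \<gamma> + V *\<^sub>v w)"
    using w g by (subst mult_mat_vec_add_dim) (auto simp: mat_dim_simps dims lv[OF T1])
  also have "\<dots> = e - V *\<^sub>v w"
    using w e by (intro eq_vecI) (auto simp: dims)
  finally have res: "V * T *\<^sub>v \<gamma> + e - V * T *\<^sub>v (\<gamma> + Ti *\<^sub>v w) = e - V *\<^sub>v w" .
  show ?thesis
    unfolding F_statistic_def UU q(1) option.case q(2) gh Let_def d res q(3)[OF a]
    by (simp add: dims w_def a_def)
qed

text \<open>\<open>U\<close> and \<open>Y\<close> enter only through \<open>U' U\<close>,
  \<open>U' Y\<close> and the length of the residual, which \<open>Q\<close> preserves.\<close>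

lemma F_statistic_isometry:
  assumes O: "Q \<in> carrier_mat n n" "Q\<^sup>T * Q = 1\<^sub>m n" and U: "U \<in> carrier_mat n k" and Y: "Y \<in> carrier_vec n"
  shows "F_statistic (Q * U) (Q *\<^sub>v Y) R r = F_statistic U Y R r"
proof -
  note dims = carrier_matD[OF O(1)] carrier_matD[OF U] carrier_vecD[OF Y]
  have l: "dim_row X = n \<Longrightarrow> Q\<^sup>T * (Q * X) = X" for X
    using O by (intro mult_mat_cancel[of _ _ n]) auto
  have lv: "dim_vec v = n \<Longrightarrow> Q\<^sup>T *\<^sub>v (Q *\<^sub>v v) = v" for v
    using O by (intro mult_mat_vec_cancel[of _ _ n]) auto
  have 1: "(Q * U)\<^sup>T * (Q * U) = U\<^sup>T * U"
    by (simp add: mat_dim_simps dims l)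
  have 2: "(Q * U)\<^sup>T *\<^sub>v (Q *\<^sub>v Y) = U\<^sup>T *\<^sub>v Y"
    by (simp add: mat_dim_simps dims lv)
  have ip: "(Q *\<^sub>v v) \<bullet> (Q *\<^sub>v v) = v \<bullet> v" if "dim_vec v = n" for v
    using that by (subst scalar_prod_mult_mat_vec) (auto simp: dims lv)
  have 3: "(Q *\<^sub>v Y - Q * U *\<^sub>v g) \<bullet> (Q *\<^sub>v Y - Q * U *\<^sub>v g) = (Y - U *\<^sub>v g) \<bullet> (Y - U *\<^sub>v g)"
    if "dim_vec g = k" for g
  proof -
    have "Q *\<^sub>v Y - Q * U *\<^sub>v g = Q *\<^sub>v (Y - U *\<^sub>v g)" using that by (simp add: mat_dim_simps dims)
    then show ?thesis using ip that by (simp add: dims)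
  qed
  show ?thesis
  proof (cases "mat_inverse (U\<^sup>T * U)")
    case None
    then show ?thesis by (simp add: F_statistic_def 1)
  next
    case (Some G)
    have "U\<^sup>T * U \<in> carrier_mat k k" using U by simp
    from mat_inverse(2)[OF this Some] have "dim_vec (G *\<^sub>v (U\<^sup>T *\<^sub>v Y)) = k" by auto
    note 3 = 3[OF this]
    show ?thesis
      unfolding F_statistic_def 1 Some option.case 2 Let_def 3
      by (cases "mat_inverse (R * G * R\<^sup>T)") (simp_all add: dims)
  qed
qed

section \<open>Entrywise measurability of random matrices and of the F-statistic\<close>

definition measurable_mat :: "'a measure \<Rightarrow> nat \<Rightarrow> nat \<Rightarrow> ('a \<Rightarrow> real mat) \<Rightarrow> bool" where
  "measurable_mat M n k A \<longleftrightarrow> (\<forall>\<omega>\<in>space M. A \<omega> \<in> carrier_mat n k) \<and>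
     (\<forall>i<n. \<forall>j<k. (\<lambda>\<omega>. A \<omega> $$ (i, j)) \<in> borel_measurable M)"

definition measurable_vec :: "'a measure \<Rightarrow> nat \<Rightarrow> ('a \<Rightarrow> real vec) \<Rightarrow> bool" where
  "measurable_vec M n v \<longleftrightarrow> (\<forall>\<omega>\<in>space M. v \<omega> \<in> carrier_vec n) \<and>
     (\<forall>i<n. (\<lambda>\<omega>. v \<omega> $ i) \<in> borel_measurable M)"

lemma measurable_mat_const: "A \<in> carrier_mat n k \<Longrightarrow> measurable_mat M n k (\<lambda>_. A)"
  by (simp add: measurable_mat_def)

lemma measurable_vec_const: "v \<in> carrier_vec n \<Longrightarrow> measurable_vec M n (\<lambda>_. v)"
  by (simp add: measurable_vec_def)

lemma measurable_mat_transpose: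
  assumes "measurable_mat M n k A" shows "measurable_mat M k n (\<lambda>\<omega>. (A \<omega>)\<^sup>T)"
  unfolding measurable_mat_def
proof (intro conjI allI impI ballI)
  fix i j assume ij: "i < k" "j < n"
  have "(\<lambda>\<omega>. A \<omega> $$ (j, i)) \<in> borel_measurable M" using assms ij by (simp add: measurable_mat_def)
  then show "(\<lambda>\<omega>. (A \<omega>)\<^sup>T $$ (i, j)) \<in> borel_measurable M"
    by (rule measurable_cong[THEN iffD1, rotated]) (use assms ij in \<open>auto simp: measurable_mat_def\<close>)
qed (use assms in \<open>auto simp: measurable_mat_def\<close>)

lemma measurable_mat_mult:
  assumes A: "measurable_mat M n k A" and B: "measurable_mat M k l B"
  shows "measurable_mat M n l (\<lambda>\<omega>. A \<omega> * B \<omega>)"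
  unfolding measurable_mat_def
proof (intro conjI allI impI ballI)
  fix i j assume ij: "i < n" "j < l"
  have "(\<lambda>\<omega>. \<Sum>m = 0..<k. A \<omega> $$ (i, m) * B \<omega> $$ (m, j)) \<in> borel_measurable M"
    using A B ij by (auto simp: measurable_mat_def intro!: borel_measurable_sum borel_measurable_times)
  then show "(\<lambda>\<omega>. (A \<omega> * B \<omega>) $$ (i, j)) \<in> borel_measurable M"
    by (rule measurable_cong[THEN iffD1, rotated])
      (use A B ij in \<open>auto simp: measurable_mat_def scalar_prod_def intro!: sum.cong dest!: bspec\<close>)
next
  fix \<omega> assume "\<omega> \<in> space M"
  then show "A \<omega> * B \<omega> \<in> carrier_mat n l" using A B by (auto simp: measurable_mat_def intro!: mult_carrier_mat[of _ n k])
qed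

lemma measurable_vec_mult:
  assumes A: "measurable_mat M n k A" and B: "measurable_vec M k v"
  shows "measurable_vec M n (\<lambda>\<omega>. A \<omega> *\<^sub>v v \<omega>)"
  unfolding measurable_vec_def
proof (intro conjI allI impI ballI)
  fix i assume i: "i < n"
  have "(\<lambda>\<omega>. \<Sum>m = 0..<k. A \<omega> $$ (i, m) * v \<omega> $ m) \<in> borel_measurable M"
    using A B i by (auto simp: measurable_mat_def measurable_vec_def intro!: borel_measurable_sum borel_measurable_times)
  then show "(\<lambda>\<omega>. (A \<omega> *\<^sub>v v \<omega>) $ i) \<in> borel_measurable M"
    by (rule measurable_cong[THEN iffD1, rotated])
      (use A B i in \<open>auto simp: measurable_mat_def measurable_vec_def scalar_prod_def index_mult_mat_vec intro!: sum.cong dest!: bspec\<close>)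
next
  fix \<omega> assume "\<omega> \<in> space M"
  then show "A \<omega> *\<^sub>v v \<omega> \<in> carrier_vec n" using A B by (auto simp: measurable_mat_def measurable_vec_def intro!: mult_mat_vec_carrier)
qed

lemma measurable_vec_minus:
  assumes A: "measurable_vec M n u" and B: "measurable_vec M n v"
  shows "measurable_vec M n (\<lambda>\<omega>. u \<omega> - v \<omega>)"
  unfolding measurable_vec_def
proof (intro conjI allI impI ballI)
  fix i assume i: "i < n"
  have "(\<lambda>\<omega>. u \<omega> $ i - v \<omega> $ i) \<in> borel_measurable M"
    using A B i by (intro borel_measurable_diff) (auto simp: measurable_vec_def)
  then show "(\<lambda>\<omega>. (u \<omega> - v \<omega>) $ i) \<in> borel_measurable M"
    by (rule measurable_cong[THEN iffD1, rotated])
      (use A B i in \<open>auto simp: measurable_vec_def dest!: bspec\<close>)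
qed (use A B in \<open>auto simp: measurable_vec_def\<close>)

lemma measurable_scalar_prod:
  assumes A: "measurable_vec M n u" and B: "measurable_vec M n v"
  shows "(\<lambda>\<omega>. u \<omega> \<bullet> v \<omega>) \<in> borel_measurable M"
proof -
  have "(\<lambda>\<omega>. \<Sum>m = 0..<n. u \<omega> $ m * v \<omega> $ m) \<in> borel_measurable M"
    using A B by (auto simp: measurable_vec_def intro!: borel_measurable_sum borel_measurable_times)
  then show ?thesis
    by (rule measurable_cong[THEN iffD1, rotated])
      (use A B in \<open>auto simp: measurable_vec_def scalar_prod_def dest!: bspec\<close>)
qed

lemma measurable_det:
  assumes A: "measurable_mat M n n A"
  shows "(\<lambda>\<omega>. det (A \<omega>)) \<in> borel_measurable M"
proof -
  have "(\<lambda>\<omega>. \<Sum>p | p permutes {0..<n}. signof p * (\<Prod>i = 0..<n. A \<omega> $$ (i, p i))) \<in> borel_measurable M"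
    using A by (intro borel_measurable_sum borel_measurable_times borel_measurable_prod borel_measurable_const)
      (auto simp: measurable_mat_def dest: permutes_in_image)
  then show ?thesis
    by (rule measurable_cong[THEN iffD1, rotated])
      (use A in \<open>auto simp: measurable_mat_def det_def'\<close>)
qed

lemma measurable_adj_mat:
  assumes A: "measurable_mat M n n A"
  shows "measurable_mat M n n (\<lambda>\<omega>. adj_mat (A \<omega>))"
  unfolding measurable_mat_def
proof (intro conjI allI impI ballI)
  fix i j assume ij: "i < n" "j < n"
  have "measurable_mat M (n - 1) (n - 1) (\<lambda>\<omega>. mat_delete (A \<omega>) j i)"
    unfolding measurable_mat_def
  proof (intro conjI allI impI ballI)
    fix a b assume ab: "a < n - 1" "b < n - 1"
    have "(\<lambda>\<omega>. A \<omega> $$ (if a < j then a else Suc a, if b < i then b else Suc b)) \<in> borel_measurable M"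
      using A ab by (auto simp: measurable_mat_def)
    then show "(\<lambda>\<omega>. mat_delete (A \<omega>) j i $$ (a, b)) \<in> borel_measurable M"
      by (rule measurable_cong[THEN iffD1, rotated]) (use A ab in \<open>auto simp: measurable_mat_def mat_delete_def dest!: bspec\<close>)
  qed (use A in \<open>auto simp: measurable_mat_def intro!: mat_delete_carrier simp del: One_nat_def\<close>)
  from measurable_det[OF this] have "(\<lambda>\<omega>. cofactor (A \<omega>) j i) \<in> borel_measurable M"
    by (simp add: Determinant.cofactor_def)
  then show "(\<lambda>\<omega>. adj_mat (A \<omega>) $$ (i, j)) \<in> borel_measurable M"
    by (rule measurable_cong[THEN iffD1, rotated]) (use A ij in \<open>auto simp: measurable_mat_def adj_mat_def dest!: bspec\<close>)
qed (use A in \<open>auto simp: measurable_mat_def intro!: adj_mat(1)\<close>)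

lemma measurable_mat_inverse_adj:
  assumes A: "measurable_mat M n n A"
  shows "measurable_mat M n n (\<lambda>\<omega>. inverse (det (A \<omega>)) \<cdot>\<^sub>m adj_mat (A \<omega>))"
  unfolding measurable_mat_def
proof (intro conjI allI impI ballI)
  fix i j assume ij: "i < n" "j < n"
  have "(\<lambda>\<omega>. inverse (det (A \<omega>)) * adj_mat (A \<omega>) $$ (i, j)) \<in> borel_measurable M"
    using measurable_det[OF A] measurable_adj_mat[OF A] ij
    by (intro borel_measurable_times borel_measurable_inverse) (auto simp: measurable_mat_def)
  then show "(\<lambda>\<omega>. (inverse (det (A \<omega>)) \<cdot>\<^sub>m adj_mat (A \<omega>)) $$ (i, j)) \<in> borel_measurable M"
    by (rule measurable_cong[THEN iffD1, rotated]) (use measurable_adj_mat[OF A] ij in \<open>auto simp: measurable_mat_def dest!: bspec\<close>)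
qed (use measurable_adj_mat[OF A] in \<open>auto simp: measurable_mat_def\<close>)

lemma measurable_F_statistic:
  assumes U: "measurable_mat M n k U" and Y: "measurable_vec M n Y"
    and R: "R \<in> carrier_mat q k" and r: "r \<in> carrier_vec q"
  shows "(\<lambda>\<omega>. F_statistic (U \<omega>) (Y \<omega>) R r) \<in> borel_measurable M"
proof -
  define A where "A = (\<lambda>\<omega>. (U \<omega>)\<^sup>T * U \<omega>)"
  have mA: "measurable_mat M k k A"
    unfolding A_def by (intro measurable_mat_mult[OF measurable_mat_transpose[OF U] U])
  define G where "G = (\<lambda>\<omega>. inverse (det (A \<omega>)) \<cdot>\<^sub>m adj_mat (A \<omega>))"
  have mG: "measurable_mat M k k G" unfolding G_def by (rule measurable_mat_inverse_adj[OF mA])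
  define B where "B = (\<lambda>\<omega>. R * G \<omega> * R\<^sup>T)"
  have mB: "measurable_mat M q q B" unfolding B_def
    by (intro measurable_mat_mult[of M q k] mG measurable_mat_const) (use R in auto)
  define H where "H = (\<lambda>\<omega>. inverse (det (B \<omega>)) \<cdot>\<^sub>m adj_mat (B \<omega>))"
  have mH: "measurable_mat M q q H" unfolding H_def by (rule measurable_mat_inverse_adj[OF mB])
  define g where "g = (\<lambda>\<omega>. G \<omega> *\<^sub>v ((U \<omega>)\<^sup>T *\<^sub>v Y \<omega>))"
  have mg: "measurable_vec M k g" unfolding g_def
    by (intro measurable_vec_mult[of M k k] mG measurable_vec_mult[of M k n] measurable_mat_transpose U Y)
  define d where "d = (\<lambda>\<omega>. R *\<^sub>v g \<omega> - r)"
  have md: "measurable_vec M q d" unfolding d_def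
    by (intro measurable_vec_minus measurable_vec_mult[of M q k] mg measurable_mat_const measurable_vec_const R r)
  define e where "e = (\<lambda>\<omega>. Y \<omega> - U \<omega> *\<^sub>v g \<omega>)"
  have me: "measurable_vec M n e" unfolding e_def
    by (intro measurable_vec_minus measurable_vec_mult[of M n k] mg U Y)
  have [measurable]: "(\<lambda>\<omega>. det (A \<omega>)) \<in> borel_measurable M" "(\<lambda>\<omega>. det (B \<omega>)) \<in> borel_measurable M"
    "(\<lambda>\<omega>. e \<omega> \<bullet> e \<omega>) \<in> borel_measurable M" "(\<lambda>\<omega>. d \<omega> \<bullet> (H \<omega> *\<^sub>v d \<omega>)) \<in> borel_measurable M"
    using measurable_det[OF mA] measurable_det[OF mB] measurable_scalar_prod[OF me me]
      measurable_scalar_prod[OF md measurable_vec_mult[OF mH md]] by auto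
  \<comment> \<open>Failing inverses are expressed by vanishing determinants. Since
    \<open>inverse 0 = 0\<close>, the matrices \<open>G\<close> and \<open>H\<close> are defined and
    measurable at every point, also where they are no inverses.\<close>
  have "(\<lambda>\<omega>. if det (A \<omega>) = 0 \<or> det (B \<omega>) = 0 \<or> e \<omega> \<bullet> e \<omega> = 0 then 0
    else (d \<omega> \<bullet> (H \<omega> *\<^sub>v d \<omega>) / real q) / (e \<omega> \<bullet> e \<omega> / real (n - k))) \<in> borel_measurable M"
    by measurable
  then show ?thesis
  proof (rule measurable_cong[THEN iffD1, rotated])
    fix \<omega> assume w: "\<omega> \<in> space M"
    have cU: "U \<omega> \<in> carrier_mat n k" and cA: "A \<omega> \<in> carrier_mat k k" and cB: "B \<omega> \<in> carrier_mat q q"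
      using U mA mB w by (auto simp: measurable_mat_def)
    have Ae: "(U \<omega>)\<^sup>T * U \<omega> = A \<omega>" by (simp add: A_def)
    have eqs: "inverse (det (A \<omega>)) \<cdot>\<^sub>m adj_mat (A \<omega>) = G \<omega>" "R * G \<omega> * R\<^sup>T = B \<omega>"
      "inverse (det (B \<omega>)) \<cdot>\<^sub>m adj_mat (B \<omega>) = H \<omega>" "G \<omega> *\<^sub>v ((U \<omega>)\<^sup>T *\<^sub>v Y \<omega>) = g \<omega>"
      "R *\<^sub>v g \<omega> - r = d \<omega>" "Y \<omega> - U \<omega> *\<^sub>v g \<omega> = e \<omega>"
      by (simp_all add: G_def B_def H_def g_def d_def e_def)
    show "(if det (A \<omega>) = 0 \<or> det (B \<omega>) = 0 \<or> e \<omega> \<bullet> e \<omega> = 0 then 0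
    else (d \<omega> \<bullet> (H \<omega> *\<^sub>v d \<omega>) / real q) / (e \<omega> \<bullet> e \<omega> / real (n - k))) = F_statistic (U \<omega>) (Y \<omega>) R r"
      unfolding F_statistic_def Ae mat_inverse_adj_mat[OF cA]
      using cU R by (cases "det (A \<omega>) = 0"; cases "det (B \<omega>) = 0")
        (simp_all add: eqs mat_inverse_adj_mat[OF cB] Let_def)
  qed
qed

subsection \<open>Gaussian matrices, Gram determinants and concentration\<close>

lemma measurable_PiM_PiM_component:
  "j \<in> J \<Longrightarrow> i \<in> I \<Longrightarrow> (\<lambda>W. W j i) \<in> measurable (PiM J (\<lambda>_. PiM I (\<lambda>_. S))) S"
  by (rule measurable_compose[where f="\<lambda>W. W j" and g="\<lambda>w. w i"]) (rule measurable_component_singleton; assumption)+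

lemma distr_PiM_uncurry:
  assumes S: "prob_space S" and fin: "finite I" "finite J"
  shows "distr (PiM J (\<lambda>_. PiM I (\<lambda>_. S))) (PiM (J \<times> I) (\<lambda>_. S)) (\<lambda>W. \<lambda>(j, i)\<in>J \<times> I. W j i)
       = PiM (J \<times> I) (\<lambda>_. S)"
proof -
  interpret S: prob_space S by fact
  interpret PI: prob_space "PiM I (\<lambda>_. S)" by (intro prob_space_PiM S)
  interpret pS: product_prob_space "\<lambda>_. S" UNIV by standard
  interpret pPI: product_prob_space "\<lambda>_. PiM I (\<lambda>_. S)" UNIV by standard
  show ?thesis
  proof (rule pS.PiM_eqI)
    fix A assume A: "\<And>k. k \<in> J \<times> I \<Longrightarrow> A k \<in> sets S"
    have m: "(\<lambda>W. \<lambda>(j, i)\<in>J \<times> I. W j i) \<in> measurable (PiM J (\<lambda>_. PiM I (\<lambda>_. S))) (PiM (J \<times> I) (\<lambda>_. S))"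
      by (intro measurable_restrict) (auto simp: case_prod_beta intro: measurable_PiM_PiM_component)
    have pre: "(\<lambda>W. \<lambda>(j, i)\<in>J \<times> I. W j i) -` Pi\<^sub>E (J \<times> I) A \<inter> space (PiM J (\<lambda>_. PiM I (\<lambda>_. S)))
      = Pi\<^sub>E J (\<lambda>j. Pi\<^sub>E I (\<lambda>i. A (j, i)))"
      using A[THEN sets.sets_into_space] by (fastforce simp: space_PiM PiE_iff extensional_def)
    have "emeasure (distr (PiM J (\<lambda>_. PiM I (\<lambda>_. S))) (PiM (J \<times> I) (\<lambda>_. S)) (\<lambda>W. \<lambda>(j, i)\<in>J \<times> I. W j i)) (Pi\<^sub>E (J \<times> I) A)
      = emeasure (PiM J (\<lambda>_. PiM I (\<lambda>_. S))) (Pi\<^sub>E J (\<lambda>j. Pi\<^sub>E I (\<lambda>i. A (j, i))))"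
      using A fin by (subst emeasure_distr[OF m]) (auto intro!: sets_PiM_I_finite simp: pre)
    also have "\<dots> = (\<Prod>j\<in>J. emeasure (PiM I (\<lambda>_. S)) (Pi\<^sub>E I (\<lambda>i. A (j, i))))"
      using A fin by (intro pPI.emeasure_PiM) (auto intro!: sets_PiM_I_finite)
    also have "\<dots> = (\<Prod>j\<in>J. \<Prod>i\<in>I. emeasure S (A (j, i)))"
      using A fin by (intro prod.cong refl pS.emeasure_PiM) auto
    also have "\<dots> = (\<Prod>k\<in>J \<times> I. emeasure S (A k))"
      by (subst prod.cartesian_product) (auto intro!: prod.cong)
    finally show "emeasure (distr (PiM J (\<lambda>_. PiM I (\<lambda>_. S))) (PiM (J \<times> I) (\<lambda>_. S)) (\<lambda>W. \<lambda>(j, i)\<in>J \<times> I. W j i)) (Pi\<^sub>E (J \<times> I) A)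
      = (\<Prod>k\<in>J \<times> I. emeasure S (A k))" .
  qed (use fin in auto)
qed

text \<open>Observations are independent rows, whereas isometries act on columns. The passage
  between the two views uncurries, swaps the index pair and curries again.\<close>

lemma distr_PiM_transpose:
  assumes S: "prob_space S" and fin: "finite I" "finite J"
  shows "distr (PiM J (\<lambda>_. PiM I (\<lambda>_. S))) (PiM I (\<lambda>_. PiM J (\<lambda>_. S))) (\<lambda>W. \<lambda>i\<in>I. \<lambda>j\<in>J. W j i)
       = PiM I (\<lambda>_. PiM J (\<lambda>_. S))"
proof -
  let ?JI = "PiM J (\<lambda>_. PiM I (\<lambda>_. S))" and ?IJ = "PiM I (\<lambda>_. PiM J (\<lambda>_. S))"
  let ?c = "\<lambda>v. \<lambda>i\<in>I. \<lambda>j\<in>J. v (i, j)" and ?s = "\<lambda>v. \<lambda>k\<in>I \<times> J. v (snd k, fst k)"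
  let ?u = "\<lambda>W. \<lambda>(j, i)\<in>J \<times> I. W j i" and ?u' = "\<lambda>W. \<lambda>(i, j)\<in>I \<times> J. W i j"
  have mc: "?c \<in> measurable (PiM (I \<times> J) (\<lambda>_. S)) ?IJ" by measurable
  have ms: "?s \<in> measurable (PiM (J \<times> I) (\<lambda>_. S)) (PiM (I \<times> J) (\<lambda>_. S))"
    by (intro measurable_restrict measurable_component_singleton) auto
  have mu: "?u \<in> measurable ?JI (PiM (J \<times> I) (\<lambda>_. S))"
    by (intro measurable_restrict) (auto simp: case_prod_beta intro: measurable_PiM_PiM_component)
  have mu': "?u' \<in> measurable ?IJ (PiM (I \<times> J) (\<lambda>_. S))"
    by (intro measurable_restrict) (auto simp: case_prod_beta intro: measurable_PiM_PiM_component)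
  have "?IJ = distr ?IJ ?IJ (\<lambda>x. x)" by (rule distr_id2[symmetric]) simp
  also have "\<dots> = distr ?IJ ?IJ (?c \<circ> ?u')"
  proof (rule distr_cong)
    fix x assume "x \<in> space ?IJ"
    then have "x \<in> extensional I" "\<And>i. i \<in> I \<Longrightarrow> x i \<in> extensional J" by (auto simp: space_PiM PiE_iff)
    then show "x = (?c \<circ> ?u') x"
      by (auto simp: fun_eq_iff extensional_def)
  qed simp_all
  also have "\<dots> = distr (distr ?IJ (PiM (I \<times> J) (\<lambda>_. S)) ?u') ?IJ ?c"
    by (rule distr_distr[symmetric, OF mc mu'])
  also have "distr ?IJ (PiM (I \<times> J) (\<lambda>_. S)) ?u' = PiM (I \<times> J) (\<lambda>_. S)"
    by (rule distr_PiM_uncurry[OF S fin(2,1)])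
  also have "\<dots> = distr (PiM (J \<times> I) (\<lambda>_. S)) (PiM (I \<times> J) (\<lambda>_. S)) ?s"
    by (rule distr_PiM_reindex[symmetric, where f="\<lambda>k. (snd k, fst k)"]) (auto simp: S inj_on_def)
  also have "PiM (J \<times> I) (\<lambda>_. S) = distr ?JI (PiM (J \<times> I) (\<lambda>_. S)) ?u"
    by (rule distr_PiM_uncurry[symmetric, OF S fin])
  also have "distr \<dots> (PiM (I \<times> J) (\<lambda>_. S)) ?s = distr ?JI (PiM (I \<times> J) (\<lambda>_. S)) (?s \<circ> ?u)"
    by (rule distr_distr[OF ms mu])
  also have "distr \<dots> ?IJ ?c = distr ?JI ?IJ (?c \<circ> (?s \<circ> ?u))"
    by (rule distr_distr[OF mc measurable_comp[OF mu ms]])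
  also have "?c \<circ> (?s \<circ> ?u) = (\<lambda>W. \<lambda>i\<in>I. \<lambda>j\<in>J. W j i)"
    by (auto simp: fun_eq_iff)
  finally show ?thesis ..
qed

lemma distr_PiM_gaussian_isometry:
  fixes p :: nat
  assumes Q: "gaussian_isometry n Q"
  shows "distr (PiM {..<p} (\<lambda>_. std_normal_vec n)) (PiM {..<p} (\<lambda>_. std_normal_vec n)) (compose {..<p} (act n Q))
       = PiM {..<p} (\<lambda>_. std_normal_vec n)"
proof -
  have m: "act n Q \<in> measurable (std_normal_vec n) (std_normal_vec n)"
    by (rule measurable_gaussian_isometry(2)[OF Q])
  have "distr (std_normal_vec n) (std_normal_vec n) (act n Q) = std_normal_vec n"
    using Q unfolding gaussian_isometry_def by (metis distr_cong sets_std_normal_PiM)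
  then show ?thesis
    by (subst distr_PiM_finite_prob_space'[OF _ prob_space_std_normal_vec prob_space_std_normal_vec m]) auto
qed

text \<open>
  The ratio \<open>gram (k + 1) u / gram k u\<close> is the squared distance of \<open>u k\<close> from the span of the previous
  vectors; unlike a projection it is visibly measurable in \<open>u\<close>.
\<close>

definition gram :: "nat \<Rightarrow> (nat \<Rightarrow> real vec) \<Rightarrow> real" where
  "gram k u = det (mat k k (\<lambda>(a, b). u a \<bullet> u b))"

text \<open>\<open>Q\<close> preserves the Gram matrix, which becomes \<open>T' T\<close> for the
  upper triangular block \<open>T\<close> of the rotated vectors.\<close>

lemma gram_triangular:
  assumes Q: "gaussian_isometry n Q" and u: "\<And>a. a < k \<Longrightarrow> u a \<in> carrier_vec n" and kn: "k \<le> n"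
    and tri: "\<And>a i. a < k \<Longrightarrow> i < n \<Longrightarrow> i > a \<Longrightarrow> (Q *\<^sub>v u a) $ i = 0"
  shows "gram k u = (\<Prod>a<k. ((Q *\<^sub>v u a) $ a)\<^sup>2)"
proof -
  define T where "T = mat k k (\<lambda>(i, a). (Q *\<^sub>v u a) $ i)"
  have T: "T \<in> carrier_mat k k" by (simp add: T_def)
  have "mat k k (\<lambda>(a, b). u a \<bullet> u b) = T\<^sup>T * T"
  proof (rule eq_matI)
    fix a b assume "a < dim_row (T\<^sup>T * T)" "b < dim_col (T\<^sup>T * T)"
    then have ab: "a < k" "b < k" using T by auto
    have "u a \<bullet> u b = (Q *\<^sub>v u a) \<bullet> (Q *\<^sub>v u b)"
      by (rule gaussian_isometry_inner[symmetric, OF Q]) (use u ab in auto)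
    also have "\<dots> = (\<Sum>i\<in>{0..<n}. (Q *\<^sub>v u a) $ i * (Q *\<^sub>v u b) $ i)"
      using Q u[OF ab(2)] by (auto simp: scalar_prod_def dest!: gaussian_isometry_carrier)
    also have "\<dots> = (\<Sum>i\<in>{0..<k}. (Q *\<^sub>v u a) $ i * (Q *\<^sub>v u b) $ i)"
      by (rule sum.mono_neutral_right) (use ab kn tri[of a] in auto)
    also have "\<dots> = (T\<^sup>T * T) $$ (a, b)"
      using ab by (simp add: T_def scalar_prod_def)
    finally show "mat k k (\<lambda>(a, b). u a \<bullet> u b) $$ (a, b) = (T\<^sup>T * T) $$ (a, b)"
      using ab by simp
  qed (use T in auto)
  then have "gram k u = det T * det T"
    unfolding gram_def by (simp add: det_mult[OF transpose_carrier_mat[THEN iffD2, OF T] T] det_transpose[OF T])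
  also have "det T = (\<Prod>a<k. (Q *\<^sub>v u a) $ a)"
  proof -
    have "upper_triangular T" using tri kn by (auto simp: T_def upper_triangular_def)
    then have "det T = prod_list (diag_mat T)" by (rule det_upper_triangular[OF _ T])
    also have "\<dots> = (\<Prod>a\<in>{0..<k}. T $$ (a, a))" using T by (simp add: prod_list_diag_prod)
    also have "\<dots> = (\<Prod>a<k. (Q *\<^sub>v u a) $ a)" by (rule prod.cong) (auto simp: T_def)
    finally show ?thesis .
  qed
  finally show ?thesis by (simp add: power2_eq_square prod.distrib)
qed

text \<open>One more elimination in the coordinates from \<open>c\<close> on makes the last vector
  triangular as well. It leaves the previous vectors alone and preserves the squared length of the
  tail, which becomes the squared last pivot.\<close>

lemma gram_Suc:
  assumes Q: "gaussian_isometry n Q" and u: "\<And>a. a \<le> c \<Longrightarrow> u a \<in> carrier_vec n" and cn: "c < n"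
    and tri: "\<And>a i. a < c \<Longrightarrow> i < n \<Longrightarrow> i > a \<Longrightarrow> (Q *\<^sub>v u a) $ i = 0"
  shows "gram (Suc c) u = gram c u * (\<Sum>i\<in>{c..<n}. ((Q *\<^sub>v u c) $ i)\<^sup>2)"
proof -
  have cQ: "Q \<in> carrier_mat n n" using Q by auto
  define w where "w = Q *\<^sub>v u c"
  have w: "w \<in> carrier_vec n" using cQ u[of c] by (simp add: w_def)
  obtain H where H: "gaussian_isometry n H"
    "\<And>x i. x \<in> carrier_vec n \<Longrightarrow> i < n \<Longrightarrow> i < c \<Longrightarrow> (H *\<^sub>v x) $ i = x $ i"
    "\<And>x. x \<in> carrier_vec n \<Longrightarrow> (\<forall>i\<in>{c..<n}. x $ i = 0) \<Longrightarrow> H *\<^sub>v x = x"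
    "\<And>i. i \<in> {Suc c..<n} \<Longrightarrow> (H *\<^sub>v w) $ i = 0" 
  proof -
    have "insert c {Suc c..<n} = {c..<n}" using cn by auto
    then show ?thesis using that gaussian_isometry_eliminate[of "{Suc c..<n}" n c w] cn w
      by (metis (no_types, lifting) atLeastLessThan_iff atLeastLessThan_subset_iff finite_atLeastLessThan
          ivl_subset le_refl lessThan_atLeast0 linorder_not_less not_less_eq_eq zero_le)
  qed
  have cH: "H \<in> carrier_mat n n" using H by auto
  have HQ: "gaussian_isometry n (H * Q)" by (rule gaussian_isometry_mult[OF H(1) Q])
  have HQv: "x \<in> carrier_vec n \<Longrightarrow> H * Q *\<^sub>v x = H *\<^sub>v (Q *\<^sub>v x)" for x
    using cH cQ by simp
  have fix_a: "H * Q *\<^sub>v u a = Q *\<^sub>v u a" if "a < c" for a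
    using that u[of a] cQ tri[of a] by (subst HQv) (auto intro!: H(3))
  have "gram (Suc c) u = (\<Prod>a<Suc c. ((H * Q *\<^sub>v u a) $ a)\<^sup>2)"
  proof (rule gram_triangular[OF HQ])
    fix a i assume "a < Suc c" "i < n" "a < i"
    then show "(H * Q *\<^sub>v u a) $ i = 0"
      using fix_a[of a] tri[of a i] HQv[of "u c"] u[of c] H(4)[of i] by (cases "a = c") (auto simp: w_def)
  qed (use u cn in auto)
  also have "\<dots> = (\<Prod>a<c. ((Q *\<^sub>v u a) $ a)\<^sup>2) * ((H *\<^sub>v w) $ c)\<^sup>2"
    using fix_a u[of c] by (simp add: HQv w_def)
  also have "(\<Prod>a<c. ((Q *\<^sub>v u a) $ a)\<^sup>2) = gram c u"
    by (rule gram_triangular[symmetric, OF Q]) (use u cn tri in auto)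
  also have "((H *\<^sub>v w) $ c)\<^sup>2 = (\<Sum>i\<in>{c..<n}. (w $ i)\<^sup>2)"
  proof -
    have sq: "v \<bullet> v = (\<Sum>i\<in>{0..<c}. (v $ i)\<^sup>2) + (\<Sum>i\<in>{c..<n}. (v $ i)\<^sup>2)" if "v \<in> carrier_vec n" for v :: "real vec"
      using that cn by (simp add: scalar_prod_def power2_eq_square sum.atLeastLessThan_concat)
    have Hw: "H *\<^sub>v w \<in> carrier_vec n" using cH w by simp
    have "(H *\<^sub>v w) \<bullet> (H *\<^sub>v w) = w \<bullet> w" by (rule gaussian_isometry_inner[OF H(1) w w])
    then have "(\<Sum>i\<in>{c..<n}. ((H *\<^sub>v w) $ i)\<^sup>2) = (\<Sum>i\<in>{c..<n}. (w $ i)\<^sup>2)"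
      unfolding sq[OF w] sq[OF Hw] using H(2)[OF w] cn by simp
    moreover have "(\<Sum>i\<in>{c..<n}. ((H *\<^sub>v w) $ i)\<^sup>2) = (\<Sum>i\<in>{c}. ((H *\<^sub>v w) $ i)\<^sup>2)"
      by (rule sum.mono_neutral_right) (use cn H(4) in auto)
    ultimately show ?thesis by simp
  qed
  finally show ?thesis by (simp add: w_def)
qed

section \<open>Second moments of independent sums and chi-square concentration\<close>

lemma (in prob_space) second_moment_sum_indep:
  fixes X :: "'i \<Rightarrow> 'a \<Rightarrow> real" and v :: real
  assumes fin: "finite I" and ind: "indep_vars (\<lambda>_. borel) X I"
    and int: "\<And>i. i \<in> I \<Longrightarrow> integrable M (\<lambda>\<omega>. (X i \<omega>)\<^sup>2)"
    and mean: "\<And>i. i \<in> I \<Longrightarrow> expectation (X i) = 0"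
    and var: "\<And>i. i \<in> I \<Longrightarrow> expectation (\<lambda>\<omega>. (X i \<omega>)\<^sup>2) \<le> v"
  shows "integrable M (\<lambda>\<omega>. (\<Sum>i\<in>I. X i \<omega>)\<^sup>2)" "expectation (\<lambda>\<omega>. (\<Sum>i\<in>I. X i \<omega>)\<^sup>2) \<le> card I * v"
proof -
  have rv: "random_variable borel (X i)" if "i \<in> I" for i
    using ind that by (auto simp: indep_vars_def2)
  have int1: "integrable M (X i)" if "i \<in> I" for i
    using square_integrable_imp_integrable[OF rv[OF that] int[OF that]] .
  have prod: "integrable M (\<lambda>\<omega>. X i \<omega> * X j \<omega>) \<and>
      expectation (\<lambda>\<omega>. X i \<omega> * X j \<omega>) = (if i = j then expectation (\<lambda>\<omega>. (X i \<omega>)\<^sup>2) else 0)"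
    if "i \<in> I" "j \<in> I" for i j
  proof (cases "i = j")
    case True
    then show ?thesis using int[OF that(1)] by (simp add: power2_eq_square)
  next
    case False
    have "indep_vars (\<lambda>_. borel) X {i, j}" by (rule indep_vars_subset[OF ind]) (use that in auto)
    from indep_vars_lebesgue_integral[OF _ this] indep_vars_integrable[OF _ this]
    show ?thesis using False int1 mean that by auto
  qed
  have e: "(\<Sum>i\<in>I. X i \<omega>)\<^sup>2 = (\<Sum>i\<in>I. \<Sum>j\<in>I. X i \<omega> * X j \<omega>)" for \<omega>
    by (simp add: power2_eq_square sum_product)
  show "integrable M (\<lambda>\<omega>. (\<Sum>i\<in>I. X i \<omega>)\<^sup>2)"
    unfolding e using prod by (intro Bochner_Integration.integrable_sum) auto
  have "expectation (\<lambda>\<omega>. (\<Sum>i\<in>I. X i \<omega>)\<^sup>2) = (\<Sum>i\<in>I. \<Sum>j\<in>I. expectation (\<lambda>\<omega>. X i \<omega> * X j \<omega>))"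
    unfolding e using prod by (subst Bochner_Integration.integral_sum, auto intro!: sum.cong Bochner_Integration.integral_sum)
  also have "\<dots> = (\<Sum>i\<in>I. expectation (\<lambda>\<omega>. (X i \<omega>)\<^sup>2))"
    using prod fin by (intro sum.cong refl) (simp add: sum.delta')
  also have "\<dots> \<le> card I * v"
    using var by (intro sum_bounded_above) auto
  finally show "expectation (\<lambda>\<omega>. (\<Sum>i\<in>I. X i \<omega>)\<^sup>2) \<le> card I * v" .
qed

lemma distr_std_normal_vec_component:
  assumes "i < n" shows "distr (std_normal_vec n) borel (\<lambda>w. w i) = std_normal_distribution"
proof -
  have "distr (std_normal_vec n) borel (\<lambda>w. w i) = distr (std_normal_vec n) std_normal_distribution (\<lambda>w. w i)"
    by (rule distr_cong) auto
  also have "\<dots> = std_normal_distribution"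
    using assms by (intro distr_PiM_component prob_space_std_normal_distribution) auto
  finally show ?thesis .
qed

lemma indep_vars_std_normal_vec:
  "prob_space.indep_vars (std_normal_vec n) (\<lambda>_. borel) (\<lambda>i w. w i) {..<n}"
\<comment> \<open>The characterization of independence by a product law asks for a nonempty index
  set.\<close>
proof (cases "n = 0")
  case True
  interpret prob_space "std_normal_vec n" by (rule prob_space_std_normal_vec)
  show ?thesis unfolding indep_vars_def indep_sets_def using True by auto
next
  case False
  interpret prob_space "std_normal_vec n" by (rule prob_space_std_normal_vec)
  have "distr (std_normal_vec n) (PiM {..<n} (\<lambda>_. borel)) (\<lambda>x. \<lambda>i\<in>{..<n}. x i) = std_normal_vec n"
  proof -
    have "distr (std_normal_vec n) (PiM {..<n} (\<lambda>_. borel)) (\<lambda>x. \<lambda>i\<in>{..<n}. x i) = distr (std_normal_vec n) (std_normal_vec n) (\<lambda>x. x)"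
      by (rule distr_cong) (auto simp: sets_std_normal_PiM space_std_normal_vec space_borel_vec extensional_restrict)
    then show ?thesis by (simp add: distr_id2)
  qed
  then show ?thesis
    using False by (subst indep_vars_iff_distr_eq_PiM') (auto simp: distr_std_normal_vec_component intro!: PiM_cong)
qed

lemma std_normal_vec_moment_even:
  assumes i: "i < n"
  shows "has_bochner_integral (std_normal_vec n) (\<lambda>w. w i ^ (2 * k)) (fact (2 * k) / (2 ^ k * fact k))"
proof -
  have "has_bochner_integral std_normal_distribution (\<lambda>x. x ^ (2 * k)) (fact (2 * k) / (2 ^ k * fact k))"
    using std_normal_moment_even[of k] by (intro has_bochner_integral_density) auto
  then have "has_bochner_integral (distr (std_normal_vec n) borel (\<lambda>w. w i)) (\<lambda>x. x ^ (2 * k)) (fact (2 * k) / (2 ^ k * fact k))"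
    by (simp only: distr_std_normal_vec_component[OF i])
  then show ?thesis
    using i by (simp add: has_bochner_integral_iff integrable_distr_eq integral_distr)
qed

text \<open>Chebyshev's inequality. The second and fourth Gaussian moments are 1 and 3, so each
  \<open>(w i)\<^sup>2 - 1\<close> is centered with variance \<open>3 - 2 + 1 = 2\<close>.\<close>

lemma chi_square_concentration:
  assumes S: "S \<subseteq> {..<n}" and t: "t > 0"
  shows "measure (std_normal_vec n) {w \<in> space (std_normal_vec n). \<bar>(\<Sum>i\<in>S. (w i)\<^sup>2) - real (card S)\<bar> \<ge> t} \<le> 2 * card S / t\<^sup>2"
proof -
  interpret prob_space "std_normal_vec n" by (rule prob_space_std_normal_vec)
  have fin: "finite S" using S finite_subset by blast
  let ?X = "\<lambda>i w. (w i)\<^sup>2 - 1 :: real"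
  have ind: "indep_vars (\<lambda>_. borel) ?X S"
    using indep_vars_compose2[OF indep_vars_subset[OF indep_vars_std_normal_vec S], of "\<lambda>_ x. x\<^sup>2 - 1" "\<lambda>_. borel"] by auto
  have m2: "has_bochner_integral (std_normal_vec n) (\<lambda>w. (w i)\<^sup>2) 1"
   and m4: "has_bochner_integral (std_normal_vec n) (\<lambda>w. (w i) ^ 4) 3" if "i \<in> S" for i
    using std_normal_vec_moment_even[of i n 1] std_normal_vec_moment_even[of i n 2] that S
    by (auto simp: fact_numeral)
  have v: "has_bochner_integral (std_normal_vec n) (\<lambda>w. (?X i w)\<^sup>2) 2" if "i \<in> S" for i
  proof -
    have "has_bochner_integral (std_normal_vec n) (\<lambda>w. (w i) ^ 4 - 2 * (w i)\<^sup>2 + 1) (3 - 2 * 1 + 1)"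
      using m2[OF that] m4[OF that]
      by (intro has_bochner_integral_add has_bochner_integral_diff has_bochner_integral_mult_right)
        (auto simp: has_bochner_integral_iff prob_space)
    moreover have "(w i) ^ 4 - 2 * (w i)\<^sup>2 + 1 = (?X i w)\<^sup>2" for w :: "nat \<Rightarrow> real"
      by (simp add: power2_eq_square power4_eq_xxxx algebra_simps)
    ultimately show ?thesis by simp
  qed
  have e: "expectation (?X i) = 0" if "i \<in> S" for i
    using m2[OF that] by (simp add: has_bochner_integral_iff prob_space)
  have "integrable (std_normal_vec n) (\<lambda>w. (\<Sum>i\<in>S. ?X i w)\<^sup>2)"
    and le: "expectation (\<lambda>w. (\<Sum>i\<in>S. ?X i w)\<^sup>2) \<le> real (card S) * 2"
    by (rule second_moment_sum_indep[OF fin ind, of 2]; use v e in \<open>simp add: has_bochner_integral_iff\<close>)+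
  moreover have "random_variable borel (\<lambda>w. \<Sum>i\<in>S. ?X i w)"
    using S by (intro borel_measurable_sum) auto
  ultimately have "measure (std_normal_vec n) {w \<in> space (std_normal_vec n). \<bar>\<Sum>i\<in>S. ?X i w\<bar> \<ge> t}
    \<le> expectation (\<lambda>w. (\<Sum>i\<in>S. ?X i w)\<^sup>2) / t\<^sup>2"
    using t by (intro second_moment_method) auto
  also have "\<dots> \<le> (real (card S) * 2) / t\<^sup>2"
    using le by (intro divide_right_mono) auto
  finally show ?thesis by (simp add: sum_subtractf mult.commute)
qed

subsection \<open>Anti-concentration and the non-central F-distribution\<close>

text \<open>\<open>W\<close> is stored by columns: \<open>W l i\<close> is coordinate
  \<open>l\<close> of observation \<open>i\<close>. The column of ones comes first, so column
  \<open>a > 0\<close> of the design is column \<open>a - 1\<close> of \<open>W\<close>.\<close>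

definition design_col :: "nat \<Rightarrow> (nat \<Rightarrow> nat \<Rightarrow> real) \<Rightarrow> nat \<Rightarrow> real vec" where
  "design_col n W a = vec n (\<lambda>i. if a = 0 then 1 else W (a - 1) i)"

lemma design_col_carrier [simp]: "design_col n W a \<in> carrier_vec n"
  by (simp add: design_col_def)

lemma measurable_PiM_borel_vec:
  "c < p \<Longrightarrow> i < n \<Longrightarrow> (\<lambda>W. W c i) \<in> borel_measurable (PiM {..<p} (\<lambda>_. borel_vec n))"
  by (rule measurable_PiM_PiM_component) auto

lemma sets_PiM_std_normal_vec:
  "sets (PiM I (\<lambda>_. std_normal_vec n)) = sets (PiM I (\<lambda>_. borel_vec n))"
  by (intro sets_PiM_cong sets_std_normal_PiM refl)

lemma measurable_gram_design_col:
  assumes "k \<le> Suc p"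
  shows "(\<lambda>W. gram k (design_col n W)) \<in> borel_measurable (PiM {..<p} (\<lambda>_. borel_vec n))"
  unfolding gram_def
proof (rule measurable_det)
  let ?M = "PiM {..<p} (\<lambda>_. borel_vec n)"
  have c: "measurable_vec ?M n (\<lambda>W. design_col n W a)" if "a < k" for a
    unfolding measurable_vec_def using that assms
    by (cases a) (auto simp: design_col_def intro!: measurable_PiM_borel_vec)
  show "measurable_mat ?M k k (\<lambda>W. mat k k (\<lambda>(a, b). design_col n W a \<bullet> design_col n W b))"
    unfolding measurable_mat_def using measurable_scalar_prod[OF c c] by auto
qed

text \<open>With the other columns held fixed, the ratio is the squared tail of
  \<open>act n Q z\<close>, where \<open>z\<close> is column \<open>c\<close> of \<open>W\<close>,
  and \<open>act n Q z\<close> has the law of \<open>z\<close>. It is an inequality because the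
  event on the left also demands a nonzero denominator.\<close>

lemma emeasure_gram_ratio_le:
  assumes c: "c < p" "Suc c < n" and A: "A \<in> sets borel"
  shows "emeasure (PiM {..<p} (\<lambda>_. std_normal_vec n))
      {W \<in> space (PiM {..<p} (\<lambda>_. std_normal_vec n)). gram (Suc c) (design_col n W) \<noteq> 0 \<and>
         gram (Suc (Suc c)) (design_col n W) / gram (Suc c) (design_col n W) \<in> A}
    \<le> emeasure (std_normal_vec n) {w \<in> space (std_normal_vec n). (\<Sum>i\<in>{Suc c..<n}. (w i)\<^sup>2) \<in> A}"
    (is "emeasure ?P ?B \<le> emeasure ?G ?A'")
proof -
  interpret G: prob_space ?G by (rule prob_space_std_normal_vec)
  interpret pG: product_prob_space "\<lambda>_. ?G" UNIV by standard
  define J where "J = {..<p} - {c}"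
  have J: "finite J" "c \<notin> J" "{..<p} = insert c J" using c by (auto simp: J_def)
  have [measurable]: "(\<lambda>W. gram (Suc c) (design_col n W)) \<in> borel_measurable ?P" "(\<lambda>W. gram (Suc (Suc c)) (design_col n W)) \<in> borel_measurable ?P"
    using c by (auto intro!: measurable_gram_design_col simp: measurable_cong_sets[OF sets_PiM_std_normal_vec refl])
  have B[measurable]: "?B \<in> sets ?P" using A by measurable
  have A'[measurable]: "?A' \<in> sets ?G" using A by measurable
  have inner: "(\<integral>\<^sup>+z. indicator ?B (x(c := z)) \<partial>?G) \<le> emeasure ?G ?A'" if x: "x \<in> space (PiM J (\<lambda>_. ?G))" for x
  proof -
    \<comment> \<open>\<open>Q\<close> is built from the columns before \<open>c\<close> only, so it
      stays constant while column \<open>c\<close> is integrated out.\<close>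
    obtain Q where Q: "gaussian_isometry n Q"
      "\<And>a i. a < Suc c \<Longrightarrow> i < n \<Longrightarrow> i \<notin> id ` {..a} \<Longrightarrow> (Q *\<^sub>v design_col n x a) $ i = 0"
      using gaussian_isometry_triangularize[of "Suc c" "design_col n x" n id] c by auto
    have same: "design_col n (x(c := z)) a = design_col n x a" if "a < Suc c" for z a
      using that by (cases a) (auto simp: design_col_def)
    have last: "design_col n (x(c := z)) (Suc c) = vec n z" for z by (simp add: design_col_def)
    have step: "gram (Suc (Suc c)) (design_col n (x(c := z))) =
      gram (Suc c) (design_col n (x(c := z))) * (\<Sum>i\<in>{Suc c..<n}. (act n Q z i)\<^sup>2)" for z
    proof -
      have "gram (Suc (Suc c)) (design_col n (x(c := z))) = gram (Suc c) (design_col n (x(c := z))) * (\<Sum>i\<in>{Suc c..<n}. ((Q *\<^sub>v design_col n (x(c := z)) (Suc c)) $ i)\<^sup>2)"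
        by (rule gram_Suc[OF Q(1)]) (use c in \<open>auto simp: same Q(2)\<close>)
      also have "(\<Sum>i\<in>{Suc c..<n}. ((Q *\<^sub>v design_col n (x(c := z)) (Suc c)) $ i)\<^sup>2) = (\<Sum>i\<in>{Suc c..<n}. (act n Q z i)\<^sup>2)"
        unfolding last by (rule sum.cong) (auto simp: act_def)
      finally show ?thesis .
    qed
    have mQ: "act n Q \<in> measurable ?G (borel_vec n)"
      by (rule measurable_gaussian_isometry(1)[OF Q(1)])
    have A'b: "?A' \<in> sets (borel_vec n)" using A' by (simp add: sets_std_normal_PiM)
    have "(\<integral>\<^sup>+z. indicator ?B (x(c := z)) \<partial>?G) \<le> (\<integral>\<^sup>+z. indicator ?A' (act n Q z) \<partial>?G)"
    proof (rule nn_integral_mono)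
      fix z assume z: "z \<in> space ?G"
      have "act n Q z \<in> space ?G" using measurable_space[OF mQ z] by (simp add: space_std_normal_vec)
      then show "indicator ?B (x(c := z)) \<le> (indicator ?A' (act n Q z) :: ennreal)"
        using step[of z] by (auto simp: indicator_def)
    qed
    also have "\<dots> = emeasure (distr ?G (borel_vec n) (act n Q)) ?A'"
      using mQ A'b by (simp add: nn_integral_distr flip: nn_integral_indicator)
    also have "\<dots> = emeasure ?G ?A'" using Q(1) by (simp add: gaussian_isometry_def)
    finally show ?thesis .
  qed
  have "emeasure ?P ?B = (\<integral>\<^sup>+W. indicator ?B W \<partial>?P)" by simp
  also have "\<dots> = (\<integral>\<^sup>+x. \<integral>\<^sup>+z. indicator ?B (x(c := z)) \<partial>?G \<partial>PiM J (\<lambda>_. ?G))"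
    unfolding J(3) by (rule pG.product_nn_integral_insert[OF J(1,2)]) (use B in \<open>simp add: J(3)\<close>)
  also have "\<dots> \<le> (\<integral>\<^sup>+x. emeasure ?G ?A' \<partial>PiM J (\<lambda>_. ?G))"
    by (intro nn_integral_mono inner)
  also have "\<dots> = emeasure ?G ?A'"
    using prob_space.emeasure_space_1[OF prob_space_PiM[of J "\<lambda>_. ?G", OF prob_space_std_normal_vec]] by simp
  finally show ?thesis .
qed

text \<open>The Gaussian density is at most \<open>1 / sqrt (2 * pi)\<close>, which is below
  \<open>1 / 2\<close> because \<open>pi \<ge> 2\<close>.\<close>

lemma emeasure_std_normal_le_lborel:
  assumes [measurable]: "A \<in> sets borel"
  shows "emeasure std_normal_distribution A \<le> ennreal (1 / 2) * emeasure lborel A"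
proof -
  have "emeasure std_normal_distribution A = (\<integral>\<^sup>+x. ennreal (std_normal_density x) * indicator A x \<partial>lborel)"
    by (rule emeasure_density) auto
  also have "\<dots> \<le> (\<integral>\<^sup>+x. ennreal (1 / 2) * indicator A x \<partial>lborel)"
  proof (intro nn_integral_mono mult_right_mono ennreal_leI)
    fix x :: real
    have "2 = sqrt (2 * 2)" by simp
    also have "\<dots> \<le> sqrt (2 * pi)" using pi_ge_two by (intro real_sqrt_le_mono) auto
    finally have "inverse (sqrt (2 * pi)) \<le> inverse 2" by (intro le_imp_inverse_le) auto
    then have "1 / sqrt (2 * pi) * exp (- x\<^sup>2 / 2) \<le> inverse 2 * 1"
      by (intro mult_mono) (auto simp: inverse_eq_divide)
    then show "std_normal_density x \<le> 1 / 2" by (simp add: std_normal_density_def)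
  qed auto
  also have "\<dots> = ennreal (1 / 2) * emeasure lborel A" by (simp add: nn_integral_cmult)
  finally show ?thesis .
qed

lemma AE_std_normal_vec_component_nonzero:
  assumes i: "i < n" shows "AE w in std_normal_vec n. w i \<noteq> 0"
proof (rule AE_PiM_component)
  have "emeasure std_normal_distribution {0} \<le> ennreal (1 / 2) * emeasure lborel {0::real}"
    by (rule emeasure_std_normal_le_lborel) auto
  then have "emeasure std_normal_distribution {0} = 0" by simp
  then have "{0} \<in> null_sets std_normal_distribution" by auto
  then show "AE x in std_normal_distribution. x \<noteq> 0"
    by (rule AE_I') auto
qed (use i prob_space_std_normal_distribution in auto)

lemma AE_std_normal_vec_sum_squares_pos:
  assumes S: "S \<subseteq> {..<n}" "S \<noteq> {}" shows "AE w in std_normal_vec n. (\<Sum>i\<in>S. (w i)\<^sup>2) > 0"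
proof -
  from S obtain i where i: "i \<in> S" by auto
  have fin: "finite S" using S finite_subset by blast
  have "AE w in std_normal_vec n. w i \<noteq> 0" using i S by (intro AE_std_normal_vec_component_nonzero) auto
  then show ?thesis
  proof eventually_elim
    case (elim w)
    then show ?case using i fin by (intro sum_pos2[of S i]) auto
  qed
qed

lemma gram_design_col_Suc_0: "n > 0 \<Longrightarrow> gram (Suc 0) (design_col n W) \<noteq> 0"
proof -
  assume n: "n > 0"
  have "gram (Suc 0) (design_col n W) = gram 0 (design_col n W) * (\<Sum>i\<in>{0..<n}. ((1\<^sub>m n *\<^sub>v design_col n W 0) $ i)\<^sup>2)"
    by (rule gram_Suc[OF gaussian_isometry_one]) (use n in auto)
  also have "\<dots> = real n" by (simp add: gram_def design_col_def)
  finally show ?thesis using n by simp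
qed

text \<open>The design has full column rank almost surely: each new column keeps a positive distance
  from the span of the previous ones, as \<open>c < n\<close> leaves it at least one free
  coordinate.\<close>

lemma AE_gram_design_col_nonzero:
  assumes "c \<le> p" "c < n"
  shows "AE W in PiM {..<p} (\<lambda>_. std_normal_vec n). gram (Suc c) (design_col n W) \<noteq> 0"
  using assms
proof (induction c)
  case 0
  then show ?case by (simp add: gram_design_col_Suc_0)
next
  case (Suc c)
  let ?P = "PiM {..<p} (\<lambda>_. std_normal_vec n)"
  have [measurable]: "(\<lambda>W. gram (Suc c) (design_col n W)) \<in> borel_measurable ?P" "(\<lambda>W. gram (Suc (Suc c)) (design_col n W)) \<in> borel_measurable ?P"
    using Suc.prems by (auto intro!: measurable_gram_design_col simp: measurable_cong_sets[OF sets_PiM_std_normal_vec refl])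
  let ?B = "{W \<in> space ?P. gram (Suc c) (design_col n W) \<noteq> 0 \<and>
         gram (Suc (Suc c)) (design_col n W) / gram (Suc c) (design_col n W) \<in> {0}}"
  have "emeasure ?P ?B \<le> emeasure (std_normal_vec n) {w \<in> space (std_normal_vec n). (\<Sum>i\<in>{Suc c..<n}. (w i)\<^sup>2) \<in> {0}}"
    by (rule emeasure_gram_ratio_le) (use Suc.prems in auto)
  also have "\<dots> = 0"
  proof -
    have "AE w in std_normal_vec n. (\<Sum>i\<in>{Suc c..<n}. (w i)\<^sup>2) > 0"
      by (rule AE_std_normal_vec_sum_squares_pos) (use Suc.prems in auto)
    then have "AE w in std_normal_vec n. \<not> (\<Sum>i\<in>{Suc c..<n}. (w i)\<^sup>2) \<in> {0}"
      by eventually_elim auto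
    then show ?thesis by (subst (asm) AE_iff_measurable[OF _ refl]) auto
  qed
  finally have "emeasure ?P ?B = 0" by simp
  then have "AE W in ?P. W \<notin> ?B" by (intro AE_not_in) auto
  moreover have "AE W in ?P. gram (Suc c) (design_col n W) \<noteq> 0" using Suc by simp
  ultimately show ?case using AE_space by eventually_elim auto
qed

lemma (in prob_space) abs_prob_diff_le:
  assumes "A \<in> events" "B \<in> events" "C \<in> events" "A \<subseteq> B \<union> C" "B \<subseteq> A \<union> C"
  shows "\<bar>prob A - prob B\<bar> \<le> prob C"
proof -
  have "prob A \<le> prob (B \<union> C)" "prob B \<le> prob (A \<union> C)" using assms by (auto intro!: finite_measure_mono)
  moreover have "prob (B \<union> C) \<le> prob B + prob C" "prob (A \<union> C) \<le> prob A + prob C"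
    using assms by (auto intro!: measure_Un_le)
  ultimately show ?thesis by linarith
qed

lemma square_band:
  fixes x b a C \<delta> :: real
  assumes "\<bar>b - a\<bar> \<le> \<delta>" "((b + x)\<^sup>2 \<le> C) \<noteq> ((a + x)\<^sup>2 \<le> C)"
  shows "C \<ge> 0 \<and> \<bar>\<bar>a + x\<bar> - sqrt C\<bar> \<le> \<delta>"
proof -
  have C: "C \<ge> 0"
    using assms(2) by (meson order_trans zero_le_power2)
  have e: "y\<^sup>2 \<le> C \<longleftrightarrow> \<bar>y\<bar> \<le> sqrt C" for y :: real
    using C real_le_rsqrt[of "\<bar>y\<bar>" C] by (metis power2_abs real_sqrt_abs real_sqrt_le_iff)
  have "\<bar>\<bar>b + x\<bar> - \<bar>a + x\<bar>\<bar> \<le> \<delta>" using assms(1) by linarith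
  then show ?thesis using assms(2) C unfolding e by linarith
qed

text \<open>The two events differ only where \<open>b w\<close> is more than \<open>\<delta>\<close>
  away from \<open>a\<close>, or where \<open>\<bar>a + w j\<bar>\<close> lies within
  \<open>\<delta>\<close> of \<open>sqrt (C w)\<close>. As \<open>C\<close> is free of
  \<open>w j\<close>, for fixed other coordinates the latter confines \<open>w j\<close> to two
  intervals of length \<open>2 * \<delta>\<close>, each of Gaussian measure at most
  \<open>\<delta>\<close>.\<close>

lemma anti_concentration:
  fixes b C :: "(nat \<Rightarrow> real) \<Rightarrow> real"
  assumes j: "j < n" and [measurable]: "b \<in> borel_measurable (borel_vec n)" "C \<in> borel_measurable (borel_vec n)"
    and C: "\<And>w x. C (w(j := x)) = C w" and d: "\<delta> > 0"
  shows "\<bar>measure (std_normal_vec n) {w \<in> space (std_normal_vec n). (b w + w j)\<^sup>2 \<le> C w}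
      - measure (std_normal_vec n) {w \<in> space (std_normal_vec n). (a + w j)\<^sup>2 \<le> C w}\<bar>
    \<le> measure (std_normal_vec n) {w \<in> space (std_normal_vec n). \<bar>b w - a\<bar> > \<delta>} + 2 * \<delta>"
proof -
  let ?G = "std_normal_vec n"
  interpret prob_space ?G by (rule prob_space_std_normal_vec)
  note [measurable] = measurable_component_singleton[of j "{..<n}" "\<lambda>_. borel"]
  have jn: "j \<in> {..<n}" using j by simp
  define Band where "Band = {w \<in> space ?G. C w \<ge> 0 \<and> \<bar>\<bar>a + w j\<bar> - sqrt (C w)\<bar> \<le> \<delta>}"
  have Bm[measurable]: "Band \<in> sets ?G" unfolding Band_def using jn by measurable
  define J where "J = {..<n} - {j}"
  have J: "finite J" "j \<notin> J" "{..<n} = insert j J" using j by (auto simp: J_def)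
  have inner: "(\<integral>\<^sup>+x. indicator Band (w(j := x)) \<partial>std_normal_distribution) \<le> ennreal (2 * \<delta>)" for w
  proof -
    let ?r = "sqrt (C w)"
    let ?I1 = "{?r - \<delta> - a..?r + \<delta> - a}" and ?I2 = "{- ?r - \<delta> - a..- ?r + \<delta> - a}"
    have "(\<integral>\<^sup>+x. indicator Band (w(j := x)) \<partial>std_normal_distribution) \<le> (\<integral>\<^sup>+x. indicator (?I1 \<union> ?I2) x \<partial>std_normal_distribution)"
    proof (rule nn_integral_mono)
      fix x
      have "x \<in> ?I1 \<union> ?I2" if "\<bar>\<bar>a + x\<bar> - ?r\<bar> \<le> \<delta>" using that by auto
      then show "indicator Band (w(j := x)) \<le> (indicator (?I1 \<union> ?I2) x :: ennreal)"
        by (auto simp: Band_def C indicator_def)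
    qed
    also have "\<dots> = emeasure std_normal_distribution (?I1 \<union> ?I2)" by simp
    also have "\<dots> \<le> emeasure std_normal_distribution ?I1 + emeasure std_normal_distribution ?I2"
      by (rule emeasure_subadditive) auto
    also have "\<dots> \<le> ennreal (1 / 2) * emeasure lborel ?I1 + ennreal (1 / 2) * emeasure lborel ?I2"
      by (intro add_mono emeasure_std_normal_le_lborel) auto
    also have "\<dots> = ennreal (1 / 2 * (2 * \<delta>)) + ennreal (1 / 2 * (2 * \<delta>))"
      using d by (subst (1 2) ennreal_mult) auto
    also have "\<dots> = ennreal (2 * \<delta>)"
      using d by (simp flip: ennreal_plus)
    finally show ?thesis .
  qed
  have "emeasure ?G Band = (\<integral>\<^sup>+w. indicator Band w \<partial>?G)" by simp
  also have "\<dots> = (\<integral>\<^sup>+w. \<integral>\<^sup>+x. indicator Band (w(j := x)) \<partial>std_normal_distribution \<partial>PiM J (\<lambda>_. std_normal_distribution))"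
    unfolding J(3) by (rule std_normal_prod.product_nn_integral_insert[OF J(1,2)]) (use Bm in \<open>simp add: J(3)\<close>)
  also have "\<dots> \<le> (\<integral>\<^sup>+w. ennreal (2 * \<delta>) \<partial>PiM J (\<lambda>_. std_normal_distribution))"
    by (intro nn_integral_mono inner)
  also have "\<dots> = ennreal (2 * \<delta>)"
    using prob_space.emeasure_space_1[OF prob_space_PiM[of J "\<lambda>_. std_normal_distribution", OF prob_space_std_normal_distribution]] by simp
  finally have band: "prob Band \<le> 2 * \<delta>"
    using d by (simp add: emeasure_eq_measure)
  let ?Bad = "{w \<in> space ?G. \<bar>b w - a\<bar> > \<delta>}"
  have Bad: "?Bad \<in> events" by measurable
  have "\<bar>prob {w \<in> space ?G. (b w + w j)\<^sup>2 \<le> C w} - prob {w \<in> space ?G. (a + w j)\<^sup>2 \<le> C w}\<bar> \<le> prob (?Bad \<union> Band)"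
  proof (rule abs_prob_diff_le)
    show "{w \<in> space ?G. (b w + w j)\<^sup>2 \<le> C w} \<in> events" "{w \<in> space ?G. (a + w j)\<^sup>2 \<le> C w} \<in> events"
      using jn by measurable
    show "?Bad \<union> Band \<in> events" using Bad Bm by auto
    have "w \<in> ?Bad \<union> Band" if "w \<in> space ?G" "((b w + w j)\<^sup>2 \<le> C w) \<noteq> ((a + w j)\<^sup>2 \<le> C w)" for w
      using square_band[of "b w" a \<delta> "w j" "C w"] that by (cases "\<bar>b w - a\<bar> > \<delta>") (auto simp: Band_def not_less)
    then show "{w \<in> space ?G. (b w + w j)\<^sup>2 \<le> C w} \<subseteq> {w \<in> space ?G. (a + w j)\<^sup>2 \<le> C w} \<union> (?Bad \<union> Band)"
      "{w \<in> space ?G. (a + w j)\<^sup>2 \<le> C w} \<subseteq> {w \<in> space ?G. (b w + w j)\<^sup>2 \<le> C w} \<union> (?Bad \<union> Band)"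
      by blast+
  qed
  also have "\<dots> \<le> prob ?Bad + prob Band" by (rule measure_Un_le[OF Bad Bm])
  finally show ?thesis using band by simp
qed

text \<open>The statistic in the rotated basis: coordinates below \<open>j\<close> belong to the
  untested regressors, the \<open>q\<close> coordinates from \<open>j\<close> on to the tested ones,
  and the rest to the residual. Only coordinate \<open>j\<close> is shifted.\<close>

definition shifted_F :: "nat \<Rightarrow> nat \<Rightarrow> nat \<Rightarrow> real \<Rightarrow> (nat \<Rightarrow> real) \<Rightarrow> real" where
  "shifted_F j q n c w = (((c + w j)\<^sup>2 + (\<Sum>i\<in>{Suc j..<j + q}. (w i)\<^sup>2)) / real q) /
     ((\<Sum>i\<in>{j + q..<n}. (w i)\<^sup>2) / real (n - (j + q)))"

lemma measurable_shifted_F: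
  assumes "j < n" "j + q \<le> n" "b \<in> borel_measurable (borel_vec n)"
  shows "(\<lambda>w. shifted_F j q n (b w) w) \<in> borel_measurable (borel_vec n)"
proof -
  note c = measurable_coordinate
  show ?thesis unfolding shifted_F_def
    using assms by (intro borel_measurable_divide borel_measurable_add borel_measurable_power borel_measurable_sum
        borel_measurable_const c) auto
qed

text \<open>Isolating the shifted square leaves a right-hand side free of \<open>w j\<close>, as
  \<open>anti_concentration\<close> demands.\<close>

lemma shifted_F_le_iff:
  assumes "q > 0" "j + q < n" "(\<Sum>i\<in>{j + q..<n}. (w i)\<^sup>2) > 0"
  shows "shifted_F j q n c w \<le> t \<longleftrightarrow>
    (c + w j)\<^sup>2 \<le> t * (real q / real (n - (j + q))) * (\<Sum>i\<in>{j + q..<n}. (w i)\<^sup>2) - (\<Sum>i\<in>{Suc j..<j + q}. (w i)\<^sup>2)"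
proof -
  have aux: "(x + M) / q' / (D / m) \<le> t \<longleftrightarrow> x \<le> t * (q' / m) * D - M"
    if "q' > 0" "m > 0" "D > 0" for x M q' D m :: real
    using that by (simp add: field_simps)
  show ?thesis unfolding shifted_F_def by (rule aux) (use assms in auto)
qed

text \<open>The shift \<open>b w\<close> may depend on all coordinates of \<open>w\<close>, including the shifted one.\<close>

lemma shifted_F_comparison:
  assumes q: "q > 0" "j + q < n" and b: "b \<in> borel_measurable (borel_vec n)" and d: "\<delta> > 0"
  shows "\<bar>measure (std_normal_vec n) {w \<in> space (std_normal_vec n). shifted_F j q n (b w) w \<le> t}
      - measure (std_normal_vec n) {w \<in> space (std_normal_vec n). shifted_F j q n a w \<le> t}\<bar>
    \<le> measure (std_normal_vec n) {w \<in> space (std_normal_vec n). \<bar>b w - a\<bar> > \<delta>} + 2 * \<delta>"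
proof -
  let ?G = "std_normal_vec n"
  define C where "C = (\<lambda>w. t * (real q / real (n - (j + q))) * (\<Sum>i\<in>{j + q..<n}. (w i)\<^sup>2) - (\<Sum>i\<in>{Suc j..<j + q}. (w i :: real)\<^sup>2))"
  note c = measurable_coordinate
  have C[measurable]: "C \<in> borel_measurable (borel_vec n)"
    unfolding C_def using q by (intro borel_measurable_diff borel_measurable_times borel_measurable_sum borel_measurable_power
        borel_measurable_const c) auto
  have eq: "measure ?G {w \<in> space ?G. shifted_F j q n (f w) w \<le> t} = measure ?G {w \<in> space ?G. (f w + w j)\<^sup>2 \<le> C w}"
    if f[measurable]: "f \<in> borel_measurable (borel_vec n)" for f
  proof (rule measure_eq_AE)
    have "AE w in ?G. (\<Sum>i\<in>{j + q..<n}. (w i)\<^sup>2) > 0"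
      by (rule AE_std_normal_vec_sum_squares_pos) (use q in auto)
    then show "AE w in ?G. w \<in> {w \<in> space ?G. shifted_F j q n (f w) w \<le> t} \<longleftrightarrow> w \<in> {w \<in> space ?G. (f w + w j)\<^sup>2 \<le> C w}"
      by eventually_elim (simp add: shifted_F_le_iff[OF q] C_def)
    have [measurable]: "(\<lambda>w. shifted_F j q n (f w) w) \<in> borel_measurable (borel_vec n)" "(\<lambda>w. w j) \<in> borel_measurable (borel_vec n)"
      using q by (auto intro!: measurable_shifted_F f c)
    show "{w \<in> space ?G. shifted_F j q n (f w) w \<le> t} \<in> sets ?G" "{w \<in> space ?G. (f w + w j)\<^sup>2 \<le> C w} \<in> sets ?G"
      by measurable
  qed
  have "C (w(j := x)) = C w" for w x
    unfolding C_def using q by (intro arg_cong2[where f="(-)"] arg_cong2[where f="(*)"] refl sum.cong) auto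
  then show ?thesis
    unfolding eq[OF b] eq[OF borel_measurable_const] using q by (intro anti_concentration b C d) auto
qed

lemma scalar_prod_self_split:
  assumes "v \<in> carrier_vec n" "q \<le> n"
  shows "v \<bullet> (v :: real vec) = (\<Sum>i\<in>{0..<q}. (v $ i)\<^sup>2) + (\<Sum>i\<in>{q..<n}. (v $ i)\<^sup>2)"
  using assms by (simp add: scalar_prod_def power2_eq_square sum.atLeastLessThan_concat)

text \<open>The vector of numerator shifts is rotated into the single shift \<open>sqrt lam\<close>
  of the first coordinate. Putting \<open>j\<close> idle coordinates in front places the reference
  law on the same space as the rotated statistic.\<close>

lemma measure_noncentral_F:
  assumes L: "noncentral_F q m lam L" and n: "j + q + m = n" and q: "q > 0"
  shows "measure L {..t} = measure (std_normal_vec n) {w \<in> space (std_normal_vec n). shifted_F j q n (sqrt lam) w \<le> t}"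
proof -
  obtain a where a: "(\<Sum>i<q. (a i)\<^sup>2) = lam" and La: "L = distr (std_normal_vec (q + m)) borel
              (\<lambda>z. ((\<Sum>i<q. (z i + a i)\<^sup>2) / real q) / ((\<Sum>j<m. (z (q + j))\<^sup>2) / real m))"
    using L by (auto simp: noncentral_F_def)
  define N where "N = q + m"
  define v where "v = vec N (\<lambda>i. if i < q then a i else 0)"
  have v: "v \<in> carrier_vec N" by (simp add: v_def)
  have ins: "insert 0 {Suc 0..<q} = {0..<q}" using q by auto
  obtain H where H: "gaussian_isometry N H"
    "\<And>x i. x \<in> carrier_vec N \<Longrightarrow> i < N \<Longrightarrow> i \<ge> q \<Longrightarrow> (H *\<^sub>v x) $ i = x $ i"
    "\<And>i. i \<in> {Suc 0..<q} \<Longrightarrow> (H *\<^sub>v v) $ i = 0" "(H *\<^sub>v v) $ 0 \<ge> 0"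
  proof -
    have "{Suc 0..<q} \<subseteq> {..<N}" by (auto simp: N_def)
    then show ?thesis
      using that gaussian_isometry_eliminate[of "{Suc 0..<q}" N 0 v] q v unfolding ins by (auto simp: N_def)
  qed
  have cH: "H \<in> carrier_mat N N" using H by auto
  have qN: "q \<le> N" by (simp add: N_def)
  have head: "(\<Sum>i\<in>{0..<q}. ((H *\<^sub>v x) $ i)\<^sup>2) = (\<Sum>i\<in>{0..<q}. (x $ i)\<^sup>2)" if x: "x \<in> carrier_vec N" for x
  proof -
    have Hx: "H *\<^sub>v x \<in> carrier_vec N" using cH x by simp
    show ?thesis
      using gaussian_isometry_inner[OF H(1) x x] H(2)[OF x]
      unfolding scalar_prod_self_split[OF x qN] scalar_prod_self_split[OF Hx qN] by simp
  qed
  have "((H *\<^sub>v v) $ 0)\<^sup>2 = (\<Sum>i\<in>{0}. ((H *\<^sub>v v) $ i)\<^sup>2)" by simp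
  also have "\<dots> = (\<Sum>i\<in>{0..<q}. ((H *\<^sub>v v) $ i)\<^sup>2)"
    by (rule sum.mono_neutral_left) (use q H(3) in auto)
  also have "\<dots> = lam"
    unfolding head[OF v] a[symmetric] lessThan_atLeast0 by (rule sum.cong) (auto simp: v_def N_def)
  finally have H0: "(H *\<^sub>v v) $ 0 = sqrt lam" using H(4) by (metis real_sqrt_abs abs_of_nonneg)
  define stat where "stat = shifted_F 0 q N (sqrt lam)"
  have stat_eq: "((\<Sum>i<q. (z i + a i)\<^sup>2) / real q) / ((\<Sum>j<m. (z (q + j))\<^sup>2) / real m) = stat (act N H z)" for z
  proof -
    define y where "y = vec N z + v"
    have y: "y \<in> carrier_vec N" using v by (simp add: y_def)
    have Hy: "(H *\<^sub>v y) $ i = act N H z i + (H *\<^sub>v v) $ i" if "i < N" for i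
      using that cH v by (simp add: y_def act_def mult_mat_vec_add_dim)
    have "(\<Sum>i<q. (z i + a i)\<^sup>2) = (\<Sum>i\<in>{0..<q}. (y $ i)\<^sup>2)"
      unfolding lessThan_atLeast0 by (rule sum.cong) (auto simp: y_def v_def N_def)
    also have "\<dots> = (\<Sum>i\<in>insert 0 {Suc 0..<q}. ((H *\<^sub>v y) $ i)\<^sup>2)"
      unfolding ins by (rule head[OF y, symmetric])
    also have "\<dots> = ((H *\<^sub>v y) $ 0)\<^sup>2 + (\<Sum>i\<in>{Suc 0..<q}. ((H *\<^sub>v y) $ i)\<^sup>2)"
      by simp
    also have "(\<Sum>i\<in>{Suc 0..<q}. ((H *\<^sub>v y) $ i)\<^sup>2) = (\<Sum>i\<in>{Suc 0..<q}. (act N H z i)\<^sup>2)"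
      by (rule sum.cong) (auto simp: Hy H(3) N_def)
    also have "(H *\<^sub>v y) $ 0 = sqrt lam + act N H z 0" using q by (subst Hy) (auto simp: H0 N_def)
    finally have num: "(\<Sum>i<q. (z i + a i)\<^sup>2) = (sqrt lam + act N H z 0)\<^sup>2 + (\<Sum>i\<in>{Suc 0..<q}. (act N H z i)\<^sup>2)" .
    have "(\<Sum>j<m. (z (q + j))\<^sup>2) = (\<Sum>i\<in>{q..<N}. (z i)\<^sup>2)"
      unfolding lessThan_atLeast0 N_def
      using sum.shift_bounds_nat_ivl[of "\<lambda>i. (z i)\<^sup>2" 0 q m] by (simp add: add.commute)
    also have "\<dots> = (\<Sum>i\<in>{q..<N}. (act N H z i)\<^sup>2)"
      by (rule sum.cong) (auto simp: act_def H(2))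
    finally have den: "(\<Sum>j<m. (z (q + j))\<^sup>2) = (\<Sum>i\<in>{q..<N}. (act N H z i)\<^sup>2)" .
    show ?thesis unfolding num den stat_def shifted_F_def by (simp add: N_def)
  qed
  have mstat[measurable]: "stat \<in> borel_measurable (borel_vec N)"
    unfolding stat_def by (rule measurable_shifted_F) (use q in \<open>auto simp: N_def\<close>)
  have mH: "act N H \<in> measurable (std_normal_vec N) (borel_vec N)"
    by (rule measurable_gaussian_isometry(1)[OF H(1)])
  let ?r = "\<lambda>w. \<lambda>i\<in>{..<N}. w (j + i)"
  have r: "distr (std_normal_vec n) (std_normal_vec N) ?r = std_normal_vec N"
    by (rule distr_PiM_reindex) (use n in \<open>auto simp: prob_space_std_normal_distribution N_def inj_on_def\<close>)
  have mr: "?r \<in> measurable (std_normal_vec n) (std_normal_vec N)"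
    by (intro measurable_restrict measurable_component_singleton) (use n in \<open>auto simp: N_def\<close>)
  have fin_eq: "stat (?r w) = shifted_F j q n (sqrt lam) w" for w
  proof -
    have 1: "(\<Sum>i\<in>{Suc 0..<q}. (?r w i)\<^sup>2) = (\<Sum>i\<in>{Suc j..<j + q}. (w i)\<^sup>2)"
    proof -
      have "(\<Sum>i\<in>{Suc 0..<q}. (?r w i)\<^sup>2) = (\<Sum>i\<in>{Suc 0..<q}. (w (i + j))\<^sup>2)"
        by (rule sum.cong) (auto simp: N_def add.commute)
      also have "\<dots> = (\<Sum>i\<in>{Suc 0 + j..<q + j}. (w i)\<^sup>2)"
        by (rule sum.shift_bounds_nat_ivl[symmetric])
      finally show ?thesis by (simp add: add.commute)
    qed
    have 2: "(\<Sum>i\<in>{q..<N}. (?r w i)\<^sup>2) = (\<Sum>i\<in>{j + q..<n}. (w i)\<^sup>2)"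
    proof -
      have "(\<Sum>i\<in>{q..<N}. (?r w i)\<^sup>2) = (\<Sum>i\<in>{q..<N}. (w (i + j))\<^sup>2)"
        by (rule sum.cong) (auto simp: N_def add.commute)
      also have "\<dots> = (\<Sum>i\<in>{q + j..<N + j}. (w i)\<^sup>2)"
        by (rule sum.shift_bounds_nat_ivl[symmetric])
      finally show ?thesis using n by (simp add: N_def ac_simps)
    qed
    have 3: "?r w 0 = w j" "N - q = n - (j + q)" using q n by (auto simp: N_def)
    show ?thesis unfolding stat_def shifted_F_def add_0 1 2 3 ..
  qed
  have "measure L {..t} = measure (std_normal_vec N) ((\<lambda>z. stat (act N H z)) -` {..t} \<inter> space (std_normal_vec N))"
    unfolding La stat_eq N_def[symmetric]
    by (rule measure_distr) (use measurable_compose[OF mH mstat] in auto)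
  also have "\<dots> = measure (distr (std_normal_vec N) (borel_vec N) (act N H)) (stat -` {..t} \<inter> space (borel_vec N))"
    using measurable_space[OF mH] by (subst measure_distr[OF mH]) (auto intro!: arg_cong[where f="measure _"])
  also have "\<dots> = measure (std_normal_vec N) (stat -` {..t} \<inter> space (borel_vec N))"
    using H(1) by (simp add: gaussian_isometry_def)
  also have "\<dots> = measure (distr (std_normal_vec n) (std_normal_vec N) ?r) (stat -` {..t} \<inter> space (std_normal_vec N))"
    unfolding r by (simp add: space_std_normal_vec)
  also have "\<dots> = measure (std_normal_vec n) {w \<in> space (std_normal_vec n). stat (?r w) \<le> t}"
    using measurable_space[OF mr]
    by (subst measure_distr[OF mr]) (auto intro!: arg_cong[where f="measure _"] measurable_sets[OF mstat] 
      simp: measurable_cong_sets[OF sets_std_normal_PiM refl])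
  finally show ?thesis unfolding fin_eq .
qed

subsection \<open>The statistic for Gaussian designs and fixed errors\<close>

text \<open>Testing the last coordinates fits upper triangular factors: for such a \<open>T\<close>,
  \<open>selector * T = T22 * selector\<close> with \<open>T22\<close> the lower right
  block.\<close>

definition selector :: "nat \<Rightarrow> nat \<Rightarrow> real mat" where
  "selector q k = mat q k (\<lambda>(a, i). if i = k - q + a then 1 else 0)"

lemma selector_carrier [simp]: "selector q k \<in> carrier_mat q k"
  by (simp add: selector_def)

lemma selector_mult_vec:
  assumes "q \<le> k" "v \<in> carrier_vec k"
  shows "selector q k *\<^sub>v v = vec q (\<lambda>a. v $ (k - q + a))"
proof (rule eq_vecI)
  fix a assume "a < dim_vec (vec q (\<lambda>a. v $ (k - q + a)))"
  then have a: "a < q" by simp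
  have "(selector q k *\<^sub>v v) $ a = (\<Sum>i\<in>{0..<k}. (if i = k - q + a then 1 else 0) * v $ i)"
    using a assms by (simp add: selector_def scalar_prod_def index_mult_mat_vec)
  also have "\<dots> = (\<Sum>i\<in>{k - q + a}. (if i = k - q + a then 1 else 0) * v $ i)"
    by (rule sum.mono_neutral_right) (use a assms in auto)
  finally show "(selector q k *\<^sub>v v) $ a = vec q (\<lambda>a. v $ (k - q + a)) $ a" using a by simp
qed (simp add: selector_def)

lemma selector_transpose_mult_vec:
  assumes "q \<le> k" "v \<in> carrier_vec q"
  shows "(selector q k)\<^sup>T *\<^sub>v v = vec k (\<lambda>i. if i < k - q then 0 else v $ (i - (k - q)))"
proof (rule eq_vecI)
  fix i assume "i < dim_vec (vec k (\<lambda>i. if i < k - q then 0 else v $ (i - (k - q))))"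
  then have i: "i < k" by simp
  have "((selector q k)\<^sup>T *\<^sub>v v) $ i = (\<Sum>a\<in>{0..<q}. (if i = k - q + a then 1 else 0) * v $ a)"
    using i assms by (simp add: selector_def scalar_prod_def index_mult_mat_vec)
  also have "\<dots> = (if i < k - q then 0 else v $ (i - (k - q)))"
  proof (cases "i < k - q")
    case True
    then show ?thesis by (auto intro!: sum.neutral)
  next
    case False
    have "(\<Sum>a\<in>{0..<q}. (if i = k - q + a then 1 else 0) * v $ a) = (\<Sum>a\<in>{i - (k - q)}. (if i = k - q + a then 1 else 0) * v $ a)"
      by (rule sum.mono_neutral_right) (use i False assms in auto)
    then show ?thesis using False by simp
  qed
  finally show "((selector q k)\<^sup>T *\<^sub>v v) $ i = vec k (\<lambda>i. if i < k - q then 0 else v $ (i - (k - q))) $ i" using i by simp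
qed (simp add: selector_def)

lemma selector_orthonormal:
  assumes "q \<le> k" shows "selector q k * (selector q k)\<^sup>T = 1\<^sub>m q"
proof (rule mat_eqI_mult_vec)
  fix v :: "real vec" assume v: "v \<in> carrier_vec q"
  have "selector q k * (selector q k)\<^sup>T *\<^sub>v v = selector q k *\<^sub>v ((selector q k)\<^sup>T *\<^sub>v v)"
    by (rule assoc_mult_mat_vec[of _ q k _ q]) (use v in auto)
  also have "\<dots> = v"
    unfolding selector_transpose_mult_vec[OF assms v]
    using assms v by (subst selector_mult_vec) (auto intro!: eq_vecI)
  finally show "selector q k * (selector q k)\<^sup>T *\<^sub>v v = 1\<^sub>m q *\<^sub>v v" using v by simp
qed (auto intro!: mult_carrier_mat[of _ q k])

definition design :: "nat \<Rightarrow> nat \<Rightarrow> (nat \<Rightarrow> nat \<Rightarrow> real) \<Rightarrow> real mat" where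
  "design n k W = mat n k (\<lambda>(i, a). design_col n W a $ i)"

lemma design_carrier [simp]: "design n k W \<in> carrier_mat n k"
  by (simp add: design_def)

section \<open>Centering and resampling of the error vector, and scale invariance\<close>

definition sample_mean :: "nat \<Rightarrow> (nat \<Rightarrow> real) \<Rightarrow> real" where
  "sample_mean n e = (\<Sum>i<n. e i) / real n"

definition centered_norm :: "nat \<Rightarrow> (nat \<Rightarrow> real) \<Rightarrow> real" where
  "centered_norm n e = sqrt (\<Sum>i<n. (e i - sample_mean n e)\<^sup>2)"

lemma centered_norm_nonneg: "centered_norm n e \<ge> 0"
  by (simp add: centered_norm_def sum_nonneg)

lemma centered_norm_power2: 
  assumes "n > 0" shows "(centered_norm n e)\<^sup>2 = (\<Sum>i<n. (e i)\<^sup>2) - real n * (sample_mean n e)\<^sup>2"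
proof -
  have "(centered_norm n e)\<^sup>2 = (\<Sum>i<n. (e i - sample_mean n e)\<^sup>2)" by (simp add: centered_norm_def sum_nonneg)
  also have "\<dots> = (\<Sum>i<n. (e i)\<^sup>2) - 2 * sample_mean n e * (\<Sum>i<n. e i) + real n * (sample_mean n e)\<^sup>2"
    by (simp add: power2_diff sum.distrib sum_subtractf sum_distrib_left algebra_simps)
  also have "(\<Sum>i<n. e i) = real n * sample_mean n e" using assms by (simp add: sample_mean_def)
  finally show ?thesis by (simp add: power2_eq_square algebra_simps)
qed

lemma measurable_centered_norm: "centered_norm n \<in> borel_measurable (borel_vec n)"
proof -
  note c = measurable_coordinate
  have m: "sample_mean n \<in> borel_measurable (borel_vec n)"
    unfolding sample_mean_def using c by (intro borel_measurable_divide borel_measurable_sum) auto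
  have "(\<lambda>e. sqrt (\<Sum>i<n. (e i - sample_mean n e)\<^sup>2)) \<in> borel_measurable (borel_vec n)"
    using c m by (intro measurable_compose[OF _ borel_measurable_sqrt] borel_measurable_sum borel_measurable_power borel_measurable_diff) auto
  then show ?thesis by (simp add: centered_norm_def[abs_def])
qed

lemma measurable_sample_mean: "sample_mean n \<in> borel_measurable (borel_vec n)"
proof -
  note c = measurable_coordinate
  show ?thesis
    unfolding sample_mean_def[abs_def] using c by (intro borel_measurable_divide borel_measurable_sum) auto
qed

text \<open>The rotated vector of ones has length \<open>sqrt n\<close> and a single nonnegative
  entry, which determines that entry. Inner products with it read off the mean, and Pythagoras gives
  the remaining length.\<close>

lemma isometry_of_ones:
  assumes Q: "gaussian_isometry n Q" and n: "n > 0"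
    and z: "\<And>i. i < n \<Longrightarrow> 0 < i \<Longrightarrow> (Q *\<^sub>v vec n (\<lambda>_. 1)) $ i = 0"
    and pos: "(Q *\<^sub>v vec n (\<lambda>_. 1)) $ 0 \<ge> 0"
  shows "(Q *\<^sub>v vec n (\<lambda>_. 1)) $ 0 = sqrt n"
    and "(Q *\<^sub>v vec n e) $ 0 = sqrt n * sample_mean n e"
    and "(\<Sum>i\<in>{1..<n}. ((Q *\<^sub>v vec n e) $ i)\<^sup>2) = (centered_norm n e)\<^sup>2"
proof -
  let ?o = "vec n (\<lambda>_. 1) :: real vec"
  have cQ: "Q \<in> carrier_mat n n" using Q by auto
  have ip: "x \<bullet> (Q *\<^sub>v ?o) = x $ 0 * (Q *\<^sub>v ?o) $ 0" if "x \<in> carrier_vec n" for x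
  proof -
    have "x \<bullet> (Q *\<^sub>v ?o) = (\<Sum>i\<in>{0..<n}. x $ i * (Q *\<^sub>v ?o) $ i)"
      using cQ by (simp add: scalar_prod_def)
    also have "\<dots> = (\<Sum>i\<in>{0}. x $ i * (Q *\<^sub>v ?o) $ i)"
      by (rule sum.mono_neutral_right) (use n z in auto)
    finally show ?thesis by simp
  qed
  have "?o \<bullet> ?o = real n" by (simp add: scalar_prod_def)
  then have "((Q *\<^sub>v ?o) $ 0)\<^sup>2 = real n"
    using gaussian_isometry_inner[OF Q, of ?o ?o] ip[of "Q *\<^sub>v ?o"] cQ by (simp add: power2_eq_square)
  then show 1: "(Q *\<^sub>v ?o) $ 0 = sqrt n" using pos by (metis real_sqrt_abs abs_of_nonneg)
  have "vec n e \<bullet> ?o = real n * sample_mean n e" using n by (simp add: scalar_prod_def sample_mean_def lessThan_atLeast0)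
  then have "(Q *\<^sub>v vec n e) $ 0 * sqrt n = sqrt n * sqrt n * sample_mean n e"
    using gaussian_isometry_inner[OF Q, of "vec n e" ?o] ip[of "Q *\<^sub>v vec n e"] cQ 1 by simp
  also have "\<dots> = (sqrt n * sample_mean n e) * sqrt n" by (simp only: ac_simps)
  finally show 2: "(Q *\<^sub>v vec n e) $ 0 = sqrt n * sample_mean n e" using n by simp
  have Qe: "Q *\<^sub>v vec n e \<in> carrier_vec n" using cQ by simp
  have "vec n e \<bullet> vec n e = (\<Sum>i<n. (e i)\<^sup>2)" by (simp add: scalar_prod_def lessThan_atLeast0 power2_eq_square)
  then have "(\<Sum>i<n. (e i)\<^sup>2) = (Q *\<^sub>v vec n e) \<bullet> (Q *\<^sub>v vec n e)"
    using gaussian_isometry_inner[OF Q, of "vec n e" "vec n e"] by simp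
  also have "\<dots> = ((Q *\<^sub>v vec n e) $ 0)\<^sup>2 + (\<Sum>i\<in>{1..<n}. ((Q *\<^sub>v vec n e) $ i)\<^sup>2)"
    using scalar_prod_self_split[OF Qe, of 1] n by simp
  finally show "(\<Sum>i\<in>{1..<n}. ((Q *\<^sub>v vec n e) $ i)\<^sup>2) = (centered_norm n e)\<^sup>2"
    unfolding centered_norm_power2[OF n] 2 by (simp add: power_mult_distrib)
qed

text \<open>Triangularizing the vector of ones together with \<open>e\<close>; the lengths and the
  nonnegative pivots determine all entries.\<close>

lemma centering_isometry:
  assumes n: "1 < n"
  obtains Q where "gaussian_isometry n Q"
    "Q *\<^sub>v vec n (\<lambda>_. 1) = vec n (\<lambda>i. if i = 0 then sqrt n else 0)"
    "Q *\<^sub>v vec n e = vec n (\<lambda>i. if i = 0 then sqrt n * sample_mean n e else if i = 1 then centered_norm n e else 0)"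
proof -
  define u where "u = (\<lambda>a::nat. vec n (if a = 0 then (\<lambda>_. 1) else e))"
  obtain Q where Q: "gaussian_isometry n Q"
    "\<And>a i. a < 2 \<Longrightarrow> i < n \<Longrightarrow> a < i \<Longrightarrow> (Q *\<^sub>v u a) $ i = 0" "\<And>a. a < 2 \<Longrightarrow> (Q *\<^sub>v u a) $ a \<ge> 0"
    using gaussian_isometry_triangularize[of 2 u n id] n by (auto simp: u_def)
  have cQ: "Q \<in> carrier_mat n n" using Q by auto
  have z: "(Q *\<^sub>v vec n (\<lambda>_. 1)) $ i = 0" if "i < n" "0 < i" for i using Q(2)[of 0 i] that by (simp add: u_def)
  have pos: "(Q *\<^sub>v vec n (\<lambda>_. 1)) $ 0 \<ge> 0" using Q(3)[of 0] by (simp add: u_def)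
  have ze: "(Q *\<^sub>v vec n e) $ i = 0" if "i < n" "1 < i" for i using Q(2)[of 1 i] that by (simp add: u_def)
  have pe: "(Q *\<^sub>v vec n e) $ 1 \<ge> 0" using Q(3)[of 1] by (simp add: u_def)
  note o = isometry_of_ones[OF Q(1) _ z pos]
  have "(\<Sum>i\<in>{1..<n}. ((Q *\<^sub>v vec n e) $ i)\<^sup>2) = (\<Sum>i\<in>{1}. ((Q *\<^sub>v vec n e) $ i)\<^sup>2)"
    by (rule sum.mono_neutral_right) (use n ze in auto)
  then have "((Q *\<^sub>v vec n e) $ 1)\<^sup>2 = (centered_norm n e)\<^sup>2" using o(3)[of e] n by simp
  then have e1: "(Q *\<^sub>v vec n e) $ 1 = centered_norm n e" using pe centered_norm_nonneg by (simp add: power2_eq_iff_nonneg)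
  show ?thesis
  proof (rule that[OF Q(1)])
    show "Q *\<^sub>v vec n (\<lambda>_. 1) = vec n (\<lambda>i. if i = 0 then sqrt n else 0)"
      using cQ o(1) z n by (intro eq_vecI) auto
    show "Q *\<^sub>v vec n e = vec n (\<lambda>i. if i = 0 then sqrt n * sample_mean n e else if i = 1 then centered_norm n e else 0)"
      using cQ o(2)[of e] ze e1 n by (intro eq_vecI) auto
  qed
qed

text \<open>
  Some orthogonal map that fixes the constant vectors takes \<open>e\<close> to \<open>resample n e g\<close>. If all \<open>g i\<close> are
  equal, the quotient is \<open>0\<close> and the result is constant.
\<close>

definition resample :: "nat \<Rightarrow> (nat \<Rightarrow> real) \<Rightarrow> (nat \<Rightarrow> real) \<Rightarrow> nat \<Rightarrow> real" where
  "resample n e g = (\<lambda>i\<in>{..<n}. sample_mean n e + centered_norm n e / centered_norm n g * (g i - sample_mean n g))"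

lemma vec_resample:
  "vec n (resample n e g) = (sample_mean n e - centered_norm n e / centered_norm n g * sample_mean n g) \<cdot>\<^sub>v vec n (\<lambda>_. 1) + (centered_norm n e / centered_norm n g) \<cdot>\<^sub>v vec n g"
  by (intro eq_vecI) (auto simp: resample_def right_diff_distrib)

lemma mult_vec_resample:
  assumes "Q \<in> carrier_mat n n"
  shows "Q *\<^sub>v vec n (resample n e g) = (sample_mean n e - centered_norm n e / centered_norm n g * sample_mean n g) \<cdot>\<^sub>v (Q *\<^sub>v vec n (\<lambda>_. 1)) + (centered_norm n e / centered_norm n g) \<cdot>\<^sub>v (Q *\<^sub>v vec n g)"
  unfolding vec_resample using assms by (simp add: mult_mat_vec_add_dim mult_mat_vec)

text \<open>\<open>e\<close> under \<open>Q1\<close> and \<open>resample n e g\<close> under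
  \<open>Q2\<close> have the same normal form, so \<open>Q2\<^sup>T * Q1\<close> takes one to the
  other. Both maps send the vector of ones to the same place.\<close>

lemma resampling_isometry:
  assumes n: "1 < n" and g: "centered_norm n g \<noteq> 0"
  obtains Q where "gaussian_isometry n Q" "Q *\<^sub>v vec n (\<lambda>_. 1) = vec n (\<lambda>_. 1)"
    "Q *\<^sub>v vec n e = vec n (resample n e g)"
proof -
  obtain Q1 where Q1: "gaussian_isometry n Q1"
    "Q1 *\<^sub>v vec n (\<lambda>_. 1) = vec n (\<lambda>i. if i = 0 then sqrt n else 0)"
    "Q1 *\<^sub>v vec n e = vec n (\<lambda>i. if i = 0 then sqrt n * sample_mean n e else if i = 1 then centered_norm n e else 0)"
    using centering_isometry[OF n] by blast
  obtain Q2 where Q2: "gaussian_isometry n Q2"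
    "Q2 *\<^sub>v vec n (\<lambda>_. 1) = vec n (\<lambda>i. if i = 0 then sqrt n else 0)"
    "Q2 *\<^sub>v vec n g = vec n (\<lambda>i. if i = 0 then sqrt n * sample_mean n g else if i = 1 then centered_norm n g else 0)"
    using centering_isometry[OF n] by blast
  have c: "Q1 \<in> carrier_mat n n" "Q2 \<in> carrier_mat n n" using Q1 Q2 by auto
  have eq: "Q1 *\<^sub>v vec n e = Q2 *\<^sub>v vec n (resample n e g)"
    unfolding mult_vec_resample[OF c(2)] Q1 Q2
    by (intro eq_vecI) (use g in \<open>auto simp: algebra_simps\<close>)
  have m: "Q2\<^sup>T * Q1 *\<^sub>v v = Q2\<^sup>T *\<^sub>v (Q1 *\<^sub>v v)" if "v \<in> carrier_vec n" for v
    using that c by (simp add: mat_dim_simps)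
  have inv: "Q2\<^sup>T *\<^sub>v (Q2 *\<^sub>v v) = v" if "v \<in> carrier_vec n" for v
    by (rule mult_mat_vec_cancel[OF gaussian_isometry_inverse(1)[OF Q2(1)]]) (use that c in auto)
  show ?thesis
  proof (rule that[of "Q2\<^sup>T * Q1"])
    show "gaussian_isometry n (Q2\<^sup>T * Q1)"
      by (intro gaussian_isometry_mult gaussian_isometry_transpose Q1 Q2)
    show "Q2\<^sup>T * Q1 *\<^sub>v vec n (\<lambda>_. 1) = vec n (\<lambda>_. 1)"
      by (simp only: m[OF vec_carrier] Q1(2) Q2(2)[symmetric] inv[OF vec_carrier])
    show "Q2\<^sup>T * Q1 *\<^sub>v vec n e = vec n (resample n e g)"
      by (simp only: m[OF vec_carrier] eq inv[OF vec_carrier])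
  qed
qed

text \<open>Numerator and denominator are homogeneous of the same degree. Coordinate 0, which holds
  the mean of the errors, is exempt because \<open>0 < j\<close>.\<close>

lemma shifted_F_scale:
  assumes "\<tau> \<noteq> 0"
    and "\<And>i. i < n \<Longrightarrow> 0 < i \<Longrightarrow> v i = \<tau> * w i" and j: "0 < j" "j < n" "j + q \<le> n"
  shows "shifted_F j q n (\<tau> * c) v = shifted_F j q n c w"
proof -
  have 1: "(\<Sum>i\<in>{Suc j..<j + q}. (v i)\<^sup>2) = \<tau>\<^sup>2 * (\<Sum>i\<in>{Suc j..<j + q}. (w i)\<^sup>2)"
    "(\<Sum>i\<in>{j + q..<n}. (v i)\<^sup>2) = \<tau>\<^sup>2 * (\<Sum>i\<in>{j + q..<n}. (w i)\<^sup>2)"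
    unfolding sum_distrib_left using assms by (auto intro!: sum.cong simp: power_mult_distrib)
  have 2: "(\<tau> * c + v j)\<^sup>2 = \<tau>\<^sup>2 * (c + w j)\<^sup>2"
    using assms(2)[of j] j by (simp add: power2_eq_square algebra_simps)
  have 3: "x / y = (\<tau>\<^sup>2 * x) / (\<tau>\<^sup>2 * y)" for x y :: real using assms(1) by simp
  show ?thesis
    unfolding shifted_F_def 1 2 using assms(1) by (simp flip: distrib_left)
qed

text \<open>Division by zero reproduces the default value of \<open>F_statistic\<close> for a
  vanishing residual.\<close>

lemma shifted_F_zero: "(\<Sum>i\<in>{j + q..<n}. (w i)\<^sup>2) = 0 \<Longrightarrow> shifted_F j q n c w = 0"
  by (simp add: shifted_F_def)

lemma (in prob_space) abs_expectation_diff_le: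
  fixes h :: "'a \<Rightarrow> real"
  assumes [measurable]: "h \<in> borel_measurable M" "S \<in> events"
    and h: "\<And>x. x \<in> space M \<Longrightarrow> 0 \<le> h x \<and> h x \<le> 1" and l: "0 \<le> l" "l \<le> 1" and eta: "\<eta> \<ge> 0"
    and le: "AE x in M. x \<notin> S \<longrightarrow> \<bar>h x - l\<bar> \<le> \<eta>"
  shows "\<bar>expectation h - l\<bar> \<le> \<eta> + prob S"
proof -
  have ih: "integrable M h"
    by (rule integrable_const_bound[where B=1]) (use h in auto)
  have iS: "integrable M (\<lambda>x. \<eta> + indicator S x :: real)"
    by (intro Bochner_Integration.integrable_add integrable_const integrable_real_indicator) (auto simp: less_top[symmetric])
  have "\<bar>expectation h - l\<bar> = \<bar>expectation (\<lambda>x. h x - l)\<bar>" using ih by (simp add: prob_space)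
  also have "\<dots> \<le> expectation (\<lambda>x. \<bar>h x - l\<bar>)" by (rule integral_abs_bound)
  also have "\<dots> \<le> expectation (\<lambda>x. \<eta> + indicator S x :: real)"
  proof (rule integral_mono_AE)
    show "AE x in M. \<bar>h x - l\<bar> \<le> \<eta> + indicator S x"
      using le AE_space
    proof eventually_elim
      case (elim x)
      have "\<bar>h x - l\<bar> \<le> 1" using h[OF elim(2)] l by auto
      then show ?case using elim eta by (auto simp: indicator_def)
    qed
  qed (use ih iS in auto)
  also have "\<dots> = \<eta> + prob S"
    by (subst Bochner_Integration.integral_add) (auto simp: prob_space less_top[symmetric] intro!: integrable_real_indicator)
  finally show ?thesis .
qed

text \<open>Squaring turns the quotient of the two shifts into \<open>x * y / z\<close> with three
  factors within \<open>\<tau>\<close> of 1. By \<open>y \<le> 3 / 2\<close> the difference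
  \<open>x * y - z\<close> is at most \<open>7 / 2 * \<tau>\<close> in absolute value, and
  \<open>z \<ge> 1 / 2\<close> doubles this to the constant 7. The root of a nonnegative number is
  at least as close to 1 as the number itself.\<close>

lemma scale_perturbation:
  fixes \<rho> D s \<sigma> \<Delta> N n1 \<tau> \<delta> :: real
  assumes pos: "\<rho> \<ge> 0" "N > 0" "n1 > 0" "\<sigma> > 0" "s > 0" "\<Delta> \<ge> 0" "D \<ge> 0"
    and close: "\<bar>\<rho>\<^sup>2 / N - 1\<bar> \<le> \<tau>" "\<bar>D / n1 - 1\<bar> \<le> \<tau>" "\<bar>s\<^sup>2 / (n1 * \<sigma>\<^sup>2) - 1\<bar> \<le> \<tau>"
    and t: "\<tau> \<le> 1 / 2" "7 * \<tau> * sqrt (\<Delta> * N) \<le> \<delta>"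
  shows "\<bar>\<rho> * (\<sigma> * sqrt \<Delta>) * sqrt D / s - sqrt (\<Delta> * N)\<bar> \<le> \<delta>"
proof -
  define x y z where "x = \<rho>\<^sup>2 / N" and "y = D / n1" and "z = s\<^sup>2 / (n1 * \<sigma>\<^sup>2)"
  have z: "z \<ge> 1 / 2" using close(3) t unfolding z_def[symmetric] by linarith
  have xy: "x \<ge> 0" "y \<ge> 0" using pos by (simp_all add: x_def y_def)
  define u where "u = x * y / z"
  have u: "u \<ge> 0" using xy z by (simp add: u_def)
  have "\<rho> * (\<sigma> * sqrt \<Delta>) * sqrt D / s = sqrt (\<rho>\<^sup>2 * (\<sigma>\<^sup>2 * \<Delta>) * D / s\<^sup>2)"
    using pos by (simp add: real_sqrt_mult real_sqrt_divide)
  also have "\<rho>\<^sup>2 * (\<sigma>\<^sup>2 * \<Delta>) * D / s\<^sup>2 = (\<Delta> * N) * u"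
    using pos by (simp add: u_def x_def y_def z_def field_simps)
  also have "sqrt ((\<Delta> * N) * u) = sqrt (\<Delta> * N) * sqrt u" by (simp add: real_sqrt_mult)
  finally have e: "\<rho> * (\<sigma> * sqrt \<Delta>) * sqrt D / s - sqrt (\<Delta> * N) = sqrt (\<Delta> * N) * (sqrt u - 1)"
    by (simp add: algebra_simps)
  have "\<bar>sqrt u - 1\<bar> * 1 \<le> \<bar>sqrt u - 1\<bar> * (sqrt u + 1)" using u by (intro mult_left_mono) auto
  also have "\<dots> = \<bar>(sqrt u - 1) * (sqrt u + 1)\<bar>" using u by (simp add: abs_mult)
  also have "(sqrt u - 1) * (sqrt u + 1) = u - 1" using u by (simp add: algebra_simps)
  finally have su: "\<bar>sqrt u - 1\<bar> \<le> \<bar>u - 1\<bar>" by simp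
  have "\<bar>u - 1\<bar> = \<bar>x * y - z\<bar> / z" using z by (simp add: u_def field_simps abs_divide)
  also have "\<dots> \<le> \<bar>x * y - z\<bar> / (1 / 2)" using z by (intro divide_left_mono) auto
  also have "\<bar>x * y - z\<bar> \<le> (7 / 2) * \<tau>"
  proof -
    have "x * y - z = (x - 1) * y + (y - 1) - (z - 1)" by (simp add: algebra_simps)
    moreover have "\<bar>(x - 1) * y\<bar> \<le> \<tau> * (3 / 2)"
      unfolding abs_mult using close t xy by (intro mult_mono) (auto simp: x_def[symmetric] y_def[symmetric])
    ultimately show ?thesis using close unfolding x_def[symmetric] y_def[symmetric] z_def[symmetric] by linarith
  qed
  finally have "\<bar>u - 1\<bar> \<le> 7 * \<tau>" by simp
  then have "\<bar>sqrt u - 1\<bar> \<le> 7 * \<tau>" using su by simp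
  then have "sqrt (\<Delta> * N) * \<bar>sqrt u - 1\<bar> \<le> sqrt (\<Delta> * N) * (7 * \<tau>)"
    using pos by (intro mult_left_mono) auto
  then show ?thesis unfolding e using t pos by (simp add: abs_mult mult.commute)
qed

text \<open>The testing problem in normal form: \<open>TA\<close> leads from the standardized
  regressors to the observed ones, \<open>K0\<close> recombines the restrictions, and
  \<open>\<theta>\<close> is going to be \<open>\<sigma> * sqrt \<Delta>\<close>.\<close>

locale tested_regression =
  fixes n p q :: nat and K0 TA R0 :: "real mat" and \<gamma> r0 :: "real vec" and \<theta> :: real
  assumes dims: "0 < q" "q \<le> p" "Suc p < n"
    and K0: "K0 \<in> carrier_mat q q" "det K0 \<noteq> 0"
    and TA: "TA \<in> carrier_mat (Suc p) (Suc p)" "det TA \<noteq> 0"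
    and vecs: "\<gamma> \<in> carrier_vec (Suc p)" "r0 \<in> carrier_vec q"
    and R0: "R0 = K0 * selector q (Suc p) * TA"
    and alternative: "R0 *\<^sub>v \<gamma> - r0 = K0 *\<^sub>v (\<theta> \<cdot>\<^sub>v unit_vec q 0)"
begin

text \<open>Index of the first tested column. It is positive by \<open>q \<le> p\<close>, so the
  column of ones is not among the tested ones.\<close>

definition j :: nat where "j = Suc p - q"

lemma j: "0 < j" "j + q = Suc p" "j \<le> p" "j < n"
  using dims by (auto simp: j_def)

definition stat :: "(nat \<Rightarrow> nat \<Rightarrow> real) \<Rightarrow> (nat \<Rightarrow> real) \<Rightarrow> real" where
  "stat W e = F_statistic (design n (Suc p) W * TA) (design n (Suc p) W * TA *\<^sub>v \<gamma> + vec n e) R0 r0"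

text \<open>Write the design as \<open>V * T1\<close> with orthonormal \<open>V\<close> and upper
  triangular \<open>T1\<close>. Moving \<open>T1\<close> past the selector brings the problem into
  the form of \<open>F_statistic_factored\<close>. The shift there is \<open>\<theta>\<close> times
  the first column of a triangular block, that is, \<open>\<theta>\<close> times the pivot of column
  \<open>j\<close> in the first place and 0 elsewhere.\<close>

lemma stat_eq_shifted_F:
  assumes Q: "gaussian_isometry n Q"
    and tri: "\<And>a i. a < Suc p \<Longrightarrow> i < n \<Longrightarrow> i > a \<Longrightarrow> (Q *\<^sub>v design_col n W a) $ i = 0"
    and gram: "gram (Suc p) (design_col n W) \<noteq> 0"
  shows "stat W e = shifted_F j q n ((Q *\<^sub>v design_col n W j) $ j * \<theta>) (act n Q e)"
proof -
  define k where "k = Suc p"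
  have kn: "k < n" "q \<le> k" "j + q = k" "k - q = j" using dims j by (auto simp: k_def)
  have cQ: "Q \<in> carrier_mat n n" using Q by auto
  note QQ = gaussian_isometry_inverse[OF Q]
  define V where "V = mat n k (\<lambda>(i, a). Q $$ (a, i))"
  define T1 where "T1 = mat k k (\<lambda>(i, a). (Q *\<^sub>v design_col n W a) $ i)"
  have V: "V \<in> carrier_mat n k" and T1: "T1 \<in> carrier_mat k k" by (auto simp: V_def T1_def)
  have VV: "V\<^sup>T * V = 1\<^sub>m k"
  proof (rule eq_matI)
    fix a b assume "a < dim_row (1\<^sub>m k :: real mat)" "b < dim_col (1\<^sub>m k :: real mat)"
    then have ab: "a < k" "b < k" by auto
    have "(V\<^sup>T * V) $$ (a, b) = (Q * Q\<^sup>T) $$ (a, b)"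
      using ab kn cQ by (simp add: V_def scalar_prod_def)
    then show "(V\<^sup>T * V) $$ (a, b) = 1\<^sub>m k $$ (a, b)" using ab kn by (simp add: QQ)
  qed (simp_all add: V_def)
  have des: "design n k W = V * T1"
  proof (rule eq_matI)
    fix i a assume "i < dim_row (V * T1)" "a < dim_col (V * T1)"
    then have ia: "i < n" "a < k" by (auto simp: V_def T1_def)
    have "design_col n W a = Q\<^sup>T *\<^sub>v (Q *\<^sub>v design_col n W a)"
      using cQ by (intro mult_mat_vec_cancel[OF QQ(1), symmetric]) (auto simp: design_col_def)
    then have "design_col n W a $ i = (Q\<^sup>T *\<^sub>v (Q *\<^sub>v design_col n W a)) $ i" by simp
    also have "\<dots> = (\<Sum>b\<in>{0..<n}. Q $$ (b, i) * (Q *\<^sub>v design_col n W a) $ b)"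
      using ia cQ by (simp add: scalar_prod_def index_mult_mat_vec)
    also have "\<dots> = (\<Sum>b\<in>{0..<k}. Q $$ (b, i) * (Q *\<^sub>v design_col n W a) $ b)"
      by (rule sum.mono_neutral_right) (use ia kn tri[of a] in \<open>auto simp: k_def\<close>)
    also have "\<dots> = (V * T1) $$ (i, a)"
      using ia kn by (simp add: V_def T1_def scalar_prod_def)
    finally show "design n k W $$ (i, a) = (V * T1) $$ (i, a)" using ia by (simp add: design_def)
  qed (auto simp: V_def T1_def design_def)
  have tri1: "T1 $$ (i, a) = 0" if "i < k" "a < i" for i a
    using that tri[of a i] kn by (simp add: T1_def k_def)
  have "gram k (design_col n W) = (\<Prod>a<k. ((Q *\<^sub>v design_col n W a) $ a)\<^sup>2)"
    by (rule gram_triangular[OF Q]) (use kn tri in \<open>auto simp: k_def\<close>)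
  then have diag: "T1 $$ (a, a) \<noteq> 0" if "a < k" for a
    using that gram[folded k_def] by (auto simp: T1_def)
  have det_ut: "det A \<noteq> 0" if "A \<in> carrier_mat m m" "upper_triangular A" "\<And>a. a < m \<Longrightarrow> A $$ (a, a) \<noteq> 0" for A :: "real mat" and m
    using that by (auto simp: det_upper_triangular[of A m] prod_list_diag_prod)
  obtain T1i where T1i: "T1i \<in> carrier_mat k k" "T1i * T1 = 1\<^sub>m k"
  proof -
    have "upper_triangular T1" using tri1 T1 by (auto simp: upper_triangular_def)
    then show ?thesis using obtain_inverse_mat[OF T1 det_ut[OF T1 _ diag]] that by blast
  qed
  define T22 where "T22 = mat q q (\<lambda>(a, b). T1 $$ (j + a, j + b))"
  have T22: "T22 \<in> carrier_mat q q" by (simp add: T22_def)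
  obtain T22i where T22i: "T22i \<in> carrier_mat q q" "T22i * T22 = 1\<^sub>m q" "T22 * T22i = 1\<^sub>m q"
  proof -
    have "upper_triangular T22" "\<And>a. a < q \<Longrightarrow> T22 $$ (a, a) \<noteq> 0"
      using tri1 diag kn by (auto simp: upper_triangular_def T22_def)
    then show ?thesis using obtain_inverse_mat[OF T22 det_ut[OF T22]] that by blast
  qed
  obtain K0i where K0i: "K0i \<in> carrier_mat q q" "K0i * K0 = 1\<^sub>m q"
    using obtain_inverse_mat[OF K0] by auto
  obtain TAi where TAi: "TAi \<in> carrier_mat k k" "TAi * TA = 1\<^sub>m k"
    using obtain_inverse_mat[OF TA] by (auto simp: k_def)
  have cTA: "TA \<in> carrier_mat k k" using TA by (simp add: k_def)
  note d = carrier_matD[OF V] carrier_matD[OF T1] carrier_matD[OF T1i(1)] carrier_matD[OF T22] carrier_matD[OF T22i(1)]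
    carrier_matD[OF K0(1)] carrier_matD[OF K0i(1)] carrier_matD[OF cTA] carrier_matD[OF TAi(1)]
    carrier_matD[OF selector_carrier[of q k]]
  \<comment> \<open>Below the diagonal \<open>T1\<close> vanishes, so the last \<open>q\<close>
    entries of \<open>T1 v\<close> involve only the last \<open>q\<close> entries of
    \<open>v\<close>. The block \<open>T22\<close> then cancels against
    \<open>K0 * T22i\<close>.\<close>
  have ST: "selector q k * T1 = T22 * selector q k"
  proof (rule mat_eqI_mult_vec)
    fix v :: "real vec" assume v: "v \<in> carrier_vec k"
    have "selector q k * T1 *\<^sub>v v = selector q k *\<^sub>v (T1 *\<^sub>v v)" using v by (simp add: mat_dim_simps d)
    also have "\<dots> = vec q (\<lambda>a. (T1 *\<^sub>v v) $ (j + a))"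
      using kn T1 v by (subst selector_mult_vec) auto
    also have "\<dots> = T22 *\<^sub>v vec q (\<lambda>a. v $ (j + a))"
    proof (rule eq_vecI)
      fix a assume "a < dim_vec (T22 *\<^sub>v vec q (\<lambda>a. v $ (j + a)))"
      then have a: "a < q" by (simp add: d)
      have "(T1 *\<^sub>v v) $ (j + a) = (\<Sum>b\<in>{0..<k}. T1 $$ (j + a, b) * v $ b)"
        using a kn v by (simp add: scalar_prod_def index_mult_mat_vec d)
      also have "\<dots> = (\<Sum>b\<in>{0 + j..<q + j}. T1 $$ (j + a, b) * v $ b)"
        by (rule sum.mono_neutral_right) (use kn a tri1 in auto)
      also have "\<dots> = (\<Sum>b\<in>{0..<q}. T1 $$ (j + a, b + j) * v $ (b + j))"
        by (rule sum.shift_bounds_nat_ivl)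
      also have "\<dots> = (T22 *\<^sub>v vec q (\<lambda>a. v $ (j + a))) $ a"
        using a by (simp add: scalar_prod_def index_mult_mat_vec T22_def add.commute)
      finally show "vec q (\<lambda>a. (T1 *\<^sub>v v) $ (j + a)) $ a = (T22 *\<^sub>v vec q (\<lambda>a. v $ (j + a))) $ a" using a by simp
    qed (simp add: d)
    also have "\<dots> = T22 * selector q k *\<^sub>v v"
      using v kn by (simp add: mat_dim_simps d selector_mult_vec)
    finally show "selector q k * T1 *\<^sub>v v = T22 * selector q k *\<^sub>v v" .
  qed (auto intro!: mult_carrier_mat[of _ q k] mult_carrier_mat[of _ q q] simp: T1 T22)
  have RK: "(K0 * T22i) * selector q k * (T1 * TA) = R0"
  proof -
    have "(K0 * T22i) * selector q k * (T1 * TA) = K0 * (T22i * (selector q k * T1 * TA))"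
      by (simp add: mat_dim_simps d)
    also have "\<dots> = R0" unfolding ST R0 k_def[symmetric]
      by (simp add: mat_dim_simps d mult_mat_cancel[OF T22i(2)])
    finally show ?thesis .
  qed
  define c where "c = T22 *\<^sub>v (\<theta> \<cdot>\<^sub>v unit_vec q 0)"
  have c: "c \<in> carrier_vec q" using T22 by (simp add: c_def)
  \<comment> \<open>The first column of the upper triangular \<open>T22\<close> has only its
    diagonal entry, so the violation stays in one coordinate.\<close>
  have c_index: "c $ a = (if a = 0 then T1 $$ (j, j) * \<theta> else 0)" if "a < q" for a
  proof -
    have "c $ a = (\<Sum>b\<in>{0..<q}. T22 $$ (a, b) * (if b = 0 then \<theta> else 0))"
      unfolding c_def using that T22 by (auto simp: scalar_prod_def index_mult_mat_vec intro!: sum.cong)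
    also have "\<dots> = (\<Sum>b\<in>{0}. T22 $$ (a, b) * (if b = 0 then \<theta> else 0))"
      by (rule sum.mono_neutral_right) (use dims in auto)
    finally show ?thesis using that tri1[of "j + a" j] dims kn by (simp add: T22_def)
  qed
  define w where "w = Q *\<^sub>v vec n e"
  have w: "w \<in> carrier_vec n" using cQ by (simp add: w_def)
  have ve: "vec n e \<in> carrier_vec n" by simp
  have Ve: "V\<^sup>T *\<^sub>v vec n e = vec k (\<lambda>b. w $ b)"
    using kn cQ by (intro eq_vecI) (auto simp: V_def w_def scalar_prod_def index_mult_mat_vec)
  have main: "stat W e = (let a = c + selector q k *\<^sub>v (V\<^sup>T *\<^sub>v vec n e); res = vec n e - V *\<^sub>v (V\<^sup>T *\<^sub>v vec n e)
     in if res \<bullet> res = 0 then 0 else (a \<bullet> a / real q) / (res \<bullet> res / real (n - k)))"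
  proof -
    have a1: "design n k W * TA = V * (T1 * TA)" unfolding des by (simp add: mat_dim_simps d)
    have T: "T1 * TA \<in> carrier_mat k k" "TAi * T1i \<in> carrier_mat k k" "(TAi * T1i) * (T1 * TA) = 1\<^sub>m k"
      using T1 cTA TAi T1i by (auto simp: mat_dim_simps d mult_mat_cancel[OF T1i(2)])
    have K: "K0 * T22i \<in> carrier_mat q q" "T22 * K0i \<in> carrier_mat q q" "(T22 * K0i) * (K0 * T22i) = 1\<^sub>m q"
      using K0 K0i T22 T22i by (auto simp: mat_dim_simps d mult_mat_cancel[OF K0i(2)])
    have ce: "(K0 * T22i * selector q k * (T1 * TA)) *\<^sub>v \<gamma> - r0 = K0 * T22i *\<^sub>v c"
      unfolding RK alternative c_def using dims
      by (simp add: mat_dim_simps d mult_mat_vec_cancel[OF T22i(2)])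
    have g: "\<gamma> \<in> carrier_vec k" using vecs by (simp add: k_def)
    show ?thesis
      unfolding stat_def k_def[symmetric] a1
      using F_statistic_factored[OF V VV T selector_carrier selector_orthonormal[OF kn(2)] K g ve c vecs(2) ce]
      unfolding RK .
  qed
  define a where "a = c + selector q k *\<^sub>v (V\<^sup>T *\<^sub>v vec n e)"
  define res where "res = vec n e - V *\<^sub>v (V\<^sup>T *\<^sub>v vec n e)"
  have a_index: "a $ i = c $ i + w $ (j + i)" if "i < q" for i
    using that kn by (simp add: a_def Ve selector_mult_vec)
  have "a \<bullet> a = (\<Sum>i\<in>{0..<q}. (a $ i)\<^sup>2)" by (simp add: scalar_prod_def power2_eq_square a_def Ve selector_mult_vec kn)
  also have "\<dots> = (a $ 0)\<^sup>2 + (\<Sum>i\<in>{Suc 0..<q}. (a $ i)\<^sup>2)"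
    using dims by (simp add: sum.atLeast_Suc_lessThan)
  also have "a $ 0 = T1 $$ (j, j) * \<theta> + w $ j" using dims by (simp add: a_index c_index)
  also have "(\<Sum>i\<in>{Suc 0..<q}. (a $ i)\<^sup>2) = (\<Sum>i\<in>{Suc 0..<q}. (w $ (i + j))\<^sup>2)"
    by (rule sum.cong) (auto simp: a_index c_index add.commute)
  also have "\<dots> = (\<Sum>i\<in>{Suc 0 + j..<q + j}. (w $ i)\<^sup>2)" by (rule sum.shift_bounds_nat_ivl[symmetric])
  finally have aa: "a \<bullet> a = (T1 $$ (j, j) * \<theta> + w $ j)\<^sup>2 + (\<Sum>i\<in>{Suc j..<j + q}. (w $ i)\<^sup>2)"
    by (simp add: add.commute)
  have res: "res \<in> carrier_vec n" using V by (simp add: res_def)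
  \<comment> \<open>In the rotated basis the residual is the error with its first \<open>k\<close>
    coordinates erased.\<close>
  have Qres: "(Q *\<^sub>v res) $ i = (if i < k then 0 else w $ i)" if "i < n" for i
  proof -
    have "(Q * V) $$ (i, b) = (if i = b then 1 else 0)" if "b < k" for b
    proof -
      have "(Q * V) $$ (i, b) = (Q * Q\<^sup>T) $$ (i, b)"
        using that \<open>i < n\<close> kn cQ by (simp add: V_def scalar_prod_def)
      then show ?thesis using that \<open>i < n\<close> kn by (simp add: QQ)
    qed
    then have QV: "(Q * V) $$ (i, b) = (if i = b then 1 else 0)" if "b < k" for b using that by blast
    have "(P *\<^sub>v vec k (($) w)) $ i = (\<Sum>b\<in>{0..<k}. P $$ (i, b) * w $ b)" if "P \<in> carrier_mat n k" for P
      using that \<open>i < n\<close> by (simp add: scalar_prod_def index_mult_mat_vec)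
    from this[of "Q * V"] have "(Q * V *\<^sub>v vec k (($) w)) $ i = (\<Sum>b\<in>{0..<k}. (Q * V) $$ (i, b) * w $ b)"
      using mult_carrier_mat[OF cQ V] by blast
    also have "\<dots> = (\<Sum>b\<in>{0..<k}. (if i = b then 1 else 0) * w $ b)"
      by (rule sum.cong[OF refl]) (subst QV, auto)
    also have "\<dots> = (if i < k then w $ i else 0)"
      by (simp add: if_distrib[of "\<lambda>x. x * _"] cong: if_cong)
    finally have "(Q *\<^sub>v (V *\<^sub>v vec k (($) w))) $ i = (if i < k then w $ i else 0)"
      using cQ by (simp add: mat_dim_simps d)
    then show ?thesis
      using that cQ V by (simp add: res_def Ve mult_mat_vec_minus_dim w_def[symmetric])
  qed
  have Qr: "Q *\<^sub>v res \<in> carrier_vec n" using cQ res by simp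
  have "res \<bullet> res = (Q *\<^sub>v res) \<bullet> (Q *\<^sub>v res)" by (rule gaussian_isometry_inner[symmetric, OF Q res res])
  also have "\<dots> = (\<Sum>i\<in>{0..<k}. ((Q *\<^sub>v res) $ i)\<^sup>2) + (\<Sum>i\<in>{k..<n}. ((Q *\<^sub>v res) $ i)\<^sup>2)"
    by (rule scalar_prod_self_split[OF Qr]) (use kn in auto)
  also have "\<dots> = (\<Sum>i\<in>{k..<n}. (w $ i)\<^sup>2)" using kn by (simp add: Qres)
  finally have rr: "res \<bullet> res = (\<Sum>i\<in>{k..<n}. (w $ i)\<^sup>2)" .
  have ww: "act n Q e i = w $ i" if "i < n" for i using that by (simp add: act_def w_def)
  have sums: "(\<Sum>i\<in>{k..<n}. (act n Q e i)\<^sup>2) = (\<Sum>i\<in>{k..<n}. (w $ i)\<^sup>2)"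
    "(\<Sum>i\<in>{Suc j..<k}. (act n Q e i)\<^sup>2) = (\<Sum>i\<in>{Suc j..<k}. (w $ i)\<^sup>2)"
    using kn by (auto intro!: sum.cong simp: ww)
  have T1j: "T1 $$ (j, j) = (Q *\<^sub>v design_col n W j) $ j" using kn dims by (simp add: T1_def)
  show ?thesis
    unfolding main a_def[symmetric] res_def[symmetric] Let_def aa rr shifted_F_def kn(3) sums T1j ww[OF j(4)]
    by simp
qed

lemma measurable_stat:
  "(\<lambda>(W, e). stat W e) \<in> borel_measurable (PiM {..<p} (\<lambda>_. borel_vec n) \<Otimes>\<^sub>M borel_vec n)"
  unfolding stat_def case_prod_beta
proof (rule measurable_F_statistic)
  let ?M = "PiM {..<p} (\<lambda>_. borel_vec n) \<Otimes>\<^sub>M borel_vec n"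
  have d: "measurable_mat ?M n (Suc p) (\<lambda>x. design n (Suc p) (fst x))"
    unfolding measurable_mat_def
  proof (intro conjI ballI allI impI)
    fix i a assume ia: "i < n" "a < Suc p"
    show "(\<lambda>x. design n (Suc p) (fst x) $$ (i, a)) \<in> borel_measurable ?M"
    proof (cases a)
      case 0
      then show ?thesis using ia by (simp add: design_def design_col_def)
    next
      case (Suc b)
      have "(\<lambda>x. fst x b i) \<in> borel_measurable ?M"
        by (rule measurable_compose[OF measurable_fst measurable_PiM_borel_vec]) (use ia Suc in auto)
      then show ?thesis using ia Suc by (simp add: design_def design_col_def)
    qed
  qed simp
  show dT: "measurable_mat ?M n (Suc p) (\<lambda>x. design n (Suc p) (fst x) * TA)"
    by (rule measurable_mat_mult[OF d measurable_mat_const[OF TA(1)]])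
  have e: "(\<lambda>x. snd x i) \<in> borel_measurable ?M" if "i < n" for i
    by (rule measurable_compose[OF measurable_snd measurable_component_singleton]) (use that in auto)
  have y: "measurable_vec ?M n (\<lambda>x. design n (Suc p) (fst x) * TA *\<^sub>v \<gamma>)"
    by (rule measurable_vec_mult[OF dT measurable_vec_const[OF vecs(1)]])
  show "measurable_vec ?M n (\<lambda>x. design n (Suc p) (fst x) * TA *\<^sub>v \<gamma> + vec n (snd x))"
    unfolding measurable_vec_def
  proof (intro conjI ballI allI impI)
    fix i assume i: "i < n"
    have "(\<lambda>x. (design n (Suc p) (fst x) * TA *\<^sub>v \<gamma>) $ i + snd x i) \<in> borel_measurable ?M"
      using y e i by (intro borel_measurable_add) (auto simp: measurable_vec_def)
    then show "(\<lambda>x. (design n (Suc p) (fst x) * TA *\<^sub>v \<gamma> + vec n (snd x)) $ i) \<in> borel_measurable ?M"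
      using i by simp
  qed (auto simp: carrier_vecI)
  show "R0 \<in> carrier_mat q (Suc p)" unfolding R0 by (rule mult_carrier_mat[OF mult_carrier_mat[OF K0(1) selector_carrier] TA(1)])
qed (rule vecs)

text \<open>As \<open>Q\<close> fixes the column of ones, rotating the columns of \<open>W\<close>
  multiplies the whole design by \<open>Q\<close>, and rotating the errors too multiplies the
  response by \<open>Q\<close>.\<close>

lemma stat_isometry:
  assumes Q: "gaussian_isometry n Q" and one: "Q *\<^sub>v vec n (\<lambda>_. 1) = vec n (\<lambda>_. 1)"
  shows "stat (compose {..<p} (act n Q) W) (act n Q e) = stat W e"
proof -
  have cQ: "Q \<in> carrier_mat n n" using Q by auto
  have d: "design n (Suc p) (compose {..<p} (act n Q) W) = Q * design n (Suc p) W"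
  proof (rule eq_matI)
    fix i a assume "i < dim_row (Q * design n (Suc p) W)" "a < dim_col (Q * design n (Suc p) W)"
    then have ia: "i < n" "a < Suc p" using cQ by (auto simp: design_def)
    have r: "(Q * design n (Suc p) W) $$ (i, a) = (Q *\<^sub>v design_col n W a) $ i"
      using ia cQ by (simp add: index_mult_mat_vec design_def col_mat)
        (auto intro!: arg_cong2[where f=scalar_prod] eq_vecI simp: design_col_def)
    show "design n (Suc p) (compose {..<p} (act n Q) W) $$ (i, a) = (Q * design n (Suc p) W) $$ (i, a)"
      unfolding r using ia one by (cases a) (auto simp: design_def design_col_def compose_def act_def)
  qed (use cQ in \<open>auto simp: design_def\<close>)
  have dim: "dim_row TA = Suc p" "dim_col TA = Suc p" "dim_vec \<gamma> = Suc p" "dim_row Q = n" "dim_col Q = n"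
    "dim_row (design n (Suc p) W) = n" "dim_col (design n (Suc p) W) = Suc p"
    using TA vecs cQ by (auto simp: design_def)
  have "stat (compose {..<p} (act n Q) W) (act n Q e) =
    F_statistic (Q * (design n (Suc p) W * TA)) (Q *\<^sub>v (design n (Suc p) W * TA *\<^sub>v \<gamma> + vec n e)) R0 r0"
    unfolding stat_def d vec_act[OF cQ] by (simp add: mat_dim_simps dim)
  also have "\<dots> = stat W e"
    unfolding stat_def
    by (rule F_statistic_isometry[OF cQ]) (use gaussian_isometry_inverse[OF Q] TA vecs in \<open>auto intro!: mult_carrier_mat[of _ n "Suc p"] add_carrier_vec mult_mat_vec_carrier[of _ n "Suc p"]\<close>)
  finally show ?thesis .
qed

abbreviation design_law :: "(nat \<Rightarrow> nat \<Rightarrow> real) measure" where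
  "design_law \<equiv> PiM {..<p} (\<lambda>_. std_normal_vec n)"

lemma prob_space_design_law: "prob_space design_law"
  by (intro prob_space_PiM prob_space_std_normal_vec)

lemma stat_cong: "vec n e = vec n e' \<Longrightarrow> stat W e = stat W e'"
  by (simp add: stat_def)

lemma measurable_stat_design:
  "f \<in> measurable M design_law \<Longrightarrow> g \<in> measurable M (borel_vec n) \<Longrightarrow> (\<lambda>x. stat (f x) (g x)) \<in> borel_measurable M"
  using measurable_compose[OF measurable_Pair measurable_stat, of f M g]
  by (simp add: measurable_cong_sets[OF refl sets_PiM_std_normal_vec])

text \<open>The law of the design absorbs the rotation of its columns, so the errors alone may be
  rotated without changing the law of the statistic.\<close>

lemma stat_prob_isometry:
  assumes Q: "gaussian_isometry n Q" "Q *\<^sub>v vec n (\<lambda>_. 1) = vec n (\<lambda>_. 1)"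
  shows "emeasure design_law {W \<in> space design_law. stat W (act n Q e) \<le> t} = emeasure design_law {W \<in> space design_law. stat W e \<le> t}"
proof -
  let ?P = design_law and ?f = "compose {..<p} (act n Q)"
  have m: "?f \<in> measurable ?P ?P"
  proof -
    have "act n Q \<in> measurable (std_normal_vec n) (std_normal_vec n)"
      by (rule measurable_gaussian_isometry(2)[OF Q(1)])
    then show ?thesis
      unfolding compose_def by (intro measurable_restrict measurable_compose[OF measurable_component_singleton]) auto
  qed
  have e: "restrict (act n Q e) {..<n} = act n Q e" by (auto simp: act_def)
  have ae: "act n Q e \<in> space (borel_vec n)" by (simp add: space_borel_vec act_def)
  have ms: "{W \<in> space ?P. stat W (act n Q e) \<le> t} \<in> sets ?P"
    using measurable_stat_design[of "\<lambda>W. W" ?P "\<lambda>_. act n Q e"] ae by (auto intro!: borel_measurable_le)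
  have "emeasure ?P {W \<in> space ?P. stat W (act n Q e) \<le> t} = emeasure (distr ?P ?P ?f) {W \<in> space ?P. stat W (act n Q e) \<le> t}"
    by (simp add: distr_PiM_gaussian_isometry[OF Q(1)])
  also have "\<dots> = emeasure ?P {W \<in> space ?P. stat (?f W) (act n Q e) \<le> t}"
    using measurable_space[OF m] by (subst emeasure_distr[OF m ms]) (auto intro!: arg_cong[where f="emeasure _"])
  finally show ?thesis by (simp add: stat_isometry[OF Q])
qed

lemma stat_prob_resample:
  assumes g: "centered_norm n g \<noteq> 0"
  shows "emeasure design_law {W \<in> space design_law. stat W (resample n e g) \<le> t} = emeasure design_law {W \<in> space design_law. stat W e \<le> t}"
proof -
  have "1 < n" using dims by simp
  then obtain Q where Q: "gaussian_isometry n Q" "Q *\<^sub>v vec n (\<lambda>_. 1) = vec n (\<lambda>_. 1)"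
    "Q *\<^sub>v vec n e = vec n (resample n e g)" using resampling_isometry[OF _ g] by blast
  have "stat W (act n Q e) = stat W (resample n e g)" for W
    by (rule stat_cong) (use Q in \<open>simp add: vec_act[OF gaussian_isometry_carrier]\<close>)
  then show ?thesis using stat_prob_isometry[OF Q(1,2), of e t] by simp
qed

lemma measurable_resample: "resample n e \<in> measurable (borel_vec n) (borel_vec n)"
proof -
  note c = measurable_coordinate
  show ?thesis unfolding resample_def[abs_def]
    by (intro measurable_restrict borel_measurable_add borel_measurable_times borel_measurable_divide borel_measurable_diff
      borel_measurable_const measurable_centered_norm measurable_sample_mean c) auto
qed

lemma AE_centered_norm_nonzero: "AE g in std_normal_vec n. centered_norm n g \<noteq> 0"
proof -
  have n: "n > 0" "1 < n" using dims by auto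
  obtain Q where Q: "gaussian_isometry n Q"
    "Q *\<^sub>v vec n (\<lambda>_. 1) = vec n (\<lambda>i. if i = 0 then sqrt n else 0)"
    using centering_isometry[OF n(2)] by blast
  have "AE w in distr (std_normal_vec n) (borel_vec n) (act n Q). (\<Sum>i\<in>{1..<n}. (w i)\<^sup>2) > 0"
  proof -
    have "AE w in std_normal_vec n. (\<Sum>i\<in>{1..<n}. (w i)\<^sup>2) > 0"
      by (rule AE_std_normal_vec_sum_squares_pos) (use n in auto)
    then show ?thesis using Q(1) by (simp only: gaussian_isometry_def)
  qed
  then have "AE g in std_normal_vec n. (\<Sum>i\<in>{1..<n}. (act n Q g i)\<^sup>2) > 0"
    by (rule AE_distrD[OF measurable_gaussian_isometry(1)[OF Q(1)]])
  moreover have "(\<Sum>i\<in>{1..<n}. (act n Q g i)\<^sup>2) = (centered_norm n g)\<^sup>2" for g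
  proof -
    have "(\<Sum>i\<in>{1..<n}. (act n Q g i)\<^sup>2) = (\<Sum>i\<in>{1..<n}. ((Q *\<^sub>v vec n g) $ i)\<^sup>2)"
      by (rule sum.cong) (auto simp: act_def)
    then show ?thesis using isometry_of_ones(3)[OF Q(1) n(1), of g] Q(2) n by simp
  qed
  ultimately show ?thesis by auto
qed

text \<open>\<open>Q\<close> triangularizes the design, and \<open>w = act n Q g\<close> is again
  standard Gaussian. Beyond coordinate 0 the rotated resampled errors are \<open>w\<close> times
  \<open>centered_norm n e / centered_norm n g\<close>. Scale invariance moves the inverse factor
  into the shift, where \<open>centered_norm n g\<close> is the length of \<open>w\<close> beyond
  coordinate 0. The Gram ratio expresses the pivot of column \<open>j\<close> without reference to
  \<open>Q\<close>.\<close>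

lemma stat_resample_law:
  assumes gram: "gram (Suc p) (design_col n W) \<noteq> 0" and W: "W \<in> space design_law" and s: "centered_norm n e > 0"
  shows "measure (std_normal_vec n) {g \<in> space (std_normal_vec n). stat W (resample n e g) \<le> t} =
    measure (std_normal_vec n) {w \<in> space (std_normal_vec n).
      shifted_F j q n (sqrt (gram (Suc j) (design_col n W) / gram j (design_col n W)) * \<theta> * sqrt (\<Sum>i\<in>{1..<n}. (w i)\<^sup>2) / centered_norm n e) w \<le> t}"
    and "gram j (design_col n W) \<noteq> 0" "gram (Suc j) (design_col n W) / gram j (design_col n W) \<ge> 0"
proof -
  obtain Q where Q: "gaussian_isometry n Q"
    "\<And>a i. a < Suc p \<Longrightarrow> i < n \<Longrightarrow> a < i \<Longrightarrow> (Q *\<^sub>v design_col n W a) $ i = 0"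
    "\<And>a. a < Suc p \<Longrightarrow> (Q *\<^sub>v design_col n W a) $ a \<ge> 0"
    using gaussian_isometry_triangularize[of "Suc p" "design_col n W" n id] dims by auto
  have cQ: "Q \<in> carrier_mat n n" using Q by auto
  have g: "gram k (design_col n W) = (\<Prod>a<k. ((Q *\<^sub>v design_col n W a) $ a)\<^sup>2)" if "k \<le> Suc p" for k
    by (rule gram_triangular[OF Q(1)]) (use that dims Q(2) in auto)
  define \<rho> where "\<rho> = (Q *\<^sub>v design_col n W j) $ j"
  have prod0: "(\<Prod>a<Suc p. ((Q *\<^sub>v design_col n W a) $ a)\<^sup>2) \<noteq> 0" using gram g[of "Suc p"] by simp
  show gj: "gram j (design_col n W) \<noteq> 0"
    using prod0 j unfolding g[OF le_SucI[OF j(3)]] prod_zero_iff[OF finite_lessThan] by auto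
  have ratio: "gram (Suc j) (design_col n W) / gram j (design_col n W) = \<rho>\<^sup>2"
    using gj j g[of j] g[of "Suc j"] by (simp add: \<rho>_def)
  show "gram (Suc j) (design_col n W) / gram j (design_col n W) \<ge> 0" unfolding ratio by simp
  have rho: "sqrt (gram (Suc j) (design_col n W) / gram j (design_col n W)) = \<rho>"
    unfolding ratio using Q(3)[of j] j by (simp add: \<rho>_def)
  have col0: "design_col n W 0 = vec n (\<lambda>_. 1)" by (simp add: design_col_def)
  have z: "(Q *\<^sub>v vec n (\<lambda>_. 1)) $ i = 0" if "i < n" "0 < i" for i using Q(2)[of 0 i] that by (simp add: col0)
  have pos: "(Q *\<^sub>v vec n (\<lambda>_. 1)) $ 0 \<ge> 0" using Q(3)[of 0] by (simp add: col0)
  have n0: "n > 0" using dims by simp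
  define b where "b = (\<lambda>w. \<rho> * \<theta> * sqrt (\<Sum>i\<in>{1..<n}. (w i)\<^sup>2) / centered_norm n e)"
  have dq: "(\<Sum>i\<in>{1..<n}. (act n Q g i)\<^sup>2) = (centered_norm n g)\<^sup>2" for g
  proof -
    have "(\<Sum>i\<in>{1..<n}. (act n Q g i)\<^sup>2) = (\<Sum>i\<in>{1..<n}. ((Q *\<^sub>v vec n g) $ i)\<^sup>2)"
      by (rule sum.cong) (auto simp: act_def)
    then show ?thesis using isometry_of_ones(3)[OF Q(1) n0 z pos, of g] by simp
  qed
  have key: "stat W (resample n e g) = shifted_F j q n (b (act n Q g)) (act n Q g)" for g
  proof -
    have "stat W (resample n e g) = shifted_F j q n (\<rho> * \<theta>) (act n Q (resample n e g))"
      unfolding \<rho>_def by (rule stat_eq_shifted_F[OF Q(1,2) gram])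
    also have "\<dots> = shifted_F j q n (b (act n Q g)) (act n Q g)"
    \<comment> \<open>The identity is wanted for every \<open>g\<close>. In the degenerate case both
      denominators vanish and both sides are 0.\<close>
    proof (cases "centered_norm n g = 0")
      case True
      have "(\<Sum>i\<in>{1..<n}. (act n Q g i)\<^sup>2) = 0" unfolding dq True by simp
      then have a0: "act n Q g i = 0" if "0 < i" "i < n" for i
        using that by (subst (asm) sum_nonneg_eq_0_iff) auto
      have r0: "act n Q (resample n e g) i = 0" if "0 < i" "i < n" for i
        using that z[of i] cQ by (simp add: act_def mult_vec_resample[OF cQ] True)
      show ?thesis using a0 r0 j by (subst (1 2) shifted_F_zero) (auto intro!: sum.neutral)
    next
      case False
      define \<tau> where "\<tau> = centered_norm n e / centered_norm n g"
      have t: "\<tau> \<noteq> 0" using False s by (simp add: \<tau>_def)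
      have "\<rho> * \<theta> = \<tau> * b (act n Q g)"
        using False s centered_norm_nonneg[of n g] by (simp add: b_def dq \<tau>_def del: One_nat_def)
      moreover have "shifted_F j q n (\<tau> * b (act n Q g)) (act n Q (resample n e g)) = shifted_F j q n (b (act n Q g)) (act n Q g)"
      proof (rule shifted_F_scale[OF t])
        fix i assume i: "i < n" "0 < i"
        show "act n Q (resample n e g) i = \<tau> * act n Q g i"
          using i z[of i] cQ by (simp add: act_def mult_vec_resample[OF cQ] \<tau>_def)
      qed (use j dims in auto)
      ultimately show ?thesis by simp
    qed
    finally show ?thesis .
  qed
  let ?G = "std_normal_vec n"
  have mQ: "act n Q \<in> measurable ?G (borel_vec n)"
    by (rule measurable_gaussian_isometry(1)[OF Q(1)])
  note c = measurable_coordinate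
  have mb: "b \<in> borel_measurable (borel_vec n)"
    unfolding b_def by (intro borel_measurable_divide borel_measurable_times borel_measurable_const
      measurable_compose[OF _ borel_measurable_sqrt] borel_measurable_sum borel_measurable_power c) auto
  have mF: "(\<lambda>w. shifted_F j q n (b w) w) \<in> borel_measurable (borel_vec n)"
    by (rule measurable_shifted_F[OF _ _ mb]) (use j dims in auto)
  have A: "{w \<in> space (borel_vec n). shifted_F j q n (b w) w \<le> t} \<in> sets (borel_vec n)"
    using mF by measurable
  have "measure ?G {g \<in> space ?G. stat W (resample n e g) \<le> t} = measure (distr ?G (borel_vec n) (act n Q)) {w \<in> space (borel_vec n). shifted_F j q n (b w) w \<le> t}"
    using measurable_space[OF mQ] by (subst measure_distr[OF mQ A]) (auto intro!: arg_cong[where f="measure _"] simp: key)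
  also have "\<dots> = measure ?G {w \<in> space ?G. shifted_F j q n (b w) w \<le> t}"
    using Q(1) by (simp add: gaussian_isometry_def space_std_normal_vec)
  finally show "measure ?G {g \<in> space ?G. stat W (resample n e g) \<le> t} =
    measure ?G {w \<in> space ?G. shifted_F j q n (sqrt (gram (Suc j) (design_col n W) / gram j (design_col n W)) * \<theta> * sqrt (\<Sum>i\<in>{1..<n}. (w i)\<^sup>2) / centered_norm n e) w \<le> t}"
    unfolding rho b_def .
qed

end

context tested_regression
begin

text \<open>By \<open>stat_prob_resample\<close> the left-hand side is unchanged if \<open>e\<close>
  is replaced by \<open>resample n e g\<close>, for almost every \<open>g\<close>. Averaging over
  \<open>g\<close> and exchanging the integrals makes \<open>g\<close> the inner variable.\<close>

lemma stat_prob_eq_expectation: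
  shows "measure design_law {W \<in> space design_law. stat W e \<le> t} =
      (\<integral>W. measure (std_normal_vec n) {g \<in> space (std_normal_vec n). stat W (resample n e g) \<le> t} \<partial>design_law)"
    and "(\<lambda>W. measure (std_normal_vec n) {g \<in> space (std_normal_vec n). stat W (resample n e g) \<le> t}) \<in> borel_measurable design_law"
proof -
  let ?P = design_law and ?G = "std_normal_vec n"
  interpret P: prob_space ?P by (rule prob_space_design_law)
  interpret G: prob_space ?G by (rule prob_space_std_normal_vec)
  interpret PG: pair_prob_space ?P ?G ..
  define h where "h = (\<lambda>W. measure ?G {g \<in> space ?G. stat W (resample n e g) \<le> t})"
  have mr: "resample n e \<in> measurable ?G (borel_vec n)"
    using measurable_resample by (simp add: measurable_cong_sets[OF sets_std_normal_PiM refl])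
  define B where "B = {x \<in> space (?P \<Otimes>\<^sub>M ?G). stat (fst x) (resample n e (snd x)) \<le> t}"
  have ms: "(\<lambda>x. stat (fst x) (resample n e (snd x))) \<in> borel_measurable (?P \<Otimes>\<^sub>M ?G)"
    by (rule measurable_stat_design[OF measurable_fst measurable_compose[OF measurable_snd mr]])
  have B: "B \<in> sets (?P \<Otimes>\<^sub>M ?G)" unfolding B_def using ms by measurable
  have B1: "Pair W -` B = {g \<in> space ?G. stat W (resample n e g) \<le> t}" if "W \<in> space ?P" for W
    using that by (auto simp: B_def space_pair_measure)
  have B2: "(\<lambda>W. (W, g)) -` B = {W \<in> space ?P. stat W (resample n e g) \<le> t}" if "g \<in> space ?G" for g
    using that by (auto simp: B_def space_pair_measure)
  have "(\<lambda>W. enn2real (emeasure ?G (Pair W -` B))) \<in> borel_measurable ?P"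
    using G.measurable_emeasure_Pair[OF B] by measurable
  then show mh: "h \<in> borel_measurable ?P"
    by (rule measurable_cong[THEN iffD1, rotated]) (simp add: B1 h_def measure_def)
  have "ennreal (measure ?P {W \<in> space ?P. stat W e \<le> t}) = (\<integral>\<^sup>+g. emeasure ?P {W \<in> space ?P. stat W e \<le> t} \<partial>?G)"
    by (simp add: G.emeasure_space_1 P.emeasure_eq_measure)
  also have "\<dots> = (\<integral>\<^sup>+g. emeasure ?P ((\<lambda>W. (W, g)) -` B) \<partial>?G)"
  proof (rule nn_integral_cong_AE)
    show "AE g in ?G. emeasure ?P {W \<in> space ?P. stat W e \<le> t} = emeasure ?P ((\<lambda>W. (W, g)) -` B)"
      using AE_centered_norm_nonzero AE_space by eventually_elim (simp add: B2 stat_prob_resample)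
  qed
  also have "\<dots> = emeasure (?P \<Otimes>\<^sub>M ?G) B"
    by (rule PG.emeasure_pair_measure_alt2[OF B, symmetric])
  also have "\<dots> = (\<integral>\<^sup>+W. emeasure ?G (Pair W -` B) \<partial>?P)"
    by (rule G.emeasure_pair_measure_alt[OF B])
  also have "\<dots> = (\<integral>\<^sup>+W. ennreal (h W) \<partial>?P)"
    by (rule nn_integral_cong) (simp add: B1 h_def G.emeasure_eq_measure)
  also have "\<dots> = ennreal (\<integral>W. h W \<partial>?P)"
    by (rule nn_integral_eq_integral) (rule P.integrable_const_bound[where B=1, OF _ mh], auto simp: h_def)
  finally have "ennreal (measure ?P {W \<in> space ?P. stat W e \<le> t}) = ennreal (\<integral>W. h W \<partial>?P)" .
  moreover have "(\<integral>W. h W \<partial>?P) \<ge> 0" by (rule integral_nonneg_AE) (simp add: h_def)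
  ultimately show "measure ?P {W \<in> space ?P. stat W e \<le> t} = (\<integral>W. h W \<partial>?P)" by simp
qed

lemma gram_ratio_concentration:
  assumes t: "\<tau> > 0"
  shows "measure design_law {W \<in> space design_law. gram j (design_col n W) \<noteq> 0 \<and>
      \<bar>gram (Suc j) (design_col n W) / gram j (design_col n W) / real (n - j) - 1\<bar> > \<tau>} \<le> 2 / (real (n - j) * \<tau>\<^sup>2)"
proof -
  let ?P = design_law and ?G = "std_normal_vec n"
  interpret P: prob_space ?P by (rule prob_space_design_law)
  interpret G: prob_space ?G by (rule prob_space_std_normal_vec)
  \<comment> \<open>Column \<open>j\<close> of the design is column \<open>c = j - 1\<close> of the
    Gaussian matrix; it is random because \<open>j > 0\<close>.\<close>
  obtain c where c: "j = Suc c" using j(1) by (cases j) auto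
  define N where "N = real (n - j)"
  have N: "N > 0" using j by (simp add: N_def)
  define A where "A = {x::real. \<bar>x / N - 1\<bar> > \<tau>}"
  have A: "A \<in> sets borel" unfolding A_def by measurable
  have "emeasure ?P {W \<in> space ?P. gram j (design_col n W) \<noteq> 0 \<and> gram (Suc j) (design_col n W) / gram j (design_col n W) \<in> A}
    \<le> emeasure ?G {w \<in> space ?G. (\<Sum>i\<in>{j..<n}. (w i)\<^sup>2) \<in> A}"
    unfolding c by (rule emeasure_gram_ratio_le[OF _ _ A]) (use j c in auto)
  then have "measure ?P {W \<in> space ?P. gram j (design_col n W) \<noteq> 0 \<and> gram (Suc j) (design_col n W) / gram j (design_col n W) \<in> A}
    \<le> measure ?G {w \<in> space ?G. (\<Sum>i\<in>{j..<n}. (w i)\<^sup>2) \<in> A}"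
    by (simp add: P.emeasure_eq_measure G.emeasure_eq_measure)
  also have "\<dots> \<le> measure ?G {w \<in> space ?G. \<bar>(\<Sum>i\<in>{j..<n}. (w i)\<^sup>2) - real (card {j..<n})\<bar> \<ge> N * \<tau>}"
  proof (rule G.finite_measure_mono)
    have e: "\<bar>x / N - 1\<bar> = \<bar>x - N\<bar> / N" for x using N by (simp add: field_simps abs_divide)
    show "{w \<in> space ?G. (\<Sum>i\<in>{j..<n}. (w i)\<^sup>2) \<in> A} \<subseteq> {w \<in> space ?G. \<bar>(\<Sum>i\<in>{j..<n}. (w i)\<^sup>2) - real (card {j..<n})\<bar> \<ge> N * \<tau>}"
      using N by (auto simp: A_def e N_def[symmetric] field_simps)
    have "(\<lambda>w. \<Sum>i\<in>{j..<n}. (w i)\<^sup>2) \<in> borel_measurable ?G"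
      by (intro borel_measurable_sum borel_measurable_power) auto
    then show "{w \<in> space ?G. \<bar>(\<Sum>i\<in>{j..<n}. (w i)\<^sup>2) - real (card {j..<n})\<bar> \<ge> N * \<tau>} \<in> sets ?G"
      by measurable
  qed
  also have "\<dots> \<le> 2 * card {j..<n} / (N * \<tau>)\<^sup>2"
    by (rule chi_square_concentration) (use N t in auto)
  also have "\<dots> = 2 / (N * \<tau>\<^sup>2)"
    using N by (simp add: N_def[symmetric] power2_eq_square)
  finally show ?thesis by (simp add: A_def N_def)
qed

text \<open>The three terms stem from the pivot of column \<open>j\<close>, from the length of
  \<open>w\<close> beyond coordinate 0, and from the Gaussian band. The first exceptional set
  consists of designs, the second of resampled Gaussian vectors for a good design.\<close>

lemma stat_prob_bound:
  fixes \<sigma> \<Delta> \<tau> \<delta> :: real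
  assumes sigma: "\<sigma> > 0" "\<Delta> \<ge> 0" "\<theta> = \<sigma> * sqrt \<Delta>"
    and tau: "\<tau> > 0" "\<tau> \<le> 1 / 2" "\<delta> > 0" "7 * \<tau> * sqrt (\<Delta> * real (n - j)) \<le> \<delta>"
    and close: "\<bar>(centered_norm n e)\<^sup>2 / (real (n - 1) * \<sigma>\<^sup>2) - 1\<bar> \<le> \<tau>"
  shows "\<bar>measure design_law {W \<in> space design_law. stat W e \<le> t}
      - measure (std_normal_vec n) {w \<in> space (std_normal_vec n). shifted_F j q n (sqrt (\<Delta> * real (n - j))) w \<le> t}\<bar>
    \<le> 2 / (real (n - j) * \<tau>\<^sup>2) + 2 / (real (n - 1) * \<tau>\<^sup>2) + 2 * \<delta>"
proof -
  let ?P = design_law and ?G = "std_normal_vec n"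
  interpret P: prob_space ?P by (rule prob_space_design_law)
  interpret G: prob_space ?G by (rule prob_space_std_normal_vec)
  define N where "N = real (n - j)"
  define n1 where "n1 = real (n - 1)"
  have N: "N > 0" and n1: "n1 > 0" using j dims by (simp_all add: N_def n1_def)
  \<comment> \<open>If the norm were 0, the left-hand side of \<open>close\<close> would be 1, which
    exceeds \<open>\<tau>\<close>.\<close>
  have s: "centered_norm n e > 0"
  proof (rule ccontr)
    assume "\<not> centered_norm n e > 0"
    then have "centered_norm n e = 0" using centered_norm_nonneg[of n e] by simp
    then show False using close tau by simp
  qed
  let ?a = "sqrt (\<Delta> * N)"
  define l where "l = measure ?G {w \<in> space ?G. shifted_F j q n ?a w \<le> t}"
  define h where "h = (\<lambda>W. measure ?G {g \<in> space ?G. stat W (resample n e g) \<le> t})"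
  define S where "S = {W \<in> space ?P. gram j (design_col n W) \<noteq> 0 \<and>
      \<bar>gram (Suc j) (design_col n W) / gram j (design_col n W) / N - 1\<bar> > \<tau>}"
  have "(\<lambda>W. gram j (design_col n W)) \<in> borel_measurable ?P" "(\<lambda>W. gram (Suc j) (design_col n W)) \<in> borel_measurable ?P"
    using j by (auto intro!: measurable_gram_design_col simp: measurable_cong_sets[OF sets_PiM_std_normal_vec refl])
  then have Sm: "S \<in> sets ?P" unfolding S_def by measurable
  have S: "P.prob S \<le> 2 / (N * \<tau>\<^sup>2)" unfolding S_def N_def by (rule gram_ratio_concentration[OF tau(1)])
  have cn: "real (card {1..<n}) = n1" by (simp add: n1_def)
  define Bw where "Bw = {w \<in> space ?G. \<bar>(\<Sum>i\<in>{1..<n}. (w i)\<^sup>2) - n1\<bar> \<ge> n1 * \<tau>}"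
  have "(\<lambda>w. \<Sum>i\<in>{1..<n}. (w i)\<^sup>2) \<in> borel_measurable ?G"
    by (intro borel_measurable_sum borel_measurable_power) auto
  then have Bwm: "Bw \<in> sets ?G" unfolding Bw_def by measurable
  have Bw: "G.prob Bw \<le> 2 / (n1 * \<tau>\<^sup>2)"
  proof -
    have "G.prob Bw \<le> 2 * real (card {1..<n}) / (n1 * \<tau>)\<^sup>2"
      unfolding Bw_def cn[symmetric] by (rule order_trans[OF chi_square_concentration]) (use n1 tau cn in auto)
    also have "\<dots> = 2 / (n1 * \<tau>\<^sup>2)"
      unfolding cn using n1 by (simp add: power2_eq_square)
    finally show ?thesis .
  qed
  have "\<bar>h W - l\<bar> \<le> 2 / (n1 * \<tau>\<^sup>2) + 2 * \<delta>"
    if W: "W \<in> space ?P" "W \<notin> S" and gram: "gram (Suc p) (design_col n W) \<noteq> 0" for W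
  proof -
    define \<rho> where "\<rho> = sqrt (gram (Suc j) (design_col n W) / gram j (design_col n W))"
    note law = stat_resample_law[OF gram W(1) s]
    have rho: "\<rho> \<ge> 0" "\<rho>\<^sup>2 = gram (Suc j) (design_col n W) / gram j (design_col n W)"
      using law(3) by (auto simp: \<rho>_def)
    have rhoN: "\<bar>\<rho>\<^sup>2 / N - 1\<bar> \<le> \<tau>" using W law(2) by (auto simp: S_def rho(2) not_less)
    define b where "b = (\<lambda>w. \<rho> * \<theta> * sqrt (\<Sum>i\<in>{1..<n}. (w i)\<^sup>2) / centered_norm n e)"
    note c = measurable_coordinate
    have mb: "b \<in> borel_measurable (borel_vec n)"
      unfolding b_def by (intro borel_measurable_divide borel_measurable_times borel_measurable_const
        measurable_compose[OF _ borel_measurable_sqrt] borel_measurable_sum borel_measurable_power c) auto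
    have "h W = measure ?G {w \<in> space ?G. shifted_F j q n (b w) w \<le> t}"
      unfolding h_def b_def \<rho>_def by (rule law(1))
    then have "\<bar>h W - l\<bar> \<le> G.prob {w \<in> space ?G. \<bar>b w - ?a\<bar> > \<delta>} + 2 * \<delta>"
      unfolding l_def using shifted_F_comparison[OF dims(1) _ mb tau(3), of j t ?a] j dims by simp
    also have "G.prob {w \<in> space ?G. \<bar>b w - ?a\<bar> > \<delta>} \<le> G.prob Bw"
    proof (rule G.finite_measure_mono[OF _ Bwm], safe)
      fix w assume w: "w \<in> space ?G" "\<bar>b w - ?a\<bar> > \<delta>"
      show "w \<in> Bw"
      proof (rule ccontr)
        assume "w \<notin> Bw"
        define D where "D = (\<Sum>i\<in>{1..<n}. (w i)\<^sup>2)"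
        have "\<bar>D - n1\<bar> < n1 * \<tau>" using \<open>w \<notin> Bw\<close> w by (simp add: Bw_def D_def)
        moreover have "\<bar>D / n1 - 1\<bar> = \<bar>D - n1\<bar> / n1" using n1 by (simp add: field_simps abs_divide)
        ultimately have D: "\<bar>D / n1 - 1\<bar> \<le> \<tau>" using n1 by (simp add: field_simps)
        have D0: "D \<ge> 0" by (simp add: D_def sum_nonneg)
        have "\<bar>\<rho> * (\<sigma> * sqrt \<Delta>) * sqrt D / centered_norm n e - sqrt (\<Delta> * N)\<bar> \<le> \<delta>"
          by (rule scale_perturbation[OF rho(1) N n1 sigma(1) s sigma(2) D0 rhoN D])
            (use close tau in \<open>simp_all add: n1_def N_def\<close>)
        then show False using w by (simp add: b_def D_def sigma(3))
      qed
    qed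
    finally show ?thesis using Bw by simp
  qed
  note hW = this
  have gn: "AE W in ?P. gram (Suc p) (design_col n W) \<noteq> 0"
    by (rule AE_gram_design_col_nonzero) (use dims in auto)
  have "\<bar>P.expectation h - l\<bar> \<le> (2 / (n1 * \<tau>\<^sup>2) + 2 * \<delta>) + P.prob S"
  proof (rule P.abs_expectation_diff_le[OF _ Sm])
    show "h \<in> borel_measurable ?P" unfolding h_def by (rule stat_prob_eq_expectation(2))
    show "AE W in ?P. W \<notin> S \<longrightarrow> \<bar>h W - l\<bar> \<le> 2 / (n1 * \<tau>\<^sup>2) + 2 * \<delta>"
      using gn AE_space by eventually_elim (use hW in blast)
  qed (use n1 tau in \<open>auto simp: h_def l_def\<close>)
  also have "P.expectation h = measure ?P {W \<in> space ?P. stat W e \<le> t}"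
    unfolding h_def by (rule stat_prob_eq_expectation(1)[symmetric])
  finally show ?thesis using S by (simp add: l_def N_def n1_def)
qed

end

text \<open>The squared centered norm is \<open>n\<close>, plus the sum of the \<open>Y i\<close>,
  minus the squared sum of the \<open>X i\<close> divided by \<open>n\<close>. Chebyshev's
  inequality handles both sums. The second moment of \<open>Y i\<close> is the fourth moment of
  \<open>X i\<close> minus 1, hence at most \<open>K\<close>.\<close>

lemma (in prob_space) centered_norm_concentration:
  fixes X :: "nat \<Rightarrow> 'a \<Rightarrow> real" and K \<tau> :: real
  assumes ind: "indep_vars (\<lambda>_. borel) X {..<n}"
    and mean: "\<And>i. i < n \<Longrightarrow> expectation (X i) = 0"
    and var: "\<And>i. i < n \<Longrightarrow> expectation (\<lambda>\<omega>. (X i \<omega>)\<^sup>2) = 1"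
    and int: "\<And>i. i < n \<Longrightarrow> integrable M (\<lambda>\<omega>. (X i \<omega>) ^ 4)"
    and K: "\<And>i. i < n \<Longrightarrow> expectation (\<lambda>\<omega>. (X i \<omega>) ^ 4) \<le> K"
    and tau: "\<tau> > 0" "\<tau> \<le> 1 / 2" "real n * \<tau> \<ge> 4"
  shows "prob {\<omega> \<in> space M. \<bar>(centered_norm n (\<lambda>i. X i \<omega>))\<^sup>2 / real (n - 1) - 1\<bar> > \<tau>} \<le> (16 * K + 4) / (real n * \<tau>\<^sup>2)"
proof -
  have n: "n > 1"
  proof (rule ccontr)
    assume "\<not> n > 1"
    then have "real n * \<tau> \<le> 1 * (1 / 2)" using tau by (intro mult_mono) auto
    then show False using tau by simp
  qed
  have rv: "random_variable borel (X i)" if "i < n" for i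
    using ind that by (auto simp: indep_vars_def2)
  have int2: "integrable M (\<lambda>\<omega>. (X i \<omega>)\<^sup>2)" if "i < n" for i
  proof (rule square_integrable_imp_integrable)
    show "integrable M (\<lambda>\<omega>. ((X i \<omega>)\<^sup>2)\<^sup>2)" using int[OF that] by (simp flip: power_mult)
  qed (use rv[OF that] in simp)
  define Y where "Y = (\<lambda>i \<omega>. (X i \<omega>)\<^sup>2 - 1)"
  have indY: "indep_vars (\<lambda>_. borel) Y {..<n}"
    unfolding Y_def using indep_vars_compose2[OF ind, of "\<lambda>_ x. x\<^sup>2 - 1" "\<lambda>_. borel"] by auto
  have Y2: "(Y i \<omega>)\<^sup>2 = (X i \<omega>) ^ 4 - 2 * (X i \<omega>)\<^sup>2 + 1" for i \<omega>
    by (simp add: Y_def power2_eq_square power4_eq_xxxx algebra_simps)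
  have intY: "integrable M (\<lambda>\<omega>. (Y i \<omega>)\<^sup>2)" if "i < n" for i
    unfolding Y2 using int[OF that] int2[OF that] by simp
  have EY: "expectation (Y i) = 0" if "i < n" for i
    unfolding Y_def using int2[OF that] var[OF that] by (simp add: prob_space)
  have EY2: "expectation (\<lambda>\<omega>. (Y i \<omega>)\<^sup>2) \<le> K" if "i < n" for i
    unfolding Y2 using int[OF that] int2[OF that] var[OF that] K[OF that] by (simp add: prob_space)
  \<comment> \<open>Each threshold permits a contribution of \<open>n * \<tau> / 4\<close>, for
    \<open>B2\<close> after squaring and dividing by \<open>n\<close>. The other half of
    \<open>n * \<tau>\<close> pays for replacing \<open>n\<close> by \<open>n - 1\<close>.\<close>
  define B1 where "B1 = {\<omega> \<in> space M. \<bar>\<Sum>i<n. Y i \<omega>\<bar> \<ge> real n * \<tau> / 4}"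
  define B2 where "B2 = {\<omega> \<in> space M. \<bar>\<Sum>i<n. X i \<omega>\<bar> \<ge> real n * sqrt \<tau> / 2}"
  have mX: "random_variable borel (\<lambda>\<omega>. \<Sum>i<n. X i \<omega>)" using rv by (intro borel_measurable_sum) auto
  have mY: "random_variable borel (\<lambda>\<omega>. \<Sum>i<n. Y i \<omega>)" unfolding Y_def using rv by (intro borel_measurable_sum borel_measurable_diff borel_measurable_power) auto
  note sY = second_moment_sum_indep[OF finite_lessThan indY, of K]
  note sX = second_moment_sum_indep[OF finite_lessThan ind, of 1]
  have sY1: "integrable M (\<lambda>\<omega>. (\<Sum>i<n. Y i \<omega>)\<^sup>2)" by (rule sY) (use intY EY EY2 in auto)
  have sY2: "expectation (\<lambda>\<omega>. (\<Sum>i<n. Y i \<omega>)\<^sup>2) \<le> card {..<n} * K" by (rule sY) (use intY EY EY2 in auto)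
  have sX1: "integrable M (\<lambda>\<omega>. (\<Sum>i<n. X i \<omega>)\<^sup>2)" by (rule sX) (use int2 mean var in auto)
  have sX2: "expectation (\<lambda>\<omega>. (\<Sum>i<n. X i \<omega>)\<^sup>2) \<le> real (card {..<n}) * 1" by (rule sX) (use int2 mean var in auto)
  have "prob B1 \<le> expectation (\<lambda>\<omega>. (\<Sum>i<n. Y i \<omega>)\<^sup>2) / (real n * \<tau> / 4)\<^sup>2"
    unfolding B1_def by (rule second_moment_method[OF mY sY1]) (use n tau in auto)
  also have "\<dots> \<le> (real n * K) / (real n * \<tau> / 4)\<^sup>2"
    using sY2 by (intro divide_right_mono) auto
  also have "\<dots> = 16 * K / (real n * \<tau>\<^sup>2)" using n by (simp add: power2_eq_square field_simps)
  finally have P1: "prob B1 \<le> 16 * K / (real n * \<tau>\<^sup>2)" .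
  have "prob B2 \<le> expectation (\<lambda>\<omega>. (\<Sum>i<n. X i \<omega>)\<^sup>2) / (real n * sqrt \<tau> / 2)\<^sup>2"
    unfolding B2_def by (rule second_moment_method[OF mX sX1]) (use n tau in auto)
  also have "\<dots> \<le> (real n * 1) / (real n * sqrt \<tau> / 2)\<^sup>2"
    using sX2 by (intro divide_right_mono) auto
  also have "\<dots> = 4 / (real n * \<tau>)" using n tau by (simp add: power_divide power_mult_distrib, simp add: power2_eq_square field_simps)
  also have "\<dots> \<le> 4 / (real n * \<tau>\<^sup>2)"
  proof (intro divide_left_mono)
    have "\<tau>\<^sup>2 \<le> \<tau> * 1" unfolding power2_eq_square using tau by (intro mult_left_mono) auto
    then show "real n * \<tau>\<^sup>2 \<le> real n * \<tau>" by (intro mult_left_mono) auto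
  qed (use n tau in auto)
  finally have P2: "prob B2 \<le> 4 / (real n * \<tau>\<^sup>2)" .
  have mB: "B1 \<in> events" "B2 \<in> events" unfolding B1_def B2_def using mX mY by measurable
  have "{\<omega> \<in> space M. \<bar>(centered_norm n (\<lambda>i. X i \<omega>))\<^sup>2 / real (n - 1) - 1\<bar> > \<tau>} \<subseteq> B1 \<union> B2"
  proof safe
    fix \<omega> assume w: "\<omega> \<in> space M" "\<bar>(centered_norm n (\<lambda>i. X i \<omega>))\<^sup>2 / real (n - 1) - 1\<bar> > \<tau>" "\<omega> \<notin> B2"
    show "\<omega> \<in> B1"
    proof (rule ccontr)
      assume "\<omega> \<notin> B1"
      define A B where "A = (\<Sum>i<n. Y i \<omega>)" and "B = (\<Sum>i<n. X i \<omega>)"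
      have A: "\<bar>A\<bar> < real n * \<tau> / 4" using \<open>\<omega> \<notin> B1\<close> w by (simp add: B1_def A_def)
      have "\<bar>B\<bar> \<le> real n * sqrt \<tau> / 2" using w by (simp add: B2_def B_def)
      then have "\<bar>B\<bar>\<^sup>2 \<le> (real n * sqrt \<tau> / 2)\<^sup>2" by (intro power_mono) auto
      then have B: "B\<^sup>2 / real n \<le> real n * \<tau> / 4"
        using n tau by (simp add: power_divide power_mult_distrib power2_eq_square field_simps)
      have dv: "(centered_norm n (\<lambda>i. X i \<omega>))\<^sup>2 = A + real n - B\<^sup>2 / real n"
        using n by (subst centered_norm_power2) (auto simp: A_def B_def Y_def sum_subtractf sample_mean_def power_divide power2_eq_square)
      have B0: "B\<^sup>2 / real n \<ge> 0" by simp
      have n1: "real (n - 1) = real n - 1" using n by simp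
      have "\<bar>(centered_norm n (\<lambda>i. X i \<omega>))\<^sup>2 - real (n - 1)\<bar> \<le> real n * \<tau> / 2 + 1"
        unfolding dv n1 using A B B0 by linarith
      \<comment> \<open>From \<open>n * \<tau> \<ge> 4\<close> and \<open>\<tau> \<le> 1 / 2\<close>
        follows \<open>1 + \<tau> \<le> n * \<tau> / 2\<close>.\<close>
      also have "\<dots> \<le> real (n - 1) * \<tau>" unfolding n1 left_diff_distrib using tau by linarith
      finally have "\<bar>(centered_norm n (\<lambda>i. X i \<omega>))\<^sup>2 - real (n - 1)\<bar> / real (n - 1) \<le> \<tau>"
        using n by (simp add: pos_divide_le_eq mult.commute)
      moreover have "\<bar>(centered_norm n (\<lambda>i. X i \<omega>))\<^sup>2 / real (n - 1) - 1\<bar> = \<bar>(centered_norm n (\<lambda>i. X i \<omega>))\<^sup>2 - real (n - 1)\<bar> / real (n - 1)"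
      proof -
        have "x / m - 1 = (x - m) / m" if "m > 0" for x m :: real using that by (simp add: diff_divide_distrib)
        then show ?thesis using n by (simp add: abs_divide del: of_nat_diff)
      qed
      ultimately show False using w by simp
    qed
  qed
  then have "prob {\<omega> \<in> space M. \<bar>(centered_norm n (\<lambda>i. X i \<omega>))\<^sup>2 / real (n - 1) - 1\<bar> > \<tau>} \<le> prob (B1 \<union> B2)"
    using mB by (intro finite_measure_mono) auto
  also have "\<dots> \<le> prob B1 + prob B2" by (rule measure_Un_le[OF mB])
  also have "\<dots> \<le> 16 * K / (real n * \<tau>\<^sup>2) + 4 / (real n * \<tau>\<^sup>2)" using P1 P2 by simp
  finally show ?thesis by (simp add: add_divide_distrib)
qed

subsection \<open>Normal form of the restriction\<close>

lemma mult_mat_vec_in_carrier: "A \<in> carrier_mat n m \<Longrightarrow> A *\<^sub>v v \<in> carrier_vec n"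
  by (auto intro: carrier_vecI)

text \<open>Multiplying the standardized design by this matrix from the right gives the observed one
  when each observation is \<open>\<mu> + A z\<close>.\<close>

definition design_factor :: "nat \<Rightarrow> real vec \<Rightarrow> real mat \<Rightarrow> real mat" where
  "design_factor p \<mu> A = four_block_mat (1\<^sub>m 1) (mat_of_rows p [\<mu>]) (0\<^sub>m p 1) A\<^sup>T"

lemma design_factor_carrier [simp]:
  "A \<in> carrier_mat p p \<Longrightarrow> design_factor p \<mu> A \<in> carrier_mat (Suc p) (Suc p)"
  by (auto simp: design_factor_def)

lemma second_moment_matrix_factor:
  assumes \<mu>: "\<mu> \<in> carrier_vec p" and A: "A \<in> carrier_mat p p"
  shows "second_moment_matrix p \<mu> (A * A\<^sup>T) = (design_factor p \<mu> A)\<^sup>T * design_factor p \<mu> A"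
proof -
  let ?r = "mat_of_rows p [\<mu>]" and ?c = "mat_of_cols p [\<mu>]"
  have c: "?r \<in> carrier_mat 1 p" "?c \<in> carrier_mat p 1" "(1\<^sub>m 1 :: real mat) \<in> carrier_mat 1 1" "(0\<^sub>m p 1 :: real mat) \<in> carrier_mat p 1"
    "A\<^sup>T \<in> carrier_mat p p" "(0\<^sub>m 1 p :: real mat) \<in> carrier_mat 1 p"
    using A by auto
  have t: "(design_factor p \<mu> A)\<^sup>T = four_block_mat (1\<^sub>m 1) (0\<^sub>m 1 p) ?c A"
    unfolding design_factor_def
    by (subst transpose_four_block_mat[OF c(3,1,4,5)]) (simp add: transpose_mat_of_rows)
  have "(design_factor p \<mu> A)\<^sup>T * design_factor p \<mu> A =
    four_block_mat (1\<^sub>m 1 * 1\<^sub>m 1 + 0\<^sub>m 1 p * 0\<^sub>m p 1) (1\<^sub>m 1 * ?r + 0\<^sub>m 1 p * A\<^sup>T)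
      (?c * 1\<^sub>m 1 + A * 0\<^sub>m p 1) (?c * ?r + A * A\<^sup>T)"
    unfolding t unfolding design_factor_def
    by (rule mult_four_block_mat[OF c(3,6,2) A c(3,1,4,5)])
  also have "\<dots> = second_moment_matrix p \<mu> (A * A\<^sup>T)"
  proof -
    have "?c * ?r + A * A\<^sup>T = A * A\<^sup>T + ?c * ?r" by (rule comm_add_mat) (use A c in auto)
    then show ?thesis using A c unfolding second_moment_matrix_def by (simp add: right_mult_zero_mat[OF A] left_mult_zero_mat[OF c(5)])
  qed
  finally show ?thesis ..
qed

lemma det_design_factor:
  assumes A: "A \<in> carrier_mat p p"
  shows "det (design_factor p \<mu> A) = det A"
  unfolding design_factor_def
  by (subst det_four_block_mat_lower_left_zero[of _ 1 _ p]) (use A in \<open>auto simp: det_transpose[OF A]\<close>)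

text \<open>The population analogue of \<open>F_statistic_factored\<close>: the second moment matrix
  \<open>T' T\<close> takes the place of \<open>U' U\<close>, and the same cancellation leaves the
  squared length of the shift.\<close>

lemma Delta_gamma_eq:
  assumes K: "K \<in> carrier_mat q q" "det K \<noteq> 0" and T: "T \<in> carrier_mat k k" "det T \<noteq> 0" and q: "q \<le> k" "0 < q"
    and alt: "K * selector q k * T *\<^sub>v \<gamma> - r = K *\<^sub>v (\<theta> \<cdot>\<^sub>v unit_vec q 0)"
  shows "Delta_gamma (T\<^sup>T * T) (K * selector q k * T) r \<gamma> \<sigma> = \<theta>\<^sup>2 / \<sigma>\<^sup>2"
proof -
  obtain Ki where Ki: "Ki \<in> carrier_mat q q" "Ki * K = 1\<^sub>m q" using obtain_inverse_mat[OF K] by auto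
  obtain Ti where Ti: "Ti \<in> carrier_mat k k" "Ti * T = 1\<^sub>m k" using obtain_inverse_mat[OF T] by auto
  note m = mat_inverse_quadratic_form[OF T(1) Ti selector_carrier selector_orthonormal[OF q(1)] K(1) Ki]
  have u: "\<theta> \<cdot>\<^sub>v unit_vec q 0 \<in> carrier_vec q" by simp
  have "(\<theta> \<cdot>\<^sub>v unit_vec q 0) \<bullet> (\<theta> \<cdot>\<^sub>v unit_vec q 0) = \<theta>\<^sup>2"
    using q by (simp add: power2_eq_square)
  then show ?thesis
    unfolding Delta_gamma_def Let_def m(1) option.sel m(2) alt m(3)[OF u] by simp
qed

text \<open>In standardized coordinates the restriction acts on the slopes by a matrix
  \<open>C\<close>. A rotation \<open>B\<close> moves the rows of \<open>C\<close> into the last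
  \<open>q\<close> coordinates and the violation into the first of these; \<open>K0\<close> is the
  remaining square block. Replacing the square root \<open>A0\<close> of \<open>\<Sigma>\<close> by
  \<open>A0 * B\<^sup>T\<close> absorbs the rotation.\<close>

lemma restriction_decomposition:
  assumes \<Sigma>: "positive_definite p \<Sigma>" and A0: "A0 \<in> carrier_mat p p" "A0 * A0\<^sup>T = \<Sigma>"
    and R0: "R0 \<in> carrier_mat q (Suc p)" "R0 * R0\<^sup>T = 1\<^sub>m q" and col0: "col R0 0 = 0\<^sub>v q"
    and q: "1 \<le> q" "q \<le> Suc p" and r0: "r0 \<in> carrier_vec q" and \<gamma>: "\<gamma> \<in> carrier_vec (Suc p)"
    and \<mu>: "\<mu> \<in> carrier_vec p"
  shows "\<exists>B K0 \<theta>. gaussian_isometry p B \<and> K0 \<in> carrier_mat q q \<and> det K0 \<noteq> 0 \<and> \<theta> \<ge> 0 \<and>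
    det (A0 * B\<^sup>T) \<noteq> 0 \<and> R0 = K0 * selector q (Suc p) * design_factor p \<mu> (A0 * B\<^sup>T) \<and>
    R0 *\<^sub>v \<gamma> - r0 = K0 *\<^sub>v (\<theta> \<cdot>\<^sub>v unit_vec q 0)" and "q \<le> p"
proof -
  have R00: "R0 $$ (a, 0) = 0" if "a < q" for a
  proof -
    have "col R0 0 $ a = 0" using col0 that by simp
    then show ?thesis using R0(1) that by simp
  qed
  \<comment> \<open>For \<open>q = p + 1\<close> the matrix \<open>R0\<close> would be orthogonal,
    which its zero column forbids.\<close>
  show qp: "q \<le> p"
  proof (rule ccontr)
    assume "\<not> q \<le> p"
    then have "q = Suc p" using q by simp
    then have R: "R0 \<in> carrier_mat q q" using R0 by simp
    have "R0\<^sup>T * R0 = 1\<^sub>m q" by (rule mat_mult_left_right_inverse[OF R _ R0(2)]) (use R in simp)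
    then have "(R0\<^sup>T * R0) $$ (0, 0) = 1" using q by simp
    moreover have "(R0\<^sup>T * R0) $$ (0, 0) = 0" using R q col0 by simp
    ultimately show False by simp
  qed
  have detA0: "det A0 \<noteq> 0"
  proof
    assume "det A0 = 0"
    then have "det A0\<^sup>T = 0" by (simp add: det_transpose[OF A0(1)])
    then obtain v where v: "v \<in> carrier_vec p" "v \<noteq> 0\<^sub>v p" "A0\<^sup>T *\<^sub>v v = 0\<^sub>v p"
      using det_0_iff_vec_prod_zero_field[of "A0\<^sup>T" p] A0 by auto
    have "\<Sigma> *\<^sub>v v = A0 *\<^sub>v (A0\<^sup>T *\<^sub>v v)" unfolding A0(2)[symmetric] using A0(1) v by (simp add: assoc_mult_mat_vec_dim)
    also have "\<dots> = 0\<^sub>v p" unfolding v(3) using A0 by (intro eq_vecI) (auto simp: scalar_prod_def index_mult_mat_vec)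
    finally have "v \<bullet> (\<Sigma> *\<^sub>v v) = 0" using v by simp
    then show False using \<Sigma> v unfolding positive_definite_def by fastforce
  qed
  obtain A0i where A0i: "A0i \<in> carrier_mat p p" "A0i * A0 = 1\<^sub>m p" "A0 * A0i = 1\<^sub>m p"
    using obtain_inverse_mat[OF A0(1) detA0] by auto
  have tA: "A0i\<^sup>T * A0\<^sup>T = 1\<^sub>m p"
    using A0 A0i by (simp flip: transpose_mult_dim)
  define Rm where "Rm = mat q p (\<lambda>(a, i). R0 $$ (a, Suc i))"
  have Rm: "Rm \<in> carrier_mat q p" by (simp add: Rm_def)
  have RR: "Rm * Rm\<^sup>T = 1\<^sub>m q"
  proof (rule eq_matI)
    fix a b assume "a < dim_row (1\<^sub>m q :: real mat)" "b < dim_col (1\<^sub>m q :: real mat)"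
    then have ab: "a < q" "b < q" by auto
    have "(R0 * R0\<^sup>T) $$ (a, b) = (\<Sum>i\<in>{0..<Suc p}. R0 $$ (a, i) * R0 $$ (b, i))"
      using ab R0(1) by (simp add: scalar_prod_def)
    also have "\<dots> = (\<Sum>i\<in>{0..<p}. R0 $$ (a, Suc i) * R0 $$ (b, Suc i))"
      using ab by (subst sum.atLeast0_lessThan_Suc_shift) (simp add: R00)
    also have "\<dots> = (Rm * Rm\<^sup>T) $$ (a, b)" using ab by (simp add: Rm_def scalar_prod_def)
    finally show "(Rm * Rm\<^sup>T) $$ (a, b) = 1\<^sub>m q $$ (a, b)" using R0(2) by simp
  qed (auto simp: Rm_def)
  \<comment> \<open>If \<open>x = \<mu> + A0 z\<close>, the slopes on \<open>z\<close> are
    \<open>A0\<^sup>T\<close> applied to the slopes on \<open>x\<close>, so the restriction on the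
    former carries the inverse of \<open>A0\<^sup>T\<close>.\<close>
  define C where "C = Rm * A0i\<^sup>T"
  have C: "C \<in> carrier_mat q p" using Rm A0i by (auto simp: C_def)
  note d = carrier_matD[OF C] carrier_matD[OF Rm] carrier_matD[OF A0(1)] carrier_matD[OF A0i(1)]
  have CA: "C * A0\<^sup>T = Rm"
    using Rm by (simp add: C_def mat_dim_simps d tA)
  \<comment> \<open>\<open>C\<close> inherits independent rows from \<open>Rm\<close>: a vector
    killed by \<open>C C'\<close> is killed by \<open>C'\<close>, hence by \<open>Rm'\<close>, hence
    is 0.\<close>
  have detCC: "det (C * C\<^sup>T) \<noteq> 0"
  proof
    have CC: "C * C\<^sup>T \<in> carrier_mat q q" using C by simp
    assume "det (C * C\<^sup>T) = 0"
    then obtain v where v: "v \<in> carrier_vec q" "v \<noteq> 0\<^sub>v q" "C * C\<^sup>T *\<^sub>v v = 0\<^sub>v q"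
      using det_0_iff_vec_prod_zero_field[OF CC] by auto
    define x where "x = C\<^sup>T *\<^sub>v v"
    have x: "x \<in> carrier_vec p" unfolding x_def by (rule mult_mat_vec_in_carrier[of _ p q]) (use C in simp)
    have "C *\<^sub>v x = 0\<^sub>v q" using v C by (simp add: x_def assoc_mult_mat_vec_dim)
    then have "v \<bullet> (C *\<^sub>v x) = 0" using v by simp
    then have "x \<bullet> x = 0" using v x by (subst (asm) scalar_prod_mult_mat_vec) (auto simp: x_def d)
    then have "(\<Sum>i\<in>{0..<p}. x $ i * x $ i) = 0" using x by (simp add: scalar_prod_def)
    then have x0: "x = 0\<^sub>v p"
      using x by (subst (asm) sum_nonneg_eq_0_iff) (auto intro!: eq_vecI)
    have "Rm\<^sup>T *\<^sub>v v = A0 *\<^sub>v x"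
      unfolding CA[symmetric] x_def using v by (simp add: mat_dim_simps d)
    also have "\<dots> = 0\<^sub>v p" unfolding x0 using A0 by (intro eq_vecI) (auto simp: scalar_prod_def index_mult_mat_vec)
    finally have "Rm *\<^sub>v (Rm\<^sup>T *\<^sub>v v) = 0\<^sub>v q" using Rm by (intro eq_vecI) (auto simp: scalar_prod_def index_mult_mat_vec)
    moreover have "Rm *\<^sub>v (Rm\<^sup>T *\<^sub>v v) = v" by (rule mult_mat_vec_cancel[OF RR]) (use v d in auto)
    ultimately show False using v by simp
  qed
  obtain Pi where Pi: "Pi \<in> carrier_mat q q" "C * C\<^sup>T * Pi = 1\<^sub>m q"
    using obtain_inverse_mat[of "C * C\<^sup>T" q] detCC C by (metis mult_carrier_mat transpose_carrier_mat)
  define \<delta> where "\<delta> = R0 *\<^sub>v \<gamma> - r0"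
  have \<delta>: "\<delta> \<in> carrier_vec q" unfolding \<delta>_def by (rule minus_carrier_vec[OF mult_mat_vec_in_carrier[OF R0(1)] r0])
  define v where "v = Pi *\<^sub>v \<delta>"
  have v: "v \<in> carrier_vec q" unfolding v_def by (rule mult_mat_vec_in_carrier[OF Pi(1)])
  \<comment> \<open>The shortest vector that \<open>C\<close> maps to \<open>\<delta>\<close>. It
    lies in the row space of \<open>C\<close>, so it follows the rows into the last \<open>q\<close>
    coordinates; its length is going to be \<open>\<theta>\<close>.\<close>
  define \<psi> where "\<psi> = C\<^sup>T *\<^sub>v v"
  have \<psi>: "\<psi> \<in> carrier_vec p" unfolding \<psi>_def by (rule mult_mat_vec_in_carrier[of _ p q]) (use C in simp)
  have C\<psi>: "C *\<^sub>v \<psi> = \<delta>"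
  proof -
    have "C *\<^sub>v \<psi> = C * C\<^sup>T *\<^sub>v (Pi *\<^sub>v \<delta>)"
      using v by (simp add: \<psi>_def v_def[symmetric] mat_dim_simps d)
    also have "\<dots> = \<delta>" by (rule mult_mat_vec_cancel[OF Pi(2)]) (use Pi \<delta> C in auto)
    finally show ?thesis .
  qed
  have rows: "row C a \<in> carrier_vec p" for a using C by (intro carrier_vecI) simp
  \<comment> \<open>The pivots descend from \<open>p - 1\<close>, so the rotated rows of
    \<open>C\<close> occupy the last \<open>q\<close> coordinates.\<close>
  obtain Q where Q: "gaussian_isometry p Q"
    "\<And>a i. a < q \<Longrightarrow> i < p \<Longrightarrow> i \<notin> (\<lambda>a. p - 1 - a) ` {..a} \<Longrightarrow> (Q *\<^sub>v row C a) $ i = 0"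
  proof -
    have "inj_on (\<lambda>a. p - 1 - a) {..<q}" using qp by (auto simp: inj_on_def)
    moreover have "(\<lambda>a. p - 1 - a) ` {..<q} \<subseteq> {..<p}" using qp q by auto
    ultimately show ?thesis
      using gaussian_isometry_triangularize[of q "row C" p "\<lambda>a. p - 1 - a"] rows that by blast
  qed
  have Q0: "(Q *\<^sub>v row C a) $ i = 0" if "a < q" "i < p - q" for a i
    by (rule Q(2)) (use that in auto)
  have cQ: "Q \<in> carrier_mat p p" using Q by auto
  have Q\<psi>: "(Q *\<^sub>v \<psi>) $ i = 0" if "i < p - q" for i
  proof -
    have ip: "i < p" using that by simp
    have "(Q * C\<^sup>T) $$ (i, a) = 0" if "a < q" for a
      using Q0[OF that \<open>i < p - q\<close>] ip that cQ C by (simp add: index_mult_mat_vec)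
    then have "(Q * C\<^sup>T *\<^sub>v v) $ i = 0"
    proof -
      assume z: "\<And>a. a < q \<Longrightarrow> (Q * C\<^sup>T) $$ (i, a) = 0"
      have "(P *\<^sub>v v) $ i = (\<Sum>a\<in>{0..<q}. P $$ (i, a) * v $ a)" if "P \<in> carrier_mat p q" for P
        using that ip v by (simp add: scalar_prod_def index_mult_mat_vec)
      from this[of "Q * C\<^sup>T"] have "(Q * C\<^sup>T *\<^sub>v v) $ i = (\<Sum>a\<in>{0..<q}. (Q * C\<^sup>T) $$ (i, a) * v $ a)"
        using cQ C by (metis mult_carrier_mat transpose_carrier_mat)
      also have "\<dots> = 0" by (rule sum.neutral) (use z in \<open>simp del: index_mult_mat(1)\<close>)
      finally show ?thesis .
    qed
    then show ?thesis using cQ v by (simp add: \<psi>_def mat_dim_simps d)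
  qed
  define k where "k = p - q"
  have k: "k < p" "k + q = p" using qp q by (auto simp: k_def)
  have Qp: "Q *\<^sub>v \<psi> \<in> carrier_vec p" by (rule mult_mat_vec_in_carrier[OF cQ])
  \<comment> \<open>\<open>H\<close> gathers the rotated \<open>\<psi>\<close> in coordinate
    \<open>k = p - q\<close>. It acts on the last \<open>q\<close> coordinates only, so the rows of
    \<open>C\<close> remain supported there.\<close>
  obtain H where H: "gaussian_isometry p H"
    "\<And>x i. x \<in> carrier_vec p \<Longrightarrow> i < k \<Longrightarrow> (H *\<^sub>v x) $ i = x $ i"
    "\<And>i. i \<in> {Suc k..<p} \<Longrightarrow> (H *\<^sub>v (Q *\<^sub>v \<psi>)) $ i = 0" "(H *\<^sub>v (Q *\<^sub>v \<psi>)) $ k \<ge> 0"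
  proof -
    have "{Suc k..<p} \<subseteq> {..<p}" "k \<notin> {Suc k..<p}" by auto
    from gaussian_isometry_eliminate[OF _ this(1) k(1) this(2) Qp] show ?thesis
      using that k by fastforce
  qed
  have cH: "H \<in> carrier_mat p p" using H by auto
  define B where "B = H * Q"
  have B: "gaussian_isometry p B" unfolding B_def by (rule gaussian_isometry_mult[OF H(1) Q(1)])
  have cB: "B \<in> carrier_mat p p" using B by auto
  have Bv: "B *\<^sub>v x = H *\<^sub>v (Q *\<^sub>v x)" if "x \<in> carrier_vec p" for x
    using that cH cQ by (simp add: B_def)
  define \<theta> where "\<theta> = (B *\<^sub>v \<psi>) $ k"
  have \<theta>: "\<theta> \<ge> 0" using H(4) by (simp add: \<theta>_def Bv[OF \<psi>])
  have B\<psi>: "(B *\<^sub>v \<psi>) $ i = (if i = k then \<theta> else 0)" if "i < p" for i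
  proof -
    consider "i < k" | "i = k" | "k < i" by linarith
    then show ?thesis
    proof cases
      case 1
      then show ?thesis using H(2)[OF Qp 1] Q\<psi>[of i] by (simp add: Bv[OF \<psi>] k_def)
    next
      case 3
      then show ?thesis using H(3)[of i] that by (simp add: Bv[OF \<psi>])
    qed (simp add: \<theta>_def)
  qed
  have Brow: "(B *\<^sub>v row C a) $ i = 0" if "a < q" "i < k" for a i
    using that Q0[of a i] H(2)[of "Q *\<^sub>v row C a" i] mult_mat_vec_in_carrier[OF cQ] by (simp add: Bv[OF rows] k_def)
  define K0 where "K0 = mat q q (\<lambda>(a, b). (B *\<^sub>v row C a) $ (k + b))"
  have K0: "K0 \<in> carrier_mat q q" by (simp add: K0_def)
  have CB: "C * B\<^sup>T = K0 * selector q p"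
  proof (rule eq_matI)
    fix a i assume "a < dim_row (K0 * selector q p)" "i < dim_col (K0 * selector q p)"
    then have ai: "a < q" "i < p" by (auto simp: K0_def selector_def)
    have "(C * B\<^sup>T) $$ (a, i) = (B *\<^sub>v row C a) $ i"
      using ai C cB by (simp add: index_mult_mat_vec comm_scalar_prod[of _ p])
    also have "\<dots> = (\<Sum>b\<in>{0..<q}. K0 $$ (a, b) * (if i = k + b then 1 else 0))"
    proof (cases "i < k")
      case True
      then show ?thesis using ai Brow by (auto intro!: sum.neutral[symmetric])
    next
      case False
      have "(\<Sum>b\<in>{0..<q}. K0 $$ (a, b) * (if i = k + b then 1 else 0)) = (\<Sum>b\<in>{i - k}. K0 $$ (a, b) * (if i = k + b then 1 else 0))"
        by (rule sum.mono_neutral_right) (use False ai k in auto)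
      then show ?thesis using False ai k by (simp add: K0_def)
    qed
    also have "\<dots> = (K0 * selector q p) $$ (a, i)"
      using ai K0 by (simp add: scalar_prod_def selector_def k_def)
    finally show "(C * B\<^sup>T) $$ (a, i) = (K0 * selector q p) $$ (a, i)" .
  qed (use C cB K0 in \<open>auto simp: selector_def\<close>)
  note BB = gaussian_isometry_inverse[OF B]
  note d' = d carrier_matD[OF cB] carrier_matD[OF K0] carrier_matD[OF selector_carrier[of q p]]
  have CKB: "C = K0 * selector q p * B"
  proof -
    have "C = C * (B\<^sup>T * B)" unfolding BB using C by simp
    also have "\<dots> = C * B\<^sup>T * B" using d' by (simp add: assoc_mult_mat_dim)
    finally show ?thesis unfolding CB .
  qed
  have detK: "det K0 \<noteq> 0"
  proof -
    have "C * C\<^sup>T = (C * B\<^sup>T) * (C * B\<^sup>T)\<^sup>T"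
      by (simp add: mat_dim_simps d' mult_mat_cancel[OF BB(1)])
    also have "\<dots> = K0 * K0\<^sup>T"
      unfolding CB by (simp add: mat_dim_simps d' mult_mat_cancel[OF selector_orthonormal[OF qp]])
    finally have "det (C * C\<^sup>T) = det K0 * det K0" using K0 by (simp add: det_mult[OF K0] det_transpose[OF K0])
    then show ?thesis using detCC by auto
  qed
  have alt: "R0 *\<^sub>v \<gamma> - r0 = K0 *\<^sub>v (\<theta> \<cdot>\<^sub>v unit_vec q 0)"
  proof -
    have "selector q p *\<^sub>v (B *\<^sub>v \<psi>) = \<theta> \<cdot>\<^sub>v unit_vec q 0"
      using mult_mat_vec_in_carrier[OF cB] k q by (subst selector_mult_vec[OF qp]) (auto simp: B\<psi> k_def unit_vec_def intro!: eq_vecI)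
    moreover have "C *\<^sub>v \<psi> = K0 *\<^sub>v (selector q p *\<^sub>v (B *\<^sub>v \<psi>))"
      using \<psi> by (subst CKB) (simp add: mat_dim_simps d')
    ultimately show ?thesis using C\<psi> by (simp add: \<delta>_def)
  qed
  define A where "A = A0 * B\<^sup>T"
  have A: "A \<in> carrier_mat p p" using A0 cB by (simp add: A_def)
  have detA: "det A \<noteq> 0"
  proof -
    have "det B * det B = 1"
      using det_mult[of "B\<^sup>T" p B] cB BB det_transpose[OF cB] by simp
    then have "det B \<noteq> 0" by auto
    then show ?thesis using detA0 cB A0 by (simp add: A_def det_mult[of _ p] det_transpose[OF cB])
  qed
  have At: "A\<^sup>T = B * A0\<^sup>T" by (simp add: A_def mat_dim_simps d')
  have KA: "K0 * selector q p * A\<^sup>T = Rm"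
  proof -
    have "K0 * selector q p * A\<^sup>T = (K0 * selector q p * B) * A0\<^sup>T" unfolding At by (simp add: mat_dim_simps d')
    then show ?thesis unfolding CKB[symmetric] CA .
  qed
  have "R0 = K0 * selector q (Suc p) * design_factor p \<mu> A"
  proof (rule eq_matI)
    fix a i assume "a < dim_row (K0 * selector q (Suc p) * design_factor p \<mu> A)" "i < dim_col (K0 * selector q (Suc p) * design_factor p \<mu> A)"
    then have ai: "a < q" "i < Suc p" using K0 A by (auto simp: design_factor_def)
    have sel: "(selector q m * T) $$ (b, i) = T $$ (m - q + b, i)" if "b < q" "q \<le> m" "T \<in> carrier_mat m l" "i < l" for b m i l and T :: "real mat"
    proof -
      have "(selector q m * T) $$ (b, i) = (selector q m *\<^sub>v col T i) $ b"
        using that by (simp add: index_mult_mat_vec selector_def)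
      then show ?thesis using that by (simp add: selector_mult_vec)
    qed
    have exp: "(K0 * S) $$ (a, i) = (\<Sum>b\<in>{0..<q}. K0 $$ (a, b) * S $$ (b, i))" if "S \<in> carrier_mat q l" "i < l" for S i l
      using that ai K0 by (simp add: scalar_prod_def)
    have DF: "design_factor p \<mu> A \<in> carrier_mat (Suc p) (Suc p)" using A by simp
    have "(K0 * selector q (Suc p) * design_factor p \<mu> A) $$ (a, i) = (K0 * (selector q (Suc p) * design_factor p \<mu> A)) $$ (a, i)"
      using DF K0 by (subst assoc_mult_mat_dim) (auto simp: selector_def)
    also have "\<dots> = (\<Sum>b\<in>{0..<q}. K0 $$ (a, b) * (selector q (Suc p) * design_factor p \<mu> A) $$ (b, i))"
      by (rule exp[of _ "Suc p"]) (use ai DF in \<open>auto intro!: mult_carrier_mat[of _ q "Suc p"]\<close>)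
    also have "\<dots> = (\<Sum>b\<in>{0..<q}. K0 $$ (a, b) * design_factor p \<mu> A $$ (Suc p - q + b, i))"
      by (intro sum.cong refl) (subst sel[of _ _ _ "Suc p"], use ai DF q in auto)
    also have "\<dots> = (\<Sum>b\<in>{0..<q}. K0 $$ (a, b) * (if i = 0 then 0 else A\<^sup>T $$ (p - q + b, i - 1)))"
      using A ai qp by (intro sum.cong refl) (auto simp: design_factor_def Suc_diff_le)
    also have "\<dots> = R0 $$ (a, i)"
    proof (cases i)
      case 0
      then show ?thesis using R00 ai by simp
    next
      case (Suc l)
      then have l: "l < p" using ai by simp
      have At': "A\<^sup>T \<in> carrier_mat p p" using A by simp
      have "R0 $$ (a, i) = (K0 * selector q p * A\<^sup>T) $$ (a, l)" unfolding KA using ai l Suc by (simp add: Rm_def)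
      also have "\<dots> = (K0 * (selector q p * A\<^sup>T)) $$ (a, l)"
        using A K0 by (subst assoc_mult_mat_dim) (auto simp: selector_def)
      also have "\<dots> = (\<Sum>b\<in>{0..<q}. K0 $$ (a, b) * (selector q p * A\<^sup>T) $$ (b, l))"
        by (rule exp[of _ p]) (use l At' in \<open>auto intro!: mult_carrier_mat[of _ q p]\<close>)
      also have "\<dots> = (\<Sum>b\<in>{0..<q}. K0 $$ (a, b) * A\<^sup>T $$ (p - q + b, l))"
        by (intro sum.cong refl) (subst sel[of _ _ _ p], use l At' qp in auto)
      finally show ?thesis using Suc by simp
    qed
    finally show "R0 $$ (a, i) = (K0 * selector q (Suc p) * design_factor p \<mu> A) $$ (a, i)" ..
  qed (use R0 K0 A in \<open>auto simp: design_factor_def\<close>)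
  then show "\<exists>B K0 \<theta>. gaussian_isometry p B \<and> K0 \<in> carrier_mat q q \<and> det K0 \<noteq> 0 \<and> \<theta> \<ge> 0 \<and>
    det (A0 * B\<^sup>T) \<noteq> 0 \<and> R0 = K0 * selector q (Suc p) * design_factor p \<mu> (A0 * B\<^sup>T) \<and>
    R0 *\<^sub>v \<gamma> - r0 = K0 *\<^sub>v (\<theta> \<cdot>\<^sub>v unit_vec q 0)"
    using B K0 detK \<theta> detA alt unfolding A_def by blast
qed

subsection \<open>The sampling model\<close>

lemma sample_mean_cong: "(\<And>i. i < n \<Longrightarrow> e i = e' i) \<Longrightarrow> sample_mean n e = sample_mean n e'"
  unfolding sample_mean_def by simp

lemma centered_norm_cong: "(\<And>i. i < n \<Longrightarrow> e i = e' i) \<Longrightarrow> centered_norm n e = centered_norm n e'"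
  unfolding centered_norm_def using sample_mean_cong[of n e e'] by simp

lemma centered_norm_scale: "(centered_norm n (\<lambda>i. c * e i))\<^sup>2 = c\<^sup>2 * (centered_norm n e)\<^sup>2"
proof -
  have m: "sample_mean n (\<lambda>i. c * e i) = c * sample_mean n e" by (simp add: sample_mean_def sum_distrib_left)
  have "(centered_norm n (\<lambda>i. c * e i))\<^sup>2 = (\<Sum>i<n. (c * e i - c * sample_mean n e)\<^sup>2)" by (simp add: centered_norm_def m sum_nonneg)
  also have "\<dots> = c\<^sup>2 * (\<Sum>i<n. (e i - sample_mean n e)\<^sup>2)"
    unfolding sum_distrib_left by (simp add: power_mult_distrib flip: right_diff_distrib)
  finally show ?thesis by (simp add: centered_norm_def sum_nonneg)
qed

lemma subalgebra_vimage_algebra: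
  "X \<in> measurable M N \<Longrightarrow> subalgebra M (vimage_algebra (space M) X N)"
  unfolding subalgebra_def by (simp add: sets_image_in_sets)

lemma independent_rv_distr_pair:
  assumes "prob_space M" and ind: "independent_rv M N X N' Y"
  shows "distr M (N \<Otimes>\<^sub>M N') (\<lambda>\<omega>. (X \<omega>, Y \<omega>)) = distr M N X \<Otimes>\<^sub>M distr M N' Y"
proof -
  interpret prob_space M by fact
  have X[measurable]: "X \<in> measurable M N" and Y[measurable]: "Y \<in> measurable M N'"
    and indep: "indep_set (sets (vimage_algebra (space M) X N)) (sets (vimage_algebra (space M) Y N'))"
    using ind by (auto simp: independent_rv_def)
  interpret DX: prob_space "distr M N X" by (rule prob_space_distr) fact
  interpret DY: prob_space "distr M N' Y" by (rule prob_space_distr) fact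
  show ?thesis
  proof (rule pair_measure_eqI[symmetric])
    show "sigma_finite_measure (distr M N X)" "sigma_finite_measure (distr M N' Y)" by unfold_locales
    show "sets (distr M N X \<Otimes>\<^sub>M distr M N' Y) = sets (distr M (N \<Otimes>\<^sub>M N') (\<lambda>\<omega>. (X \<omega>, Y \<omega>)))"
      by (simp cong: sets_pair_measure_cong)
    fix A B assume "A \<in> sets (distr M N X)" "B \<in> sets (distr M N' Y)"
    then have A: "A \<in> sets N" and B: "B \<in> sets N'" by auto
    have "X -` A \<inter> space M \<in> sets (vimage_algebra (space M) X N)" "Y -` B \<inter> space M \<in> sets (vimage_algebra (space M) Y N')"
      using A B by (auto intro: in_vimage_algebra)
    then have "prob ((X -` A \<inter> space M) \<inter> (Y -` B \<inter> space M)) = prob (X -` A \<inter> space M) * prob (Y -` B \<inter> space M)"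
      by (rule indep_setD[OF indep])
    moreover have "(X -` A \<inter> space M) \<inter> (Y -` B \<inter> space M) = (\<lambda>\<omega>. (X \<omega>, Y \<omega>)) -` (A \<times> B) \<inter> space M" by auto
    ultimately show "emeasure (distr M N X) A * emeasure (distr M N' Y) B = emeasure (distr M (N \<Otimes>\<^sub>M N') (\<lambda>\<omega>. (X \<omega>, Y \<omega>))) (A \<times> B)"
      using A B by (simp add: emeasure_distr emeasure_eq_measure ennreal_mult[symmetric])
  qed
qed

text \<open>The map by which \<open>gaussian_vector\<close> produces its law, under a name.\<close>

definition affine_map :: "nat \<Rightarrow> real vec \<Rightarrow> real mat \<Rightarrow> (nat \<Rightarrow> real) \<Rightarrow> nat \<Rightarrow> real" where
  "affine_map p \<mu> A z = (\<lambda>j\<in>{..<p}. (\<mu> + A *\<^sub>v vec p z) $ j)"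

lemma measurable_affine:
  assumes "A \<in> carrier_mat p p" "\<mu> \<in> carrier_vec p"
  shows "affine_map p \<mu> A \<in> measurable (borel_vec p) (borel_vec p)"
proof -
  have eq: "affine_map p \<mu> A = (\<lambda>z. \<lambda>j\<in>{..<p}. \<mu> $ j + act p A z j)"
    unfolding affine_map_def act_def using assms by (intro ext restrict_ext) auto
  have "(\<lambda>z. \<lambda>j\<in>{..<p}. \<mu> $ j + act p A z j) \<in> measurable (borel_vec p) (borel_vec p)"
    by (intro measurable_restrict borel_measurable_add borel_measurable_const
      measurable_compose[OF measurable_act[OF assms(1)] measurable_component_singleton]) auto
  then show ?thesis unfolding eq .
qed

lemma measurable_affine_std_normal:
  assumes "A \<in> carrier_mat p p" "\<mu> \<in> carrier_vec p"
  shows "affine_map p \<mu> A \<in> measurable (std_normal_vec p) (borel_vec p)"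
  using measurable_affine[OF assms] by (simp add: measurable_cong_sets[OF sets_std_normal_PiM refl])

text \<open>This gives the freedom to exchange the square root of \<open>\<Sigma>\<close> that comes
  with \<open>gaussian_vector\<close> for one adapted to the restriction.\<close>

lemma distr_affine_isometry:
  assumes A: "A \<in> carrier_mat p p" and \<mu>: "\<mu> \<in> carrier_vec p" and B: "gaussian_isometry p B"
  shows "distr (std_normal_vec p) (borel_vec p) (affine_map p \<mu> (A * B)) = distr (std_normal_vec p) (borel_vec p) (affine_map p \<mu> A)"
proof -
  have cB: "B \<in> carrier_mat p p" using B by auto
  have mB: "act p B \<in> measurable (std_normal_vec p) (borel_vec p)"
    by (rule measurable_gaussian_isometry(1)[OF B])
  have "affine_map p \<mu> (A * B) = affine_map p \<mu> A \<circ> act p B"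
    using A cB by (auto simp: affine_map_def vec_act[OF cB] assoc_mult_mat_vec_dim fun_eq_iff)
  then have "distr (std_normal_vec p) (borel_vec p) (affine_map p \<mu> (A * B))
    = distr (distr (std_normal_vec p) (borel_vec p) (act p B)) (borel_vec p) (affine_map p \<mu> A)"
    using distr_distr[OF measurable_affine[OF A \<mu>] mB] by simp
  then show ?thesis using B by (simp add: gaussian_isometry_def)
qed

text \<open>The bridge between the two views of the design: \<open>W\<close> lists the standardized
  columns, the result lists the observations.\<close>

definition affine_rows :: "nat \<Rightarrow> nat \<Rightarrow> real vec \<Rightarrow> real mat \<Rightarrow> (nat \<Rightarrow> nat \<Rightarrow> real) \<Rightarrow> nat \<Rightarrow> nat \<Rightarrow> real" where
  "affine_rows n p \<mu> A W = (\<lambda>i\<in>{..<n}. affine_map p \<mu> A (\<lambda>l\<in>{..<p}. W l i))"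

lemma measurable_affine_rows:
  assumes A: "A \<in> carrier_mat p p" and \<mu>: "\<mu> \<in> carrier_vec p"
  shows "affine_rows n p \<mu> A \<in> measurable (PiM {..<p} (\<lambda>_. std_normal_vec n)) (PiM {..<n} (\<lambda>_. borel_vec p))"
proof -
  have "(\<lambda>W. \<lambda>l\<in>{..<p}. W l i) \<in> measurable (PiM {..<p} (\<lambda>_. std_normal_vec n)) (borel_vec p)" if "i < n" for i
    unfolding measurable_cong_sets[OF sets_PiM_std_normal_vec refl]
    using that by (intro measurable_restrict measurable_PiM_borel_vec) auto
  then show ?thesis
    unfolding affine_rows_def[abs_def]
    by (intro measurable_restrict) (rule measurable_compose[OF _ measurable_affine[OF A \<mu>]], blast)
qed

text \<open>Transposition turns independent Gaussian columns into independent Gaussian rows, and the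
  affine map acts on each row separately.\<close>

lemma distr_affine_rows:
  assumes A: "A \<in> carrier_mat p p" and \<mu>: "\<mu> \<in> carrier_vec p"
  shows "distr (PiM {..<p} (\<lambda>_. std_normal_vec n)) (PiM {..<n} (\<lambda>_. borel_vec p)) (affine_rows n p \<mu> A)
    = PiM {..<n} (\<lambda>_. distr (std_normal_vec p) (borel_vec p) (affine_map p \<mu> A))"
proof -
  let ?D = "distr (std_normal_vec p) (borel_vec p) (affine_map p \<mu> A)"
  let ?R = "PiM {..<n} (\<lambda>_. std_normal_vec p)" and ?C = "PiM {..<p} (\<lambda>_. std_normal_vec n)"
  let ?t = "\<lambda>W. \<lambda>i\<in>{..<n}. \<lambda>l\<in>{..<p}. W l i"
  have D: "prob_space ?D" by (rule prob_space.prob_space_distr[OF prob_space_std_normal_vec measurable_affine_std_normal[OF A \<mu>]])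
  have sD: "sets (PiM {..<n} (\<lambda>_. ?D)) = sets (PiM {..<n} (\<lambda>_. borel_vec p))" by (intro sets_PiM_cong) auto
  have ma: "affine_map p \<mu> A \<in> measurable (std_normal_vec p) ?D"
    using measurable_affine_std_normal[OF A \<mu>] by simp
  have mt: "?t \<in> measurable ?C ?R"
    by (intro measurable_restrict measurable_PiM_PiM_component) auto
  have mc: "compose {..<n} (affine_map p \<mu> A) \<in> measurable ?R (PiM {..<n} (\<lambda>_. borel_vec p))"
    unfolding compose_def
    by (intro measurable_restrict measurable_compose[OF measurable_component_singleton[of _ "{..<n}" "\<lambda>_. std_normal_vec p"] measurable_affine_std_normal[OF A \<mu>]])
  have "PiM {..<n} (\<lambda>_. ?D) = PiM {..<n} (\<lambda>_. distr (std_normal_vec p) ?D (affine_map p \<mu> A))"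
    by (intro PiM_cong refl distr_cong) auto
  also have "\<dots> = distr ?R (PiM {..<n} (\<lambda>_. ?D)) (compose {..<n} (affine_map p \<mu> A))"
    by (rule distr_PiM_finite_prob_space'[symmetric]) (auto intro: prob_space_std_normal_vec D ma simp del: measurable_distr_eq2)
  also have "\<dots> = distr ?R (PiM {..<n} (\<lambda>_. borel_vec p)) (compose {..<n} (affine_map p \<mu> A))"
    by (intro distr_cong refl sD)
  also have "?R = distr ?C ?R ?t"
    by (rule distr_PiM_transpose[symmetric, OF prob_space_std_normal_distribution]) auto
  also have "distr (distr ?C ?R ?t) (PiM {..<n} (\<lambda>_. borel_vec p)) (compose {..<n} (affine_map p \<mu> A))
    = distr ?C (PiM {..<n} (\<lambda>_. borel_vec p)) (compose {..<n} (affine_map p \<mu> A) \<circ> ?t)"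
    by (rule distr_distr[OF mc mt])
  also have "compose {..<n} (affine_map p \<mu> A) \<circ> ?t = affine_rows n p \<mu> A"
    by (auto simp: compose_def affine_rows_def fun_eq_iff)
  finally show ?thesis ..
qed

text \<open>The argument \<open>\<lambda>i \<xi>. \<xi> i\<close> is the coordinate process: the
  design itself serves as the sample point.\<close>

lemma regressor_matrix_affine_rows:
  assumes A: "A \<in> carrier_mat p p" and \<mu>: "\<mu> \<in> carrier_vec p"
  shows "regressor_matrix n p (\<lambda>i \<xi>. \<xi> i) (affine_rows n p \<mu> A W) = design n (Suc p) W * design_factor p \<mu> A"
proof (rule eq_matI)
  fix i a assume "i < dim_row (design n (Suc p) W * design_factor p \<mu> A)" "a < dim_col (design n (Suc p) W * design_factor p \<mu> A)"
  then have ia: "i < n" "a < Suc p" using A by (auto simp: design_def design_factor_def)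
  have "(design n (Suc p) W * design_factor p \<mu> A) $$ (i, a) = (\<Sum>b\<in>{0..<Suc p}. design n (Suc p) W $$ (i, b) * design_factor p \<mu> A $$ (b, a))"
    using ia A by (simp add: scalar_prod_def design_def carrier_matD[OF design_factor_carrier])
  also have "\<dots> = design_factor p \<mu> A $$ (0, a) + (\<Sum>b\<in>{0..<p}. W b i * design_factor p \<mu> A $$ (Suc b, a))"
    using ia by (subst sum.atLeast0_lessThan_Suc_shift) (simp add: design_def design_col_def)
  also have "\<dots> = regressor_matrix n p (\<lambda>i \<xi>. \<xi> i) (affine_rows n p \<mu> A W) $$ (i, a)"
  proof (cases a)
    case 0
    then show ?thesis using ia A by (simp add: regressor_matrix_def design_factor_def)
  next
    case (Suc b)
    then have b: "b < p" using ia by simp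
    have "(\<Sum>l\<in>{0..<p}. W l i * design_factor p \<mu> A $$ (Suc l, a)) = (\<Sum>l\<in>{0..<p}. A $$ (b, l) * W l i)"
      using Suc b A by (intro sum.cong refl) (auto simp: design_factor_def)
    also have "\<dots> = (A *\<^sub>v vec p (\<lambda>l\<in>{..<p}. W l i)) $ b"
      using b A by (simp add: scalar_prod_def index_mult_mat_vec)
    finally show ?thesis
      using ia Suc b A \<mu> by (simp add: regressor_matrix_def affine_rows_def affine_map_def) (simp add: design_factor_def mat_of_rows_def)
  qed
  finally show "regressor_matrix n p (\<lambda>i \<xi>. \<xi> i) (affine_rows n p \<mu> A W) $$ (i, a) = (design n (Suc p) W * design_factor p \<mu> A) $$ (i, a)" ..
qed (use A in \<open>auto simp: regressor_matrix_def design_def design_factor_def\<close>)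

lemma regressor_matrix_mult_vCons:
  assumes \<beta>: "\<beta> \<in> carrier_vec p"
  shows "regressor_matrix n p (\<lambda>i \<xi>. \<xi> i) \<xi> *\<^sub>v vCons \<alpha> \<beta> + vec n e = vec n (\<lambda>i. \<alpha> + \<beta> \<bullet> vec p (\<xi> i) + e i)"
proof (rule eq_vecI)
  fix i assume "i < dim_vec (vec n (\<lambda>i. \<alpha> + \<beta> \<bullet> vec p (\<xi> i) + e i))"
  then have i: "i < n" by simp
  have "(regressor_matrix n p (\<lambda>i \<xi>. \<xi> i) \<xi> *\<^sub>v vCons \<alpha> \<beta>) $ i = (\<Sum>a\<in>{0..<Suc p}. (if a = 0 then 1 else \<xi> i (a - 1)) * vCons \<alpha> \<beta> $ a)"
    using i \<beta> by (simp add: regressor_matrix_def scalar_prod_def index_mult_mat_vec)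
  also have "\<dots> = \<alpha> + (\<Sum>a\<in>{0..<p}. \<xi> i a * \<beta> $ a)"
    by (subst sum.atLeast0_lessThan_Suc_shift) simp
  also have "(\<Sum>a\<in>{0..<p}. \<xi> i a * \<beta> $ a) = \<beta> \<bullet> vec p (\<xi> i)"
    by (simp add: scalar_prod_def mult.commute)
  finally show "(regressor_matrix n p (\<lambda>i \<xi>. \<xi> i) \<xi> *\<^sub>v vCons \<alpha> \<beta> + vec n e) $ i = vec n (\<lambda>i. \<alpha> + \<beta> \<bullet> vec p (\<xi> i) + e i) $ i"
    using i by simp
qed simp

section \<open>Conditional moments, independence and moments of the errors in the sampling
  model\<close>

locale homoskedastic_sample =
  fixes M :: "'w measure" and n p :: nat and y :: "nat \<Rightarrow> 'w \<Rightarrow> real" and x :: "nat \<Rightarrow> 'w \<Rightarrow> nat \<Rightarrow> real"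
    and \<alpha> :: real and \<beta> :: "real vec" and \<sigma> :: real
  assumes model: "linear_homoskedastic_model M n p y x \<alpha> \<beta> \<sigma>"
begin

sublocale prob_space M
  using model unfolding linear_homoskedastic_model_def by blast

lemma model_dims: "0 < p" "Suc p < n" "0 < n" "\<beta> \<in> carrier_vec p" "\<sigma> > 0"
proof -
  show "0 < p" "\<beta> \<in> carrier_vec p" "\<sigma> > 0" using model unfolding linear_homoskedastic_model_def by blast+
  have "p < n - 1" using model unfolding linear_homoskedastic_model_def by blast
  then show "Suc p < n" "0 < n" by auto
qed

lemma indep_pairs: "indep_vars (\<lambda>_. borel \<Otimes>\<^sub>M borel_vec p) (\<lambda>i \<omega>. (y i \<omega>, x i \<omega>)) {..<n}"
  using model unfolding linear_homoskedastic_model_def by blast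

lemma measurable_pair: "i < n \<Longrightarrow> (\<lambda>\<omega>. (y i \<omega>, x i \<omega>)) \<in> measurable M (borel \<Otimes>\<^sub>M borel_vec p)"
  using indep_pairs by (auto simp: indep_vars_def2)

lemma measurable_y: "i < n \<Longrightarrow> y i \<in> borel_measurable M"
  using measurable_compose[OF measurable_pair measurable_fst] by simp

lemma measurable_x: "i < n \<Longrightarrow> x i \<in> measurable M (borel_vec p)"
  using measurable_compose[OF measurable_pair measurable_snd] by simp

lemma pair_law:
  "i < n \<Longrightarrow> distr M (borel \<Otimes>\<^sub>M borel_vec p) (\<lambda>\<omega>. (y i \<omega>, x i \<omega>)) = distr M (borel \<Otimes>\<^sub>M borel_vec p) (\<lambda>\<omega>. (y 0 \<omega>, x 0 \<omega>))"
  using model unfolding linear_homoskedastic_model_def by blast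

lemma transport:
  fixes \<phi> :: "real \<times> (nat \<Rightarrow> real) \<Rightarrow> real"
  assumes i: "i < n" and \<phi>: "\<phi> \<in> borel_measurable (borel \<Otimes>\<^sub>M borel_vec p)"
  shows "integrable M (\<lambda>\<omega>. \<phi> (y i \<omega>, x i \<omega>)) \<longleftrightarrow> integrable M (\<lambda>\<omega>. \<phi> (y 0 \<omega>, x 0 \<omega>))"
    and "(\<integral>\<omega>. \<phi> (y i \<omega>, x i \<omega>) \<partial>M) = (\<integral>\<omega>. \<phi> (y 0 \<omega>, x 0 \<omega>) \<partial>M)"
proof -
  let ?N = "borel \<Otimes>\<^sub>M borel_vec p"
  note m = measurable_pair[OF i] measurable_pair[OF model_dims(3)]
  show "integrable M (\<lambda>\<omega>. \<phi> (y i \<omega>, x i \<omega>)) \<longleftrightarrow> integrable M (\<lambda>\<omega>. \<phi> (y 0 \<omega>, x 0 \<omega>))"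
    unfolding integrable_distr_eq[OF m(1) \<phi>, symmetric] integrable_distr_eq[OF m(2) \<phi>, symmetric]
    by (simp only: pair_law[OF i])
  show "(\<integral>\<omega>. \<phi> (y i \<omega>, x i \<omega>) \<partial>M) = (\<integral>\<omega>. \<phi> (y 0 \<omega>, x 0 \<omega>) \<partial>M)"
    unfolding integral_distr[OF m(1) \<phi>, symmetric] integral_distr[OF m(2) \<phi>, symmetric]
    by (simp only: pair_law[OF i])
qed

definition reg :: "(nat \<Rightarrow> real) \<Rightarrow> real" where "reg v = \<alpha> + \<beta> \<bullet> vec p v"

lemma measurable_reg: "reg \<in> borel_measurable (borel_vec p)"
proof -
  have eq: "reg = (\<lambda>v. \<alpha> + (\<Sum>l\<in>{0..<p}. \<beta> $ l * v l))" by (rule ext) (simp add: reg_def scalar_prod_def)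
  have "(\<lambda>v. \<alpha> + (\<Sum>l\<in>{0..<p}. \<beta> $ l * v l)) \<in> borel_measurable (borel_vec p)"
    by (intro borel_measurable_add borel_measurable_const borel_measurable_sum borel_measurable_times measurable_component_singleton) auto
  then show ?thesis unfolding eq .
qed

lemma finite_measure_subalgebra_x: "i < n \<Longrightarrow> finite_measure_subalgebra M (vimage_algebra (space M) (x i) (borel_vec p))"
  by (intro finite_measure_subalgebra.intro finite_measure_subalgebra_axioms.intro subalgebra_vimage_algebra measurable_x) unfold_locales

lemma integrable_y: "integrable M (y 0)"
  using model unfolding linear_homoskedastic_model_def by blast

lemma AE_cond_exp_0: "AE \<omega> in M. real_cond_exp M (vimage_algebra (space M) (x 0) (borel_vec p)) (y 0) \<omega> = reg (x 0 \<omega>)"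
  using model unfolding linear_homoskedastic_model_def cond_expectation_def reg_def by blast

lemma integrable_reg_0: "integrable M (\<lambda>\<omega>. reg (x 0 \<omega>))" "(\<integral>\<omega>. reg (x 0 \<omega>) \<partial>M) = (\<integral>\<omega>. y 0 \<omega> \<partial>M)"
proof -
  interpret S: finite_measure_subalgebra M "vimage_algebra (space M) (x 0) (borel_vec p)"
    by (rule finite_measure_subalgebra_x[OF model_dims(3)])
  have m: "(\<lambda>\<omega>. reg (x 0 \<omega>)) \<in> borel_measurable M"
    by (rule measurable_compose[OF measurable_x[OF model_dims(3)] measurable_reg])
  show "integrable M (\<lambda>\<omega>. reg (x 0 \<omega>))"
    using S.real_cond_exp_int(1)[OF integrable_y] AE_cond_exp_0 m
    by (subst integrable_cong_AE[symmetric]) (auto intro: borel_measurable_integrable)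
  show "(\<integral>\<omega>. reg (x 0 \<omega>) \<partial>M) = (\<integral>\<omega>. y 0 \<omega> \<partial>M)"
    using S.real_cond_exp_int[OF integrable_y] AE_cond_exp_0 m
    by (subst (asm) integral_cong_AE[of _ _ "\<lambda>\<omega>. reg (x 0 \<omega>)"]) (auto intro: borel_measurable_integrable)
qed

text \<open>The model prescribes the conditional mean of the first pair only. Every event generated
  by \<open>x i\<close> is the preimage of a set \<open>B\<close>, so the integrals that
  characterize conditional expectation depend only on the law of the pair and carry over from index
  0.\<close>

lemma AE_cond_exp:
  assumes i: "i < n"
  shows "AE \<omega> in M. real_cond_exp M (vimage_algebra (space M) (x i) (borel_vec p)) (y i) \<omega> = reg (x i \<omega>)"
proof -
  interpret S: finite_measure_subalgebra M "vimage_algebra (space M) (x i) (borel_vec p)"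
    by (rule finite_measure_subalgebra_x[OF i])
  interpret S0: finite_measure_subalgebra M "vimage_algebra (space M) (x 0) (borel_vec p)"
    by (rule finite_measure_subalgebra_x[OF model_dims(3)])
  have mreg: "(\<lambda>z. reg (snd z)) \<in> borel_measurable (borel \<Otimes>\<^sub>M borel_vec p)"
    by (rule measurable_compose[OF measurable_snd measurable_reg])
  show ?thesis
  proof (rule S.real_cond_exp_charact)
    show "integrable M (y i)" using transport(1)[OF i, of fst] integrable_y by simp
    show "integrable M (\<lambda>\<omega>. reg (x i \<omega>))" using transport(1)[OF i mreg] integrable_reg_0 by simp
    have "x i \<in> measurable (vimage_algebra (space M) (x i) (borel_vec p)) (borel_vec p)"
      by (rule measurable_vimage_algebra1) (use measurable_space[OF measurable_x[OF i]] in auto)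
    then show "(\<lambda>\<omega>. reg (x i \<omega>)) \<in> borel_measurable (vimage_algebra (space M) (x i) (borel_vec p))"
      by (rule measurable_compose[OF _ measurable_reg])
    fix A assume "A \<in> sets (vimage_algebra (space M) (x i) (borel_vec p))"
    then obtain B where B: "B \<in> sets (borel_vec p)" and A: "A = x i -` B \<inter> space M"
      using sets_vimage_algebra2[of "x i" "space M" "borel_vec p"] measurable_space[OF measurable_x[OF i]] by auto
    have iB: "(\<lambda>z. indicator B (snd z) :: real) \<in> borel_measurable (borel \<Otimes>\<^sub>M borel_vec p)"
      using B by measurable
    have m1: "(\<lambda>z. indicator B (snd z) * fst z :: real) \<in> borel_measurable (borel \<Otimes>\<^sub>M borel_vec p)"
      using iB by (intro borel_measurable_times) auto
    have m2: "(\<lambda>z. indicator B (snd z) * reg (snd z) :: real) \<in> borel_measurable (borel \<Otimes>\<^sub>M borel_vec p)"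
      using iB mreg by (intro borel_measurable_times) auto
    define A0 where "A0 = x 0 -` B \<inter> space M"
    have A0: "A0 \<in> sets (vimage_algebra (space M) (x 0) (borel_vec p))"
      unfolding A0_def using B by (rule in_vimage_algebra)
    have ind: "set_lebesgue_integral M (x l -` B \<inter> space M) f = (\<integral>\<omega>. indicator B (x l \<omega>) * f \<omega> \<partial>M)" for f :: "'w \<Rightarrow> real" and l
      unfolding set_lebesgue_integral_def by (intro Bochner_Integration.integral_cong) (auto simp: indicator_def)
    have "(\<integral>\<omega>\<in>A. y i \<omega> \<partial>M) = (\<integral>\<omega>\<in>A0. y 0 \<omega> \<partial>M)"
      unfolding A A0_def ind using transport(2)[OF i m1] by simp
    also have "\<dots> = (\<integral>\<omega>\<in>A0. real_cond_exp M (vimage_algebra (space M) (x 0) (borel_vec p)) (y 0) \<omega> \<partial>M)"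
      by (rule S0.real_cond_exp_intA[OF integrable_y A0])
    also have "\<dots> = (\<integral>\<omega>\<in>A0. reg (x 0 \<omega>) \<partial>M)"
      unfolding A0_def ind
    proof (rule integral_cong_AE)
      have "(\<lambda>\<omega>. indicator B (x 0 \<omega>) :: real) \<in> borel_measurable M"
        using measurable_compose[OF measurable_x[OF model_dims(3)], of "indicator B :: _ \<Rightarrow> real"] B by auto
      then show "(\<lambda>\<omega>. indicator B (x 0 \<omega>) * real_cond_exp M (vimage_algebra (space M) (x 0) (borel_vec p)) (y 0) \<omega>) \<in> borel_measurable M"
        "(\<lambda>\<omega>. indicator B (x 0 \<omega>) * reg (x 0 \<omega>)) \<in> borel_measurable M"
        using measurable_compose[OF measurable_x[OF model_dims(3)] measurable_reg] by (auto intro!: borel_measurable_times)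
    qed (use AE_cond_exp_0 in auto)
    also have "\<dots> = (\<integral>\<omega>\<in>A. reg (x i \<omega>) \<partial>M)"
      unfolding A A0_def ind using transport(2)[OF i m2] by simp
    finally show "(\<integral>\<omega>\<in>A. y i \<omega> \<partial>M) = (\<integral>\<omega>\<in>A. reg (x i \<omega>) \<partial>M)" .
  qed
qed

lemma AE_model_error: "i < n \<Longrightarrow> AE \<omega> in M. model_error M p (x i) (y i) \<omega> = y i \<omega> - reg (x i \<omega>)"
  using AE_cond_exp[of i] by (auto simp: model_error_def cond_expectation_def)

text \<open>\<open>model_error\<close> rests on a version of the conditional expectation for each
  \<open>i\<close>, identified only almost everywhere. \<open>err\<close> is one explicit function
  of the pair for all \<open>i\<close>, so independence is immediate; it is scaled to variance
  1.\<close>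

definition err :: "nat \<Rightarrow> 'w \<Rightarrow> real" where "err i \<omega> = (y i \<omega> - reg (x i \<omega>)) / \<sigma>"

lemma err_map: "(\<lambda>z. (fst z - reg (snd z)) / \<sigma>) \<in> borel_measurable (borel \<Otimes>\<^sub>M borel_vec p)"
  using measurable_compose[OF measurable_snd measurable_reg] by (intro borel_measurable_divide borel_measurable_diff) auto

lemma indep_err: "indep_vars (\<lambda>_. borel) err {..<n}"
  using indep_vars_compose2[OF indep_pairs, of "\<lambda>_ z. (fst z - reg (snd z)) / \<sigma>" "\<lambda>_. borel"] err_map
  by (simp add: err_def[abs_def])

lemma err_moments:
  assumes i: "i < n" and int4: "integrable M (\<lambda>\<omega>. (model_error M p (x 0) (y 0) \<omega> / \<sigma>) ^ 4)"
  shows "expectation (err i) = 0" "expectation (\<lambda>\<omega>. (err i \<omega>)\<^sup>2) = 1" "integrable M (\<lambda>\<omega>. (err i \<omega>) ^ 4)"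
    "expectation (\<lambda>\<omega>. (err i \<omega>) ^ 4) = (\<integral>\<omega>. (model_error M p (x 0) (y 0) \<omega> / \<sigma>) ^ 4 \<partial>M)"
proof -
  note n0 = model_dims(3) and s = model_dims(5)
  have T: "(\<integral>\<omega>. (err i \<omega>) ^ k \<partial>M) = (\<integral>\<omega>. (err 0 \<omega>) ^ k \<partial>M)" "integrable M (\<lambda>\<omega>. (err i \<omega>) ^ k) \<longleftrightarrow> integrable M (\<lambda>\<omega>. (err 0 \<omega>) ^ k)" for k
    using transport[OF i, of "\<lambda>z. ((fst z - reg (snd z)) / \<sigma>) ^ k"] err_map by (auto simp: err_def)
  have me: "err 0 \<in> borel_measurable M" using indep_err n0 by (auto simp: indep_vars_def2)
  have ae: "AE \<omega> in M. model_error M p (x 0) (y 0) \<omega> / \<sigma> = err 0 \<omega>"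
    using AE_model_error[OF n0] by eventually_elim (simp add: err_def)
  have mm: "model_error M p (x 0) (y 0) \<in> borel_measurable M"
    unfolding model_error_def[abs_def] cond_expectation_def using measurable_y[OF n0] by auto
  have ae4: "AE \<omega> in M. (model_error M p (x 0) (y 0) \<omega> / \<sigma>) ^ 4 = (err 0 \<omega>) ^ 4" using ae by eventually_elim simp
  have int04: "integrable M (\<lambda>\<omega>. (err 0 \<omega>) ^ 4)"
    using int4 by (subst integrable_cong_AE[of _ _ "\<lambda>\<omega>. (model_error M p (x 0) (y 0) \<omega> / \<sigma>) ^ 4"]) (use ae4 me mm in auto)
  then show "integrable M (\<lambda>\<omega>. (err i \<omega>) ^ 4)" using T(2) by simp
  show "expectation (\<lambda>\<omega>. (err i \<omega>) ^ 4) = (\<integral>\<omega>. (model_error M p (x 0) (y 0) \<omega> / \<sigma>) ^ 4 \<partial>M)"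
    unfolding T(1) by (rule integral_cong_AE) (use ae4 me mm in auto)
  have "expectation (err i) = expectation (err 0)" using T(1)[of 1] by simp
  also have "\<dots> = 0"
    unfolding err_def using integrable_y integrable_reg_0 by simp
  finally show "expectation (err i) = 0" .
  \<comment> \<open>Square integrability is taken from the fourth moment; it is what turns the
    conditional variance into an unconditional second moment.\<close>
  have int2: "integrable M (\<lambda>\<omega>. (err 0 \<omega>)\<^sup>2)"
  proof (rule square_integrable_imp_integrable)
    show "integrable M (\<lambda>\<omega>. ((err 0 \<omega>)\<^sup>2)\<^sup>2)" using int04 by (simp flip: power_mult)
  qed (use me in simp)
  have ae2: "AE \<omega> in M. (model_error M p (x 0) (y 0) \<omega>)\<^sup>2 = \<sigma>\<^sup>2 * (err 0 \<omega>)\<^sup>2"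
    using ae
  proof eventually_elim
    case (elim \<omega>)
    then have "model_error M p (x 0) (y 0) \<omega> = \<sigma> * err 0 \<omega>" using s by (simp add: field_simps)
    then show ?case by (simp add: power_mult_distrib)
  qed
  have intm: "integrable M (\<lambda>\<omega>. (model_error M p (x 0) (y 0) \<omega>)\<^sup>2)"
    using int2 by (subst integrable_cong_AE[of _ _ "\<lambda>\<omega>. \<sigma>\<^sup>2 * (err 0 \<omega>)\<^sup>2"]) (use ae2 me mm in auto)
  interpret S0: finite_measure_subalgebra M "vimage_algebra (space M) (x 0) (borel_vec p)"
    by (rule finite_measure_subalgebra_x[OF n0])
  have "AE \<omega> in M. real_cond_exp M (vimage_algebra (space M) (x 0) (borel_vec p)) (\<lambda>\<omega>. (model_error M p (x 0) (y 0) \<omega>)\<^sup>2) \<omega> = \<sigma>\<^sup>2"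
    using model unfolding linear_homoskedastic_model_def cond_variance_def cond_expectation_def by blast
  then have "(\<integral>\<omega>. real_cond_exp M (vimage_algebra (space M) (x 0) (borel_vec p)) (\<lambda>\<omega>. (model_error M p (x 0) (y 0) \<omega>)\<^sup>2) \<omega> \<partial>M) = (\<integral>\<omega>. \<sigma>\<^sup>2 \<partial>M)"
    by (intro integral_cong_AE) auto
  then have "(\<integral>\<omega>. (model_error M p (x 0) (y 0) \<omega>)\<^sup>2 \<partial>M) = \<sigma>\<^sup>2"
    by (simp add: S0.real_cond_exp_int(2)[OF intm] prob_space)
  also have "(\<integral>\<omega>. (model_error M p (x 0) (y 0) \<omega>)\<^sup>2 \<partial>M) = (\<integral>\<omega>. \<sigma>\<^sup>2 * (err 0 \<omega>)\<^sup>2 \<partial>M)"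
    by (rule integral_cong_AE) (use ae2 me mm in auto)
  finally have "\<sigma>\<^sup>2 * expectation (\<lambda>\<omega>. (err 0 \<omega>)\<^sup>2) = \<sigma>\<^sup>2 * 1" by simp
  then show "expectation (\<lambda>\<omega>. (err i \<omega>)\<^sup>2) = 1" unfolding T(1) using s by (subst (asm) mult_cancel_left) auto
qed

end

lemma measurable_mat_compose:
  assumes f: "f \<in> measurable N M" and A: "measurable_mat M n k A"
  shows "measurable_mat N n k (\<lambda>\<omega>. A (f \<omega>))"
  unfolding measurable_mat_def
proof (intro conjI ballI allI impI)
  fix i j assume "i < n" "j < k"
  then show "(\<lambda>\<omega>. A (f \<omega>) $$ (i, j)) \<in> borel_measurable N"
    using A unfolding measurable_mat_def by (intro measurable_compose[OF f]) blast
next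
  fix \<omega> assume "\<omega> \<in> space N"
  then show "A (f \<omega>) \<in> carrier_mat n k"
    using A measurable_space[OF f] by (simp add: measurable_mat_def)
qed

lemma measurable_regressor_matrix:
  "measurable_mat (PiM {..<n} (\<lambda>_. borel_vec p)) n (Suc p) (regressor_matrix n p (\<lambda>i \<xi>. \<xi> i))"
  unfolding measurable_mat_def
proof (intro conjI ballI allI impI)
  fix i a assume ia: "i < n" "a < Suc p"
  show "(\<lambda>\<xi>. regressor_matrix n p (\<lambda>i \<xi>. \<xi> i) \<xi> $$ (i, a)) \<in> borel_measurable (PiM {..<n} (\<lambda>_. borel_vec p))"
    using ia by (cases a) (auto simp: regressor_matrix_def intro!: measurable_PiM_borel_vec)
qed (simp add: regressor_matrix_def)

context homoskedastic_sample
begin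

text \<open>The statistic as a function of the design and the errors, the form in which the
  independence of the two can be exploited.\<close>

definition sample_F :: "real mat \<Rightarrow> real vec \<Rightarrow> (nat \<Rightarrow> nat \<Rightarrow> real) \<Rightarrow> (nat \<Rightarrow> real) \<Rightarrow> real" where
  "sample_F R0 r0 \<xi> e = F_statistic (regressor_matrix n p (\<lambda>i \<xi>. \<xi> i) \<xi>) (vec n (\<lambda>i. reg (\<xi> i) + e i)) R0 r0"

lemma measurable_sample_F:
  assumes R0: "R0 \<in> carrier_mat q (Suc p)" "r0 \<in> carrier_vec q"
  shows "(\<lambda>(\<xi>, e). sample_F R0 r0 \<xi> e) \<in> borel_measurable (PiM {..<n} (\<lambda>_. borel_vec p) \<Otimes>\<^sub>M borel_vec n)"
  unfolding sample_F_def case_prod_beta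
proof (rule measurable_F_statistic[OF _ _ R0])
  let ?M = "PiM {..<n} (\<lambda>_. borel_vec p) \<Otimes>\<^sub>M borel_vec n"
  show "measurable_mat ?M n (Suc p) (\<lambda>x. regressor_matrix n p (\<lambda>i \<xi>. \<xi> i) (fst x))"
    by (rule measurable_mat_compose[OF measurable_fst measurable_regressor_matrix])
  show "measurable_vec ?M n (\<lambda>x. vec n (\<lambda>i. reg (fst x i) + snd x i))"
    unfolding measurable_vec_def
  proof (intro conjI ballI allI impI)
    fix i assume i: "i < n"
    have "(\<lambda>x. fst x i) \<in> measurable ?M (borel_vec p)"
      by (rule measurable_compose[OF measurable_fst measurable_component_singleton[of i "{..<n}" "\<lambda>_. borel_vec p"]])
        (use i in simp)
    then have "(\<lambda>x. reg (fst x i)) \<in> borel_measurable ?M" by (rule measurable_compose[OF _ measurable_reg])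
    moreover have "(\<lambda>x. snd x i) \<in> borel_measurable ?M"
      by (rule measurable_compose[OF measurable_snd measurable_component_singleton[of i "{..<n}" "\<lambda>_. borel"]])
        (use i in simp)
    ultimately show "(\<lambda>x. vec n (\<lambda>i. reg (fst x i) + snd x i) $ i) \<in> borel_measurable ?M" using i by simp
  qed simp
qed

lemma distr_design:
  "distr M (PiM {..<n} (\<lambda>_. borel_vec p)) (\<lambda>\<omega>. \<lambda>i\<in>{..<n}. x i \<omega>) = PiM {..<n} (\<lambda>_. distr M (borel_vec p) (x 0))"
proof -
  have ind: "indep_vars (\<lambda>_. borel_vec p) x {..<n}"
    using indep_vars_compose2[OF indep_pairs, of "\<lambda>_. snd" "\<lambda>_. borel_vec p"] by simp
  have law: "distr M (borel_vec p) (x i) = distr M (borel_vec p) (x 0)" if i: "i < n" for i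
  proof -
    have d: "distr M (borel_vec p) (x l) = distr (distr M (borel \<Otimes>\<^sub>M borel_vec p) (\<lambda>\<omega>. (y l \<omega>, x l \<omega>))) (borel_vec p) snd" if "l < n" for l
      unfolding distr_distr[OF measurable_snd measurable_pair[OF that]] by (simp only: comp_def snd_conv)
    show ?thesis unfolding d[OF i] d[OF model_dims(3)] by (simp only: pair_law[OF i])
  qed
  have "distr M (PiM {..<n} (\<lambda>_. borel_vec p)) (\<lambda>\<omega>. \<lambda>i\<in>{..<n}. x i \<omega>) = PiM {..<n} (\<lambda>i. distr M (borel_vec p) (x i))"
  proof -
    have ne: "{..<n} \<noteq> {}" using model_dims(3) by auto
    have rv: "random_variable (borel_vec p) (x i)" if "i \<in> {..<n}" for i using measurable_x that by simp
    show ?thesis by (rule iffD1[OF indep_vars_iff_distr_eq_PiM'[where M'="\<lambda>_. borel_vec p" and X=x, OF ne rv] ind])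
  qed
  also have "\<dots> = PiM {..<n} (\<lambda>_. distr M (borel_vec p) (x 0))"
    by (intro PiM_cong refl law) (simp only: lessThan_iff)
  finally show ?thesis .
qed

lemma AE_F_statistic_sample:
  "AE \<omega> in M. F_statistic (regressor_matrix n p x \<omega>) (vec n (\<lambda>i. y i \<omega>)) R0 r0 =
     sample_F R0 r0 (\<lambda>i\<in>{..<n}. x i \<omega>) (\<lambda>i\<in>{..<n}. model_error M p (x i) (y i) \<omega>)"
proof -
  have "AE \<omega> in M. \<forall>i\<in>{..<n}. model_error M p (x i) (y i) \<omega> = y i \<omega> - reg (x i \<omega>)"
    by (rule AE_finite_allI) (auto intro: AE_model_error)
  then show ?thesis
  proof eventually_elim
    case (elim \<omega>)
    have 1: "regressor_matrix n p (\<lambda>i \<xi>. \<xi> i) (\<lambda>i\<in>{..<n}. x i \<omega>) = regressor_matrix n p x \<omega>"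
      by (intro eq_matI) (auto simp: regressor_matrix_def)
    have 2: "vec n (\<lambda>i. reg ((\<lambda>i\<in>{..<n}. x i \<omega>) i) + (\<lambda>i\<in>{..<n}. model_error M p (x i) (y i) \<omega>) i) = vec n (\<lambda>i. y i \<omega>)"
      using elim by (intro eq_vecI) auto
    show ?case unfolding sample_F_def 1 2 ..
  qed
qed

lemma centered_norm_errors_concentration:
  fixes K \<tau> :: real
  assumes int4: "integrable M (\<lambda>\<omega>. (model_error M p (x 0) (y 0) \<omega> / \<sigma>) ^ 4)"
    and K: "(\<integral>\<omega>. (model_error M p (x 0) (y 0) \<omega> / \<sigma>) ^ 4 \<partial>M) \<le> K"
    and tau: "\<tau> > 0" "\<tau> \<le> 1 / 2" "real n * \<tau> \<ge> 4"
    and E: "(\<lambda>\<omega>. \<lambda>i\<in>{..<n}. model_error M p (x i) (y i) \<omega>) \<in> measurable M (borel_vec n)"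
  shows "prob {\<omega> \<in> space M. \<bar>(centered_norm n (\<lambda>i\<in>{..<n}. model_error M p (x i) (y i) \<omega>))\<^sup>2 / (real (n - 1) * \<sigma>\<^sup>2) - 1\<bar> > \<tau>}
    \<le> (16 * K + 4) / (real n * \<tau>\<^sup>2)"
proof -
  have "AE \<omega> in M. \<forall>i\<in>{..<n}. model_error M p (x i) (y i) \<omega> = y i \<omega> - reg (x i \<omega>)"
    by (rule AE_finite_allI) (auto intro: AE_model_error)
  then have ae: "AE \<omega> in M. (centered_norm n (\<lambda>i\<in>{..<n}. model_error M p (x i) (y i) \<omega>))\<^sup>2 / (real (n - 1) * \<sigma>\<^sup>2) = (centered_norm n (\<lambda>i. err i \<omega>))\<^sup>2 / real (n - 1)"
  proof eventually_elim
    case (elim \<omega>)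
    have "centered_norm n (\<lambda>i\<in>{..<n}. model_error M p (x i) (y i) \<omega>) = centered_norm n (\<lambda>i. \<sigma> * err i \<omega>)"
      using elim model_dims(5) by (intro centered_norm_cong) (auto simp: err_def)
    then show ?case using model_dims(5) by (simp add: centered_norm_scale)
  qed
  have m1: "(\<lambda>\<omega>. centered_norm n (\<lambda>i\<in>{..<n}. model_error M p (x i) (y i) \<omega>)) \<in> borel_measurable M"
    by (rule measurable_compose[OF E measurable_centered_norm])
  have me: "err i \<in> borel_measurable M" if "i < n" for i using indep_err that by (auto simp: indep_vars_def2)
  have "(\<lambda>\<omega>. \<lambda>i\<in>{..<n}. err i \<omega>) \<in> measurable M (borel_vec n)"
    by (rule measurable_restrict) (use me in simp)
  then have "(\<lambda>\<omega>. centered_norm n (\<lambda>i\<in>{..<n}. err i \<omega>)) \<in> borel_measurable M"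
    by (rule measurable_compose[OF _ measurable_centered_norm])
  moreover have "centered_norm n (\<lambda>i\<in>{..<n}. err i \<omega>) = centered_norm n (\<lambda>i. err i \<omega>)" for \<omega>
    by (rule centered_norm_cong) simp
  ultimately have m2: "(\<lambda>\<omega>. centered_norm n (\<lambda>i. err i \<omega>)) \<in> borel_measurable M" by simp
  have "prob {\<omega> \<in> space M. \<bar>(centered_norm n (\<lambda>i\<in>{..<n}. model_error M p (x i) (y i) \<omega>))\<^sup>2 / (real (n - 1) * \<sigma>\<^sup>2) - 1\<bar> > \<tau>}
    = prob {\<omega> \<in> space M. \<bar>(centered_norm n (\<lambda>i. err i \<omega>))\<^sup>2 / real (n - 1) - 1\<bar> > \<tau>}"
  proof (rule measure_eq_AE)
    show "AE \<omega> in M. \<omega> \<in> {\<omega> \<in> space M. \<bar>(centered_norm n (\<lambda>i\<in>{..<n}. model_error M p (x i) (y i) \<omega>))\<^sup>2 / (real (n - 1) * \<sigma>\<^sup>2) - 1\<bar> > \<tau>}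
      \<longleftrightarrow> \<omega> \<in> {\<omega> \<in> space M. \<bar>(centered_norm n (\<lambda>i. err i \<omega>))\<^sup>2 / real (n - 1) - 1\<bar> > \<tau>}"
      using ae by eventually_elim simp
  qed (use m1 m2 in measurable)
  also have "\<dots> \<le> (16 * K + 4) / (real n * \<tau>\<^sup>2)"
    by (rule centered_norm_concentration[OF indep_err]) (use err_moments[OF _ int4] K tau in auto)
  finally show ?thesis .
qed

text \<open>By independence the errors are frozen, and \<open>stat_prob_bound\<close> is applied to
  every value whose centered norm is close to its typical size. The last term bounds the probability
  of the other values.\<close>

lemma F_statistic_noncentral_bound:
  fixes q :: nat and R0 :: "real mat" and r0 \<mu> :: "real vec" and \<Sigma> :: "real mat" and L :: "real measure" and \<tau> \<delta> K t :: real
  defines "\<Delta> \<equiv> Delta_gamma (second_moment_matrix p \<mu> \<Sigma>) R0 r0 (vCons \<alpha> \<beta>) \<sigma>"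
  assumes pos: "positive_definite p \<Sigma>"
    and gauss: "gaussian_vector M p (x 0) \<mu> \<Sigma>"
    and indep: "independent_rv M (PiM {..<n} (\<lambda>_. borel_vec p)) (\<lambda>\<omega>. \<lambda>i\<in>{..<n}. x i \<omega>)
        (borel_vec n) (\<lambda>\<omega>. \<lambda>i\<in>{..<n}. model_error M p (x i) (y i) \<omega>)"
    and int4: "integrable M (\<lambda>\<omega>. (model_error M p (x 0) (y 0) \<omega> / \<sigma>) ^ 4)"
    and K: "(\<integral>\<omega>. (model_error M p (x 0) (y 0) \<omega> / \<sigma>) ^ 4 \<partial>M) \<le> K"
    and q: "1 \<le> q" "q \<le> Suc p"
    and R0: "R0 \<in> carrier_mat q (Suc p)" "R0 * R0\<^sup>T = 1\<^sub>m q" "col R0 0 = 0\<^sub>v q" and r0: "r0 \<in> carrier_vec q"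
    and L: "noncentral_F q (n - p - 1) (\<Delta> * real (n - p - 1 + q)) L"
    and tau: "\<tau> > 0" "\<tau> \<le> 1 / 2" "real n * \<tau> \<ge> 4" "\<delta> > 0" "7 * \<tau> * sqrt (\<Delta> * real n) \<le> \<delta>"
  shows "\<bar>measure M {\<omega> \<in> space M. F_statistic (regressor_matrix n p x \<omega>) (vec n (\<lambda>i. y i \<omega>)) R0 r0 \<le> t} - measure L {..t}\<bar>
    \<le> 2 / (real (n - p) * \<tau>\<^sup>2) + 2 / (real (n - 1) * \<tau>\<^sup>2) + 2 * \<delta> + (16 * K + 4) / (real n * \<tau>\<^sup>2)"
proof -
  obtain A0 where \<mu>: "\<mu> \<in> carrier_vec p" and A0: "A0 \<in> carrier_mat p p" "A0 * A0\<^sup>T = \<Sigma>"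
    and law0: "distr M (borel_vec p) (x 0) = distr (std_normal_vec p) (borel_vec p) (affine_map p \<mu> A0)"
    using gauss unfolding gaussian_vector_def affine_map_def[abs_def] by blast
  have \<gamma>: "vCons \<alpha> \<beta> \<in> carrier_vec (Suc p)" using model_dims by simp
  note dec = restriction_decomposition[OF pos A0 R0(1,2,3) q r0 \<gamma> \<mu>]
  obtain B K0 \<theta> where B: "gaussian_isometry p B" and K0: "K0 \<in> carrier_mat q q" "det K0 \<noteq> 0" and th: "\<theta> \<ge> 0"
    and detA: "det (A0 * B\<^sup>T) \<noteq> 0" and R0eq: "R0 = K0 * selector q (Suc p) * design_factor p \<mu> (A0 * B\<^sup>T)"
    and alt: "R0 *\<^sub>v vCons \<alpha> \<beta> - r0 = K0 *\<^sub>v (\<theta> \<cdot>\<^sub>v unit_vec q 0)"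
    using dec(1) by blast
  have cB: "B \<in> carrier_mat p p" using B by auto
  \<comment> \<open>Another square root of \<open>\<Sigma>\<close>, rotated so that the restriction
    has the form demanded by \<open>tested_regression\<close>.\<close>
  define A where "A = A0 * B\<^sup>T"
  have A: "A \<in> carrier_mat p p" using A0 cB by (simp add: A_def)
  define TA where "TA = design_factor p \<mu> A"
  have TA: "TA \<in> carrier_mat (Suc p) (Suc p)" "det TA \<noteq> 0"
    using A detA by (simp_all add: TA_def det_design_factor A_def)
  interpret T: tested_regression n p q K0 TA R0 "vCons \<alpha> \<beta>" r0 \<theta>
    by unfold_locales (use q dec(2) model_dims K0 TA \<gamma> r0 R0eq alt in \<open>simp_all add: TA_def A_def\<close>)
  have AA: "A * A\<^sup>T = \<Sigma>"
  proof -
    have "A * A\<^sup>T = A0 * A0\<^sup>T"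
      using A0(1) cB by (simp add: A_def mat_dim_simps mult_mat_cancel[OF gaussian_isometry_inverse(1)[OF B]])
    then show ?thesis using A0 by simp
  qed
  have "\<Delta> = \<theta>\<^sup>2 / \<sigma>\<^sup>2"
    unfolding \<Delta>_def AA[symmetric] second_moment_matrix_factor[OF \<mu> A] TA_def[symmetric] T.R0
    by (rule Delta_gamma_eq[OF K0 TA]) (use q T.alternative[unfolded T.R0] in auto)
  then have D0: "\<Delta> \<ge> 0" and theta: "\<theta> = \<sigma> * sqrt \<Delta>"
    using th model_dims(5) by (simp_all add: real_sqrt_divide)
  define PX where "PX = PiM {..<n} (\<lambda>_. borel_vec p)"
  define X where "X = (\<lambda>\<omega>. \<lambda>i\<in>{..<n}. x i \<omega>)"
  define E where "E = (\<lambda>\<omega>. \<lambda>i\<in>{..<n}. model_error M p (x i) (y i) \<omega>)"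
  have X: "X \<in> measurable M PX" and E: "E \<in> measurable M (borel_vec n)"
    and joint: "distr M (PX \<Otimes>\<^sub>M borel_vec n) (\<lambda>\<omega>. (X \<omega>, E \<omega>)) = distr M PX X \<Otimes>\<^sub>M distr M (borel_vec n) E"
    using indep independent_rv_distr_pair[OF prob_space_axioms indep]
    by (simp_all add: independent_rv_def X_def E_def PX_def)
  define DX where "DX = distr M PX X"
  define DE where "DE = distr M (borel_vec n) E"
  interpret DX: prob_space DX unfolding DX_def by (rule prob_space_distr[OF X])
  interpret DE: prob_space DE unfolding DE_def by (rule prob_space_distr[OF E])
  interpret PP: pair_prob_space DX DE ..
  have mrow: "affine_rows n p \<mu> A \<in> measurable T.design_law PX"
    unfolding PX_def by (rule measurable_affine_rows[OF A \<mu>])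
  \<comment> \<open>The observed rows are realized as an image of the columnwise Gaussian design;
    exchanging the square root does not affect the law of a row.\<close>
  have DX: "DX = distr T.design_law PX (affine_rows n p \<mu> A)"
  proof -
    have "DX = PiM {..<n} (\<lambda>_. distr (std_normal_vec p) (borel_vec p) (affine_map p \<mu> A))"
      unfolding DX_def X_def PX_def distr_design law0 A_def
      by (simp only: distr_affine_isometry[OF A0(1) \<mu> gaussian_isometry_transpose[OF B]])
    then show ?thesis unfolding PX_def distr_affine_rows[OF A \<mu>] .
  qed
  let ?F = "sample_F R0 r0"
  have mF: "(\<lambda>(\<xi>, e). ?F \<xi> e) \<in> borel_measurable (PX \<Otimes>\<^sub>M borel_vec n)"
    unfolding PX_def by (rule measurable_sample_F[OF R0(1) r0])
  have stat: "?F (affine_rows n p \<mu> A W) e = T.stat W e" for W e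
    unfolding T.stat_def unfolding TA_def regressor_matrix_affine_rows[OF A \<mu>, symmetric]
      regressor_matrix_mult_vCons[OF model_dims(4)] sample_F_def reg_def ..
  define S where "S = {z \<in> space (PX \<Otimes>\<^sub>M borel_vec n). ?F (fst z) (snd z) \<le> t}"
  have S: "S \<in> sets (PX \<Otimes>\<^sub>M borel_vec n)" unfolding S_def using mF by (simp add: case_prod_beta)
  have SD: "S \<in> sets (DX \<Otimes>\<^sub>M DE)"
    using S by (simp add: DX_def DE_def cong: sets_pair_measure_cong)
  have XE: "(\<lambda>\<omega>. (X \<omega>, E \<omega>)) \<in> measurable M (PX \<Otimes>\<^sub>M borel_vec n)" using X E by simp
  have mFw: "(\<lambda>\<omega>. ?F (X \<omega>) (E \<omega>)) \<in> borel_measurable M"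
    using measurable_compose[OF XE mF] by simp
  define h where "h = (\<lambda>e. measure T.design_law {W \<in> space T.design_law. T.stat W e \<le> t})"
  have slice: "emeasure DX ((\<lambda>\<xi>. (\<xi>, e)) -` S) = ennreal (h e)" if e: "e \<in> space DE" for e
  proof -
    interpret TD: prob_space T.design_law by (rule T.prob_space_design_law)
    have e': "e \<in> space (borel_vec n)" using e by (simp add: DE_def)
    have "(\<lambda>\<xi>. (\<xi>, e)) -` S \<in> sets PX" using sets_Pair2[OF S] .
    then have "emeasure DX ((\<lambda>\<xi>. (\<xi>, e)) -` S) = emeasure T.design_law (affine_rows n p \<mu> A -` ((\<lambda>\<xi>. (\<xi>, e)) -` S) \<inter> space T.design_law)"
      unfolding DX by (rule emeasure_distr[OF mrow])
    also have "affine_rows n p \<mu> A -` ((\<lambda>\<xi>. (\<xi>, e)) -` S) \<inter> space T.design_law = {W \<in> space T.design_law. T.stat W e \<le> t}"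
      using e' measurable_space[OF mrow] by (auto simp: S_def space_pair_measure stat)
    finally show ?thesis by (simp add: h_def TD.emeasure_eq_measure)
  qed
  have mh: "h \<in> borel_measurable DE"
  proof -
    have "(\<lambda>e. enn2real (emeasure DX ((\<lambda>\<xi>. (\<xi>, e)) -` S))) \<in> borel_measurable DE"
      using PP.measurable_emeasure_Pair2[OF SD] by measurable
    then show ?thesis
      by (rule measurable_cong[THEN iffD1, rotated]) (simp add: slice, simp add: h_def)
  qed
  have mU: "measurable_mat M n (Suc p) (\<lambda>\<omega>. regressor_matrix n p x \<omega>)"
  proof -
    have eq: "regressor_matrix n p (\<lambda>i \<xi>. \<xi> i) (X \<omega>) = regressor_matrix n p x \<omega>" for \<omega>
      by (intro eq_matI) (auto simp: regressor_matrix_def X_def)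
    show ?thesis
      using measurable_mat_compose[OF X measurable_regressor_matrix[of n p, folded PX_def]] unfolding eq .
  qed
  have mY: "measurable_vec M n (\<lambda>\<omega>. vec n (\<lambda>i. y i \<omega>))"
    using measurable_y by (auto simp: measurable_vec_def)
  have mFs: "(\<lambda>\<omega>. F_statistic (regressor_matrix n p x \<omega>) (vec n (\<lambda>i. y i \<omega>)) R0 r0) \<in> borel_measurable M"
    by (rule measurable_F_statistic[OF mU mY R0(1) r0])
  have "measure M {\<omega> \<in> space M. F_statistic (regressor_matrix n p x \<omega>) (vec n (\<lambda>i. y i \<omega>)) R0 r0 \<le> t}
    = measure M {\<omega> \<in> space M. ?F (X \<omega>) (E \<omega>) \<le> t}"
  proof (rule measure_eq_AE)
    show "AE \<omega> in M. \<omega> \<in> {\<omega> \<in> space M. F_statistic (regressor_matrix n p x \<omega>) (vec n (\<lambda>i. y i \<omega>)) R0 r0 \<le> t}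
      \<longleftrightarrow> \<omega> \<in> {\<omega> \<in> space M. ?F (X \<omega>) (E \<omega>) \<le> t}"
      using AE_F_statistic_sample[of R0 r0] by eventually_elim (simp add: X_def E_def)
  qed (use mFs mFw in measurable)
  also have "\<dots> = measure (distr M (PX \<Otimes>\<^sub>M borel_vec n) (\<lambda>\<omega>. (X \<omega>, E \<omega>))) S"
    using measurable_space[OF XE] by (subst measure_distr[OF XE S]) (auto simp: S_def intro!: arg_cong[where f="measure M"])
  also have "\<dots> = measure (DX \<Otimes>\<^sub>M DE) S" unfolding joint DX_def DE_def ..
  also have "\<dots> = DE.expectation h"
  proof -
    have "ennreal (measure (DX \<Otimes>\<^sub>M DE) S) = emeasure (DX \<Otimes>\<^sub>M DE) S" by (simp add: PP.P.emeasure_eq_measure)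
    also have "\<dots> = (\<integral>\<^sup>+e. emeasure DX ((\<lambda>\<xi>. (\<xi>, e)) -` S) \<partial>DE)" by (rule PP.emeasure_pair_measure_alt2[OF SD])
    also have "\<dots> = (\<integral>\<^sup>+e. ennreal (h e) \<partial>DE)" by (rule nn_integral_cong) (rule slice)
    also have "\<dots> = ennreal (DE.expectation h)"
    proof (rule nn_integral_eq_integral)
      have "h e \<le> 1" for e unfolding h_def by (rule prob_space.prob_le_1[OF T.prob_space_design_law])
      then show "integrable DE h" by (intro DE.integrable_const_bound[where B=1, OF _ mh]) (auto simp: h_def)
    qed (simp add: h_def)
    finally show ?thesis by (simp add: integral_nonneg_AE h_def)
  qed
  finally have PF: "measure M {\<omega> \<in> space M. F_statistic (regressor_matrix n p x \<omega>) (vec n (\<lambda>i. y i \<omega>)) R0 r0 \<le> t} = DE.expectation h" .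
  \<comment> \<open>Since \<open>j = p + 1 - q\<close>, the factor of \<open>\<Delta>\<close> in the
    non-centrality is \<open>n - j\<close>, the degrees of freedom of the squared distance of column
    \<open>j\<close> from the previous columns.\<close>
  have Nj: "n - p - 1 + q = n - T.j" "T.j + q + (n - p - 1) = n" "n - p \<le> n - T.j"
    using T.j model_dims q by auto
  define l where "l = measure (std_normal_vec n) {w \<in> space (std_normal_vec n). shifted_F T.j q n (sqrt (\<Delta> * real (n - T.j))) w \<le> t}"
  have lL: "measure L {..t} = l"
    unfolding l_def Nj(1)[symmetric] by (rule measure_noncentral_F[OF L Nj(2)]) (use q in auto)
  define Bad where "Bad = {e \<in> space DE. \<bar>(centered_norm n e)\<^sup>2 / (real (n - 1) * \<sigma>\<^sup>2) - 1\<bar> > \<tau>}"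
  have mdev: "centered_norm n \<in> borel_measurable DE" using measurable_centered_norm by (simp add: DE_def)
  have mBad: "Bad \<in> sets DE" unfolding Bad_def using mdev by measurable
  have "DE.prob Bad = prob {\<omega> \<in> space M. \<bar>(centered_norm n (E \<omega>))\<^sup>2 / (real (n - 1) * \<sigma>\<^sup>2) - 1\<bar> > \<tau>}"
    using measurable_space[OF E] mBad unfolding DE_def
    by (subst measure_distr[OF E]) (auto simp: Bad_def DE_def intro!: arg_cong[where f=prob])
  also have "\<dots> \<le> (16 * K + 4) / (real n * \<tau>\<^sup>2)"
    unfolding E_def by (rule centered_norm_errors_concentration[OF int4 K tau(1-3) E[unfolded E_def]])
  finally have PB: "DE.prob Bad \<le> (16 * K + 4) / (real n * \<tau>\<^sup>2)" .
  define \<eta> where "\<eta> = 2 / (real (n - T.j) * \<tau>\<^sup>2) + 2 / (real (n - 1) * \<tau>\<^sup>2) + 2 * \<delta>"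
  have e1: "\<bar>DE.expectation h - l\<bar> \<le> \<eta> + DE.prob Bad"
  proof (rule DE.abs_expectation_diff_le[OF mh mBad])
    have "7 * \<tau> * sqrt (\<Delta> * real (n - T.j)) \<le> 7 * \<tau> * sqrt (\<Delta> * real n)"
      using D0 tau by (intro mult_left_mono real_sqrt_le_mono) auto
    then have t7: "7 * \<tau> * sqrt (\<Delta> * real (n - T.j)) \<le> \<delta>" using tau(5) by linarith
    have "\<bar>h e - l\<bar> \<le> \<eta>" if "e \<in> space DE" "e \<notin> Bad" for e
      unfolding h_def l_def \<eta>_def
      by (rule T.stat_prob_bound[OF model_dims(5) D0 theta tau(1,2,4) t7]) (use that in \<open>auto simp: Bad_def not_less\<close>)
    then show "AE e in DE. e \<notin> Bad \<longrightarrow> \<bar>h e - l\<bar> \<le> \<eta>" by auto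
    show "0 \<le> h e \<and> h e \<le> 1" for e
      unfolding h_def using prob_space.prob_le_1[OF T.prob_space_design_law] by simp
    show "0 \<le> l" "l \<le> 1"
      unfolding l_def using prob_space.prob_le_1[OF prob_space_std_normal_vec] by simp_all
    show "0 \<le> \<eta>" unfolding \<eta>_def using tau by simp
  qed
  have e2: "\<eta> \<le> 2 / (real (n - p) * \<tau>\<^sup>2) + 2 / (real (n - 1) * \<tau>\<^sup>2) + 2 * \<delta>"
    unfolding \<eta>_def using Nj(3) model_dims tau
    by (intro add_mono order_refl divide_left_mono mult_right_mono mult_pos_pos) auto
  show ?thesis unfolding PF lL by (rule order_trans[OF e1 add_mono[OF e2 PB]])
qed

end

text \<open>As \<open>n - p - 1 + q\<close> is positive, the mere existence of \<open>L n\<close>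
  gives \<open>\<Delta> n \<ge> 0\<close> in the theorem.\<close>

lemma noncentral_F_nonneg: "noncentral_F q m lam L \<Longrightarrow> lam \<ge> 0"
  by (auto simp: noncentral_F_def intro: sum_nonneg)

section \<open>The limit statement: choice of the tolerances for large sample sizes\<close>

theorem corollary3p2:
  fixes M :: "nat \<Rightarrow> 'w measure"
    and p q :: "nat \<Rightarrow> nat"
    and y :: "nat \<Rightarrow> nat \<Rightarrow> 'w \<Rightarrow> real"
    and x :: "nat \<Rightarrow> nat \<Rightarrow> 'w \<Rightarrow> nat \<Rightarrow> real"
    and \<alpha> \<sigma> :: "nat \<Rightarrow> real"
    and \<beta> \<mu> r\<^sub>0 :: "nat \<Rightarrow> real vec"
    and \<Sigma> R\<^sub>0 :: "nat \<Rightarrow> real mat"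
    and L :: "nat \<Rightarrow> real measure"
  defines "\<epsilon> \<equiv> \<lambda>n i. model_error (M n) (p n) (x n i) (y n i)"
    and "\<Delta> \<equiv> \<lambda>n. Delta_gamma (second_moment_matrix (p n) (\<mu> n) (\<Sigma> n)) (R\<^sub>0 n) (r\<^sub>0 n)
                   (vCons (\<alpha> n) (\<beta> n)) (\<sigma> n)"
    and "F \<equiv> \<lambda>n \<omega>. F_statistic (regressor_matrix n (p n) (x n) \<omega>) (vec n (\<lambda>i. y n i \<omega>))
                   (R\<^sub>0 n) (r\<^sub>0 n)"
  assumes model: "\<And>n. n \<ge> 3 \<Longrightarrow>
      linear_homoskedastic_model (M n) n (p n) (y n) (x n) (\<alpha> n) (\<beta> n) (\<sigma> n)"
    and mean: "\<And>n. n \<ge> 3 \<Longrightarrow> \<mu> n = mean_vector (M n) (p n) (x n 0)"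
    and cov: "\<And>n. n \<ge> 3 \<Longrightarrow> \<Sigma> n = covariance_matrix (M n) (p n) (x n 0)"
    and pos_def: "\<And>n. n \<ge> 3 \<Longrightarrow> positive_definite (p n) (\<Sigma> n)"
    and gaussian: "\<And>n i. n \<ge> 3 \<Longrightarrow> i < n \<Longrightarrow>
      gaussian_vector (M n) (p n) (x n i) (\<mu> n) (\<Sigma> n)"
    and indep_design_errors: "\<And>n. n \<ge> 3 \<Longrightarrow>
      independent_rv (M n)
        (PiM {..<n} (\<lambda>_. borel_vec (p n))) (\<lambda>\<omega>. \<lambda>i\<in>{..<n}. x n i \<omega>)
        (borel_vec n) (\<lambda>\<omega>. \<lambda>i\<in>{..<n}. \<epsilon> n i \<omega>)"
    and fourth_moment_finite:
      "\<forall>\<^sub>F n in sequentially. integrable (M n) (\<lambda>\<omega>. (\<epsilon> n 0 \<omega> / \<sigma> n) ^ 4)"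
    and fourth_moment_bounded:
      "(\<lambda>n. \<integral>\<omega>. (\<epsilon> n 0 \<omega> / \<sigma> n) ^ 4 \<partial>M n) \<in> O(\<lambda>_. 1)"
    and q: "\<And>n. n \<ge> 3 \<Longrightarrow> 1 \<le> q n \<and> q n \<le> p n + 1"
    and R0_dim: "\<And>n. n \<ge> 3 \<Longrightarrow> R\<^sub>0 n \<in> carrier_mat (q n) (p n + 1)"
    and R0_rank: "\<And>n. n \<ge> 3 \<Longrightarrow> vec_space.rank (q n) (R\<^sub>0 n) = q n"
    and R0_orthonormal: "\<And>n. n \<ge> 3 \<Longrightarrow> R\<^sub>0 n * (R\<^sub>0 n)\<^sup>T = 1\<^sub>m (q n)"
    and r0_dim: "\<And>n. n \<ge> 3 \<Longrightarrow> r\<^sub>0 n \<in> carrier_vec (q n)"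
    and limsup_p: "limsup (\<lambda>n. ereal (real (p n) / real n)) < 1"
    and Delta_small: "\<Delta> \<in> o(\<lambda>n. real (q n) / real n)"
    and no_intercept: "\<And>n. n \<ge> 3 \<Longrightarrow> col (R\<^sub>0 n) 0 = 0\<^sub>v (q n)"
    and L: "\<And>n. n \<ge> 3 \<Longrightarrow>
      noncentral_F (q n) (n - p n - 1) (\<Delta> n * real (n - p n - 1 + q n)) (L n)"
  shows "(\<lambda>n. SUP t. \<bar>measure (M n) {\<omega> \<in> space (M n). F n \<omega> \<le> t} - measure (L n) {..t}\<bar>)
           \<longlonglongrightarrow> 0"
proof -
  \<comment> \<open>The bound \<open>q n \<le> p n + 1 < n\<close> keeps the ratio
    \<open>q n / n\<close> at most 1.\<close>
  have \<Delta>_tendsto: "\<Delta> \<longlonglongrightarrow> 0"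
  proof (rule LIMSEQ_I)
    fix r :: real assume r: "0 < r"
    have "\<forall>\<^sub>F n in sequentially. norm (\<Delta> n) \<le> r / 2 * norm (real (q n) / real n)"
      using landau_o.smallD[OF Delta_small, of "r / 2"] r by simp
    moreover have "\<forall>\<^sub>F n in sequentially. n \<ge> 3" by (rule eventually_ge_at_top)
    ultimately have "\<forall>\<^sub>F n in sequentially. norm (\<Delta> n - 0) < r"
    proof eventually_elim
      case (elim n)
      interpret homoskedastic_sample "M n" n "p n" "y n" "x n" "\<alpha> n" "\<beta> n" "\<sigma> n"
        by unfold_locales (rule model[OF elim(2)])
      have "real (q n) \<le> real n" using q[OF elim(2)] model_dims by simp
      then have "norm (real (q n) / real n) \<le> 1" by (simp add: divide_le_eq)
      then have "r / 2 * norm (real (q n) / real n) \<le> r / 2 * 1" using r by (intro mult_left_mono) auto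
      then show ?case using elim r by simp
    qed
    then show "\<exists>no. \<forall>n\<ge>no. norm (\<Delta> n - 0) < r" by (simp add: eventually_sequentially)
  qed
  obtain K where K: "K > 0" "\<forall>\<^sub>F n in sequentially. norm (\<integral>\<omega>. (\<epsilon> n 0 \<omega> / \<sigma> n) ^ 4 \<partial>M n) \<le> K"
    using fourth_moment_bounded by (auto elim!: landau_o.bigE)
  obtain c' where c': "limsup (\<lambda>n. ereal (real (p n) / real n)) < c'" "c' < 1"
    using dense[OF limsup_p] by blast
  \<comment> \<open>Excludes minus infinity, so that \<open>c'\<close> can be read as a real
    number.\<close>
  have c'0: "\<not> c' < 0"
  proof
    assume "c' < 0"
    then have "limsup (\<lambda>n. ereal (real (p n) / real n)) < 0" using c'(1) by simp
    then have "\<forall>\<^sub>F n in sequentially. ereal (real (p n) / real n) < 0" by (rule Limsup_lessD)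
    then show False by (auto simp: eventually_sequentially divide_less_0_iff)
  qed
  obtain c where c: "c' = ereal c" using c'(2) c'0 by (cases c') auto
  have c1: "c < 1" using c'(2) c by simp
  have pc: "\<forall>\<^sub>F n in sequentially. real (p n) / real n < c"
    using Limsup_lessD[OF c'(1)] c by simp
  define D where "D = (\<lambda>n. SUP t. \<bar>measure (M n) {\<omega> \<in> space (M n). F n \<omega> \<le> t} - measure (L n) {..t}\<bar>)"
  have "D \<longlonglongrightarrow> 0"
  proof (rule LIMSEQ_I)
    fix r :: real assume r: "0 < r"
    \<comment> \<open>The term \<open>2 * \<delta>\<close> becomes \<open>r / 4\<close>; the
      remaining terms are made smaller than another \<open>r / 4\<close>.\<close>
    define \<delta> where "\<delta> = r / 8"
    have d: "\<delta> > 0" using r by (simp add: \<delta>_def)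
    \<comment> \<open>This is \<open>1 / (n * \<tau>\<^sup>2)\<close> for the \<open>\<tau>\<close>
      chosen below, the common order of all exceptional probabilities.\<close>
    define \<rho> where "\<rho> = (\<lambda>n. 4 / real n + 49 * \<Delta> n / \<delta>\<^sup>2)"
    \<comment> \<open>The three parts come from \<open>n - p n \<ge> (1 - c) * n\<close>, from
      \<open>n - 1 \<ge> n / 2\<close> and from the fourth moments.\<close>
    define C where "C = 2 / (1 - c) + 4 + (16 * K + 4)"
    have C: "C > 0" using c1 K by (simp add: C_def add_pos_pos)
    have "\<rho> \<longlonglongrightarrow> 0 + 49 * 0 / \<delta>\<^sup>2"
      unfolding \<rho>_def using d by (intro tendsto_intros \<Delta>_tendsto lim_const_over_n) auto
    then have \<rho>: "\<rho> \<longlonglongrightarrow> 0" by simp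
    \<comment> \<open>The bound \<open>1 / 4\<close> yields
      \<open>n * \<tau>\<^sup>2 \<ge> 4\<close>; the other bound makes \<open>C * \<rho> n\<close>
      smaller than \<open>r / 4\<close>.\<close>
    have ev1: "\<forall>\<^sub>F n in sequentially. \<rho> n < min (1 / 4) (r / (4 * C))"
      by (rule order_tendstoD(2)[OF \<rho>]) (use r C in auto)
    have ev2: "\<forall>\<^sub>F n in sequentially. n \<ge> 3" by (rule eventually_ge_at_top)
    from ev1 ev2 pc K(2) fourth_moment_finite
    have "\<forall>\<^sub>F n in sequentially. norm (D n - 0) < r"
    proof eventually_elim
      case (elim n)
      note n3 = elim(2)
      interpret homoskedastic_sample "M n" n "p n" "y n" "x n" "\<alpha> n" "\<beta> n" "\<sigma> n"
        by unfold_locales (rule model[OF n3])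
      have qn: "1 \<le> q n" "q n \<le> Suc (p n)" using q[OF n3] by auto
      have D0: "\<Delta> n \<ge> 0"
      proof -
        have "real (n - p n - 1 + q n) > 0" using qn by simp
        then show ?thesis using noncentral_F_nonneg[OF L[OF n3]] by (simp add: zero_le_mult_iff)
      qed
      \<comment> \<open>With \<open>\<tau> = 1 / sqrt \<kappa>\<close>, the summand 4 ensures
        \<open>\<tau> \<le> 1 / 2\<close>. The other summand is what
        \<open>7 * \<tau> * sqrt (\<Delta> n * n) \<le> \<delta>\<close> requires after
        squaring.\<close>
      define \<kappa> where "\<kappa> = 4 + 49 * \<Delta> n * real n / \<delta>\<^sup>2"
      have \<kappa>: "\<kappa> \<ge> 4" using D0 by (simp add: \<kappa>_def)
      define \<tau> where "\<tau> = 1 / sqrt \<kappa>"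
      have \<tau>: "\<tau> > 0" using \<kappa> by (simp add: \<tau>_def)
      have \<tau>2: "\<tau>\<^sup>2 = 1 / \<kappa>" using \<kappa> by (simp add: \<tau>_def power_divide)
      have np: "real n > 0" using n3 by simp
      have \<rho>n: "\<rho> n = \<kappa> / real n" using np by (simp add: \<rho>_def \<kappa>_def add_divide_distrib)
      have \<rho>0: "\<rho> n > 0" using \<kappa> np by (simp add: \<rho>n)
      have \<tau>1: "\<tau> \<le> 1 / 2"
      proof -
        have "sqrt 4 \<le> sqrt \<kappa>" using \<kappa> by (rule real_sqrt_le_mono)
        then have "2 \<le> sqrt \<kappa>" by simp
        then show ?thesis unfolding \<tau>_def using \<kappa> by (intro divide_left_mono) auto
      qed
      have n\<tau>: "real n * \<tau> \<ge> 4"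
      proof -
        have "4 \<le> real n * \<tau>\<^sup>2" using elim(1) \<rho>0 \<kappa> np by (simp add: \<tau>2 \<rho>n field_simps)
        also have "\<dots> \<le> real n * \<tau>"
        proof (rule mult_left_mono)
          have "\<tau> * \<tau> \<le> \<tau> * 1" using \<tau> \<tau>1 by (intro mult_left_mono) auto
          then show "\<tau>\<^sup>2 \<le> \<tau>" by (simp add: power2_eq_square)
        qed simp
        finally show ?thesis .
      qed
      have small: "7 * \<tau> * sqrt (\<Delta> n * real n) \<le> \<delta>"
      proof (rule power2_le_imp_le)
        have "(7 * \<tau> * sqrt (\<Delta> n * real n))\<^sup>2 = 49 * \<Delta> n * real n / \<kappa>"
          using D0 by (simp add: power_mult_distrib \<tau>2)
        also have "\<dots> \<le> \<delta>\<^sup>2"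
          using \<kappa> d by (simp add: pos_divide_le_eq) (simp add: \<kappa>_def field_simps)
        finally show "(7 * \<tau> * sqrt (\<Delta> n * real n))\<^sup>2 \<le> \<delta>\<^sup>2" .
      qed (use d in simp)
      have Kn: "(\<integral>\<omega>. (\<epsilon> n 0 \<omega> / \<sigma> n) ^ 4 \<partial>M n) \<le> K" using elim(4) by simp
      have R0n: "R\<^sub>0 n \<in> carrier_mat (q n) (Suc (p n))" using R0_dim[OF n3] by simp
      have bound: "\<bar>measure (M n) {\<omega> \<in> space (M n). F n \<omega> \<le> t} - measure (L n) {..t}\<bar>
        \<le> 2 / (real (n - p n) * \<tau>\<^sup>2) + 2 / (real (n - 1) * \<tau>\<^sup>2) + 2 * \<delta> + (16 * K + 4) / (real n * \<tau>\<^sup>2)" for t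
        unfolding F_def
        by (rule F_statistic_noncentral_bound[OF pos_def[OF n3] gaussian[OF n3 model_dims(3)]
              indep_design_errors[OF n3, unfolded \<epsilon>_def] elim(5)[unfolded \<epsilon>_def] Kn[unfolded \<epsilon>_def]
              qn R0n R0_orthonormal[OF n3] no_intercept[OF n3] r0_dim[OF n3]
              L[OF n3, unfolded \<Delta>_def] \<tau> \<tau>1 n\<tau> d small[unfolded \<Delta>_def]])
      have inv: "a / (real m * \<tau>\<^sup>2) \<le> a * b * \<rho> n" if "a \<ge> 0" "b > 0" "real m \<ge> real n / b" for a b :: real and m :: nat
      proof -
        have "0 < real n / b" using that np by simp
        then have "0 < real m" using that by linarith
        then have "a / (real m * \<tau>\<^sup>2) \<le> a / (real n / b * \<tau>\<^sup>2)"
          using that \<tau> np by (intro divide_left_mono mult_right_mono mult_pos_pos) auto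
        also have "\<dots> = a * b * \<rho> n" using that \<kappa> np by (simp add: \<tau>2 \<rho>n)
        finally show ?thesis .
      qed
      have "2 / (real (n - p n) * \<tau>\<^sup>2) \<le> 2 * (1 / (1 - c)) * \<rho> n"
      proof (rule inv)
        have "real (p n) < c * real n" using elim(3) np by (simp add: divide_less_eq)
        moreover have "real (n - p n) = real n - real (p n)" using model_dims by (simp add: of_nat_diff)
        ultimately show "real n / (1 / (1 - c)) \<le> real (n - p n)" by (simp add: algebra_simps)
      qed (use c1 in auto)
      moreover have "2 / (real (n - 1) * \<tau>\<^sup>2) \<le> 2 * 2 * \<rho> n"
        by (rule inv) (use n3 in auto)
      moreover have "(16 * K + 4) / (real n * \<tau>\<^sup>2) \<le> (16 * K + 4) * 1 * \<rho> n"
        by (rule inv) (use K in auto)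
      ultimately have sum: "2 / (real (n - p n) * \<tau>\<^sup>2) + 2 / (real (n - 1) * \<tau>\<^sup>2) + 2 * \<delta> + (16 * K + 4) / (real n * \<tau>\<^sup>2)
        \<le> C * \<rho> n + 2 * \<delta>" by (simp add: C_def algebra_simps)
      have "C * \<rho> n < C * (r / (4 * C))" using elim(1) C by (intro mult_strict_left_mono) auto
      then have "C * \<rho> n < r / 4" using C by simp
      then have le: "\<bar>measure (M n) {\<omega> \<in> space (M n). F n \<omega> \<le> t} - measure (L n) {..t}\<bar> \<le> r / 2" for t
        using bound[of t] sum by (simp add: \<delta>_def)
      have "D n \<le> r / 2" unfolding D_def by (rule cSUP_least) (use le in auto)
      moreover have "0 \<le> D n"
        unfolding D_def by (rule cSUP_upper2[of _ _ 0]) (use le in \<open>auto intro!: bdd_aboveI2[where M="r / 2"]\<close>)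
      ultimately show ?case using r by simp
    qed
    then show "\<exists>no. \<forall>n\<ge>no. norm (D n - 0) < r" by (simp add: eventually_sequentially)
  qed
  then show ?thesis unfolding D_def .
qed

end
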